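(* Problem 1C in the presence of possibly complex minimum-phase invariant zeros (stated in the context) is solvable if and only if there exist $\nu_{0,0},\nu_{0,1},\nu_{0,3},\ldots,\nu_{0,2c-1}\in\mathbb N$ such that $\nu_{0,0}+2\nu_{0,1}+2\nu_{0,3}+\cdots+2\nu_{0,2c-1}=\nu_0$ and $$\dim\Big(\sum_{i\in Q_0}\mathcal E_{g,0}+\sum_{i\in Q}\mathcal E_{g,i}+\sum_{i\in Q'}\overline{\mathcal E}_{g,i}+\sum_{i\in P}\mathcal R^{\star c}_i\Big)\ge\sum_{i\in Q_0}\nu_{0,i}+\sum_{i\in Q}\nu_{0,i}+\sum_{i\in Q'}\nu_{0,i}+\sum_{i\in P}\nu_i$$ for all $Q_0\in2^{J_0}$ with $J_0=\{0\}$, all $Q,Q'\in2^J$ with $J=\{1,3,\ldots,2c-1\}$, and all $P\in2^I$ with $I=\{1,2,\ldots,p\}$, where $\mathcal R^{\star c}_i=\operatorname{span}_{\mathbb C}\mathcal R^\star_i$ and dimensions are over $\mathbb C$.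
   Context: System: $\Sigma=(A,B,C,D)$ is $\mathcal D x=Ax+Bu$, $y=Cx+Du$, $x(t)\in\mathbb R^n$, $u(t)\in\mathbb R^m$, $y(t)\in\mathbb R^p$, real matrices; $\mathcal D x=\dot x$ (continuous time) or $x(t+1)$ (discrete time). $\mathbb C_g$ is the open left half-plane (continuous) or open unit disc (discrete). $\mathcal Z$ is the set of invariant zeros of $\Sigma$: those $\lambda\in\mathbb C$ at which the rank of $\begin{bmatrix}A-\lambda I&B\\C&D\end{bmatrix}$ is below its normal rank; minimum-phase zeros are those in $\mathbb C_g$. $\mathcal Z_{g,\mathbb C}$ is the set of invariant zeros in $\mathbb C_g\setminus\mathbb R$, consisting of $c$ complex conjugate pairs, indexed as $z_1,\ldots,z_{2c}$ with $z_{i+1}=\overline z_i$ for odd $i$. Standing assumptions: $\Sigma$ is right invertible (that matrix pencil has full row rank for all but finitely many $\lambda$), stabilizable, with no invariant zero at $0$ (continuous) or $1$ (discrete); algebraic and geometric multiplicities of each minimum-phase invariant zero coincide; no Jordan chains are allowed in the closed loop ($A+BF$ diagonalizable). The freely selected eigenvalues are real, but minimum-phase invariant zeros may be complex. $\mathbb N$ includes $0$. Control: $u=Fx+Gr$, $F$ real with $\sigma(A+BF)\subset\mathbb C_g$, $G$ a right inverse of the closed-loop static gain. For constant $r$, $\epsilon=y-r$ satisfies $\mathcal D\xi=(A+BF)\xi$, $\epsilon=(C+DF)\xi$. State-to-output decoupling: for any initial condition, $\epsilon_i(t)=\sum_{j=1}^{\nu_i}\beta_{i,j}e^{\lambda_{i,j}t}$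 (resp. $\sum_j\beta_{i,j}\lambda_{i,j}^t$), $i=1,\ldots,p$, where the $\lambda_{i,j}$ are the observable closed-loop eigenvalues and the $\beta_{i,j}$ can be made arbitrary by choice of $\xi(0)$ (subject to $\beta_{i,k}=\overline\beta_{i,j}$ for conjugate pairs $\lambda_{i,k}=\overline\lambda_{i,j}$). That is, $A+BF$ has a basis of eigenvectors $v_{0,1},\ldots,v_{0,\nu_0},v_{1,1},\ldots,v_{p,\nu_p}$ (real for real eigenvalues, in conjugate pairs otherwise) with eigenvalues $\lambda_{i,j}$ such that $(C+DF)v_{0,j}=0$ and $(C+DF)v_{i,j}$ is a nonzero multiple of the $i$-th canonical vector $e_i\in\mathbb R^p$ for $i\ge1$; the $\lambda_{i,j}$ ($1\le j\le\nu_i$) are the eigenvalues observable from $\epsilon_i$ and the $\lambda_{0,j}$ the unobservable ones. Problem 1C: given nonnegative integers $\nu_1,\ldots,\nu_p$ with $\nu_0=n-\sum_i\nu_i\ge0$, find $F,G$ such that: (1) $y(t)\to\bar r$ for every constant reference $r(t)=\bar r$; (2) state-to-output decoupling is achieved; (3) from each $\epsilon_i$ exactly $\nu_i$ eigenvalues are observable and they are not invariant zeros; neither the observable nor the unobservable eigenvalues are assigned a priori (the unobservable ones may be invariant zeros). Solvable means such $F,G$ exist. Sets: for $\lambda\in\mathbb C$, $\mathcal R(\lambda)=\{v\in\mathbb C^n\mid\exists w\in\mathbb C^m:\ (A-\lambda I)v+Bw=0,\ Cv+Dw=0\}$. $E_{g,0}=\bigcup_{\lambda\in\mathbb C_g\setminus\mathcal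 Z_{g,\mathbb C}}\mathcal R(\lambda)$, $E_{g,i}=\mathcal R(z_i)$ for $i=1,\ldots,2c$, so that $E_{g,i+1}=\overline{E}_{g,i}$ for odd $i$; $\mathcal E_{g,i}=\operatorname{span}_{\mathbb C}E_{g,i}$ and $\overline{\mathcal E}_{g,i}$ is its complex conjugate. $\mathcal R^\star_i\subseteq\mathbb R^n$ is the supremal output-nulling reachability subspace of $(A,B,C_{(i)},D_{(i)})$, where $C_{(i)},D_{(i)}$ are $C,D$ with the $i$-th row removed. *)

theory Defs
  imports
    "HOL-Analysis.Analysis"
    "HOL-Library.Set_Algebras"
    "HOL-Computational_Algebra.Computational_Algebra"
    "HOL-Computational_Algebra.Field_as_Ring"
begin

datatype time_domain = Continuous | Discrete

definition stable_region :: "time_domain \<Rightarrow> complex set" where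
  "stable_region T = (case T of Continuous \<Rightarrow> {s. Re s < 0} | Discrete \<Rightarrow> {s. norm s < 1})"

text \<open>The value of the transform variable that corresponds to constant signals.\<close>

definition dc_point :: "time_domain \<Rightarrow> real" where
  "dc_point T = (case T of Continuous \<Rightarrow> 0 | Discrete \<Rightarrow> 1)"


definition cvec :: "real^'n \<Rightarrow> complex^'n" where
  "cvec x = (\<chi> i. complex_of_real (x $ i))"

definition cmat :: "real^'n^'m \<Rightarrow> complex^'n^'m" where
  "cmat M = map_matrix complex_of_real M"

definition conj_vec :: "complex^'n \<Rightarrow> complex^'n" where
  "conj_vec v = (\<chi> i. cnj (v $ i))"

definition eigenvalues :: "real^'n^'n \<Rightarrow> complex set" where
  "eigenvalues M = {s. \<exists>v. v \<noteq> 0 \<and> cmat M *v v = s *s v}"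


text \<open>The system pencil with rows \<open>[A - s I, B]\<close> and \<open>[C, D]\<close>. The coefficient embedding
  \<open>h\<close> lets the same matrix be formed over the complex numbers and over the polynomials.\<close>

definition rosenbrock ::
  "(real \<Rightarrow> 'a::comm_ring_1) \<Rightarrow> real^'n^'n \<Rightarrow> real^'m^'n \<Rightarrow> real^'n^'p \<Rightarrow> real^'m^'p \<Rightarrow> 'a
    \<Rightarrow> 'a^('n + 'm)^('n + 'p)" where
  "rosenbrock h A B C D s = (\<chi> i j.
     case i of
       Inl k \<Rightarrow> (case j of Inl l \<Rightarrow> h (A $ k $ l) - (if k = l then s else 0) | Inr l \<Rightarrow> h (B $ k $ l))
     | Inr k \<Rightarrow> (case j of Inl l \<Rightarrow> h (C $ k $ l) | Inr l \<Rightarrow> h (D $ k $ l)))"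

definition pencil ::
  "real^'n^'n \<Rightarrow> real^'m^'n \<Rightarrow> real^'n^'p \<Rightarrow> real^'m^'p \<Rightarrow> complex \<Rightarrow> complex^('n + 'm)^('n + 'p)" where
  "pencil A B C D s = rosenbrock complex_of_real A B C D s"

definition pencil_poly ::
  "real^'n^'n \<Rightarrow> real^'m^'n \<Rightarrow> real^'n^'p \<Rightarrow> real^'m^'p \<Rightarrow> complex poly^('n + 'm)^('n + 'p)" where
  "pencil_poly A B C D = rosenbrock (\<lambda>a. [:complex_of_real a:]) A B C D [:0, 1:]"

definition normal_rank :: "real^'n^'n \<Rightarrow> real^'m^'n \<Rightarrow> real^'n^'p \<Rightarrow> real^'m^'p \<Rightarrow> nat" where
  "normal_rank A B C D = Max (range (\<lambda>s. rank (pencil A B C D s)))"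

definition invariant_zeros :: "real^'n^'n \<Rightarrow> real^'m^'n \<Rightarrow> real^'n^'p \<Rightarrow> real^'m^'p \<Rightarrow> complex set" where
  "invariant_zeros A B C D = {s. rank (pencil A B C D s) < normal_rank A B C D}"

definition nonreal_stable_zeros ::
  "time_domain \<Rightarrow> real^'n^'n \<Rightarrow> real^'m^'n \<Rightarrow> real^'n^'p \<Rightarrow> real^'m^'p \<Rightarrow> complex set" where
  "nonreal_stable_zeros T A B C D = invariant_zeros A B C D \<inter> (stable_region T - \<real>)"

text \<open>The number of invariant polynomials in the Smith form of the pencil that vanish at \<open>s\<close>.\<close>

definition geometric_mult ::
  "real^'n^'n \<Rightarrow> real^'m^'n \<Rightarrow> real^'n^'p \<Rightarrow> real^'m^'p \<Rightarrow> complex \<Rightarrow> nat" where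
  "geometric_mult A B C D s = normal_rank A B C D - rank (pencil A B C D s)"

definition minors :: "nat \<Rightarrow> 'a::comm_ring_1^'c^'r \<Rightarrow> 'a set" where
  "minors r P = {\<Sum>\<sigma> | \<sigma> permutes {..<r}. of_int (sign \<sigma>) * (\<Prod>i<r. P $ f i $ g (\<sigma> i)) | f g.
     inj_on f {..<r} \<and> inj_on g {..<r}}"

text \<open>The product of the invariant polynomials of the pencil (the zero polynomial of the
  system) is the greatest common divisor of its minors of order equal to the normal rank.\<close>

definition algebraic_mult ::
  "real^'n^'n \<Rightarrow> real^'m^'n \<Rightarrow> real^'n^'p \<Rightarrow> real^'m^'p \<Rightarrow> complex \<Rightarrow> nat" where
  "algebraic_mult A B C D s = order s (Gcd (minors (normal_rank A B C D) (pencil_poly A B C D)))"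

definition right_invertible :: "real^'n^'n \<Rightarrow> real^'m^'n \<Rightarrow> real^'n^'p \<Rightarrow> real^'m^'p \<Rightarrow> bool" where
  "right_invertible A B C D \<longleftrightarrow> finite {s. rank (pencil A B C D s) \<noteq> CARD('n) + CARD('p)}"

definition stabilizable :: "time_domain \<Rightarrow> real^'n^'n \<Rightarrow> real^'m^'n \<Rightarrow> bool" where
  "stabilizable T A B \<longleftrightarrow> (\<exists>F. eigenvalues (A + B ** F) \<subseteq> stable_region T)"


text \<open>The closed loop is \<open>u = F x + G r\<close> with constant \<open>r\<close>. Powers of square matrices are
  written as iterates of the associated maps, since \<open>(^)\<close> on \<^typ>\<open>real^'n^'n\<close> is componentwise.\<close>

definition closed_loop_dc_gain ::
  "time_domain \<Rightarrow> real^'n^'n \<Rightarrow> real^'m^'n \<Rightarrow> real^'n^'p \<Rightarrow> real^'m^'p \<Rightarrow> real^'n^'m \<Rightarrow> real^'m^'p" where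
  "closed_loop_dc_gain T A B C D F =
     (C + D ** F) ** matrix_inv (mat (dc_point T) - (A + B ** F)) ** B + D"

definition tracks_constants ::
  "time_domain \<Rightarrow> real^'n^'n \<Rightarrow> real^'m^'n \<Rightarrow> real^'n^'p \<Rightarrow> real^'m^'p
    \<Rightarrow> real^'n^'m \<Rightarrow> real^'p^'m \<Rightarrow> bool" where
  "tracks_constants T A B C D F G \<longleftrightarrow>
     (case T of
        Continuous \<Rightarrow>
          \<forall>r (x :: real \<Rightarrow> real^'n) u y.
            (\<forall>t\<ge>0. (x has_vector_derivative A *v x t + B *v u t) (at t within {0..}) \<and>
                   u t = F *v x t + G *v r \<and>
                   y t = C *v x t + D *v u t)
            \<longrightarrow> (y \<longlongrightarrow> r) at_top
      | Discrete \<Rightarrow>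
          \<forall>r (x :: nat \<Rightarrow> real^'n) u y.
            (\<forall>t. x (Suc t) = A *v x t + B *v u t \<and>
                 u t = F *v x t + G *v r \<and>
                 y t = C *v x t + D *v u t)
            \<longrightarrow> y \<longlonglongrightarrow> r)"

text \<open>Closed-loop modes are indexed by pairs: \<open>(Some i, j)\<close> with \<open>j < \<nu> i\<close> is the \<open>j\<close>-th mode
  seen at the \<open>i\<close>-th output, and \<open>(None, j)\<close> with \<open>j < \<nu>\<^sub>0\<close> is the \<open>j\<close>-th unobservable mode.\<close>

definition mode_indices :: "nat \<Rightarrow> ('p \<Rightarrow> nat) \<Rightarrow> ('p option \<times> nat) set" where
  "mode_indices \<nu>\<^sub>0 \<nu> = {(k, j). j < (case k of None \<Rightarrow> \<nu>\<^sub>0 | Some i \<Rightarrow> \<nu> i)}"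

definition decoupling_eigenbasis ::
  "real^'n^'n \<Rightarrow> real^'m^'n \<Rightarrow> real^'n^'p \<Rightarrow> real^'m^'p \<Rightarrow> real^'n^'m \<Rightarrow> nat \<Rightarrow> ('p \<Rightarrow> nat)
    \<Rightarrow> ('p option \<times> nat \<Rightarrow> complex) \<Rightarrow> ('p option \<times> nat \<Rightarrow> complex^'n) \<Rightarrow> bool" where
  "decoupling_eigenbasis A B C D F \<nu>\<^sub>0 \<nu> \<mu> v \<longleftrightarrow>
     (let I = mode_indices \<nu>\<^sub>0 \<nu> in
       inj_on v I \<and> vec.independent (v ` I) \<and> vec.span (v ` I) = UNIV \<and>
       (\<forall>a\<in>I. cmat (A + B ** F) *v v a = \<mu> a *s v a) \<and>
       (\<forall>a\<in>I. if \<mu> a \<in> \<real> then conj_vec (v a) = v a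
              else \<exists>b\<in>I. fst b = fst a \<and> \<mu> b = cnj (\<mu> a) \<and> v b = conj_vec (v a)) \<and>
       (\<forall>j<\<nu>\<^sub>0. cmat (C + D ** F) *v v (None, j) = 0) \<and>
       (\<forall>i. \<forall>j<\<nu> i. \<exists>\<alpha>. \<alpha> \<noteq> 0 \<and> cmat (C + D ** F) *v v (Some i, j) = \<alpha> *s axis i 1))"

definition observable_eigenvalues ::
  "real^'n^'n \<Rightarrow> real^'m^'n \<Rightarrow> real^'n^'p \<Rightarrow> real^'m^'p \<Rightarrow> real^'n^'m \<Rightarrow> 'p \<Rightarrow> complex set" where
  "observable_eigenvalues A B C D F i =
     {s. \<exists>v. cmat (A + B ** F) *v v = s *s v \<and> (cmat (C + D ** F) *v v) $ i \<noteq> 0}"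

text \<open>Two modes with the same eigenvalue at the same output combine into an unobservable mode, so
  exactly \<open>\<nu> i\<close> eigenvalues are observable from output \<open>i\<close> only if the \<open>\<mu> (Some i, j)\<close> are
  distinct; this is the injectivity part of \<^const>\<open>bij_betw\<close> below.

  The last conjunct says that the freely selected eigenvalues are real. An eigenvalue that
  is not an invariant zero is freely selected: right invertibility makes every uncontrollable
  eigenvalue an invariant zero.\<close>

definition problem_1C_solvable ::
  "time_domain \<Rightarrow> real^'n^'n \<Rightarrow> real^'m^'n \<Rightarrow> real^'n^'p \<Rightarrow> real^'m^'p \<Rightarrow> nat \<Rightarrow> ('p \<Rightarrow> nat) \<Rightarrow> bool" where
  "problem_1C_solvable T A B C D \<nu>\<^sub>0 \<nu> \<longleftrightarrow>
     (\<exists>F G.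
        eigenvalues (A + B ** F) \<subseteq> stable_region T \<and>
        closed_loop_dc_gain T A B C D F ** G = mat 1 \<and>
        tracks_constants T A B C D F G \<and>
        (\<exists>\<mu> v.
           decoupling_eigenbasis A B C D F \<nu>\<^sub>0 \<nu> \<mu> v \<and>
           (\<forall>i. bij_betw (\<lambda>j. \<mu> (Some i, j)) {..<\<nu> i} (observable_eigenvalues A B C D F i))) \<and>
        (\<forall>i. observable_eigenvalues A B C D F i \<inter> invariant_zeros A B C D = {}) \<and>
        eigenvalues (A + B ** F) - invariant_zeros A B C D \<subseteq> \<real>)"


definition null_directions ::
  "real^'n^'n \<Rightarrow> real^'m^'n \<Rightarrow> real^'n^'p \<Rightarrow> real^'m^'p \<Rightarrow> complex \<Rightarrow> (complex^'n) set" where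
  "null_directions A B C D s =
     {v. \<exists>w. (cmat A - mat s) *v v + cmat B *v w = 0 \<and> cmat C *v v + cmat D *v w = 0}"

text \<open>In the next two definitions \<open>z\<close> lists the invariant zeros in \<^const>\<open>nonreal_stable_zeros\<close>
  from index 1 on.\<close>

definition E_set ::
  "time_domain \<Rightarrow> real^'n^'n \<Rightarrow> real^'m^'n \<Rightarrow> real^'n^'p \<Rightarrow> real^'m^'p \<Rightarrow> (nat \<Rightarrow> complex)
    \<Rightarrow> nat \<Rightarrow> (complex^'n) set" where
  "E_set T A B C D z i =
     (if i = 0
      then \<Union>s \<in> stable_region T - nonreal_stable_zeros T A B C D. null_directions A B C D s
      else null_directions A B C D (z i))"

definition E_space ::
  "time_domain \<Rightarrow> real^'n^'n \<Rightarrow> real^'m^'n \<Rightarrow> real^'n^'p \<Rightarrow> real^'m^'p \<Rightarrow> (nat \<Rightarrow> complex)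
    \<Rightarrow> nat \<Rightarrow> (complex^'n) set" where
  "E_space T A B C D z i = vec.span (E_set T A B C D z i)"


definition reachable_subspace :: "real^'n^'n \<Rightarrow> real^'m^'n \<Rightarrow> (real^'n) set" where
  "reachable_subspace A B = span (\<Union>k. range (\<lambda>u. (((*v) A) ^^ k) (B *v u)))"

text \<open>Reachability subspaces are those of the form \<open>\<langle>A + B F | im (B L)\<rangle>\<close>. Only the outputs in
  \<open>S\<close> are required to vanish, which amounts to removing the rows of \<open>C\<close> and \<open>D\<close> outside \<open>S\<close>.\<close>

definition output_nulling_reachability_subspaces ::
  "real^'n^'n \<Rightarrow> real^'m^'n \<Rightarrow> real^'n^'p \<Rightarrow> real^'m^'p \<Rightarrow> 'p set \<Rightarrow> (real^'n) set set" where
  "output_nulling_reachability_subspaces A B C D S =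
     {reachable_subspace (A + B ** F) (B ** L) | (F :: real^'n^'m) (L :: real^'m^'m).
        (\<forall>x \<in> reachable_subspace (A + B ** F) (B ** L). \<forall>j\<in>S. ((C + D ** F) *v x) $ j = 0) \<and>
        (\<forall>u. \<forall>j\<in>S. ((D ** L) *v u) $ j = 0)}"

definition R_star ::
  "real^'n^'n \<Rightarrow> real^'m^'n \<Rightarrow> real^'n^'p \<Rightarrow> real^'m^'p \<Rightarrow> 'p \<Rightarrow> (real^'n) set" where
  "R_star A B C D i = span (\<Union>(output_nulling_reachability_subspaces A B C D (- {i})))"

definition R_star_complex ::
  "real^'n^'n \<Rightarrow> real^'m^'n \<Rightarrow> real^'n^'p \<Rightarrow> real^'m^'p \<Rightarrow> 'p \<Rightarrow> (complex^'n) set" where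
  "R_star_complex A B C D i = vec.span (cvec ` R_star A B C D i)"

end

theory Submission
  imports Defs
begin

text \<open>A closed-loop mode is a pair \<open>(v, w)\<close> with \<open>w = F v\<close> that the pencil at its eigenvalue \<open>s\<close> maps to
  \<open>(0, y)\<close>, so finding \<open>F\<close> amounts to finding a basis of such \<open>v\<close>, closed under conjugation, with
  \<open>y = 0\<close> or \<open>y\<close> a nonzero multiple of a unit vector.

  The tool that replaces polynomial kernels of the pencil is an observation on resolvents: \<open>b\<close> lies in
  the span of the vectors \<open>(s - M)\<^sup>-\<^sup>1 b\<close> for \<open>s\<close> in any infinite set, since otherwise the
  compression of \<open>M\<close> along \<open>b\<close> to that span would have every such \<open>s\<close> as an eigenvalue. Applied to \<open>Q E\<close>, where \<open>Q\<close> is a right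
  inverse of the pencil at a point that is not an invariant zero, it moves a mode from that point to any infinite
  set of points. Hence the complexification of \<open>R\<^sup>\<star>\<^sub>i\<close> is spanned by real modes seen exactly at output \<open>i\<close>, with
  eigenvalues in any prescribed infinite set of reals that avoids the zeros, and \<open>E\<^sub>0\<close> by unobservable
  real modes.

  With these spanning sets the dimension inequalities are the hypothesis of Rado's theorem, which yields
  independent vectors, one for each mode. The vectors chosen for \<open>z\<^sub>i\<close> and for its conjugate are then replaced by
  conjugate ones by polarization of the determinant. Conversely, the closed-loop eigenvectors lie in
  the corresponding subspaces and are independent.\<close>

section \<open>Resolvents and perturbed linear equations\<close>

text \<open>Two demands on eigenvalues shape the construction. At one output they must be distinct,
  yet Rado's theorem, not the designer, decides which vector and hence which eigenvalue a mode
  receives. So each position j gets its own infinite set \<Lambda> j of stable reals off the zeros,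
  and these sets are disjoint. The vectors of modes with eigenvalue in \<Lambda> j do not form a
  subspace, but Rado's condition sees only dimensions of unions, so it is enough that they span;
  this is why spanning is needed for arbitrary infinite sets of points. At a nonreal zero the
  eigenvalue is forced and the pencil is not onto, so a mode there cannot be moved to real points.
  Rado's theorem picks its vector and that of the conjugate zero separately, while a real feedback
  needs conjugate states with conjugate inputs; hence the exchange, after which the inputs are
  chosen for one member of each pair only. Tracking adds no condition: the pencil is onto at the dc
  point, so every constant reference has a steady state.\<close>

lemma vec_family_independent:
  fixes v :: "'i \<Rightarrow> 'a::field^'n"
  assumes "finite I" "vec.dim (v ` I) = card I"
  shows "inj_on v I" "vec.independent (v ` I)"
proof -
  have "card I \<le> card (v ` I)"
    using assms by (metis finite_imageI vec.dim_le_card vec.span_superset)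
  then have card: "card (v ` I) = card I"
    using assms(1) card_image_le le_antisym by blast
  then show "inj_on v I" using assms(1) by (simp add: eq_card_imp_inj_on)
  show "vec.independent (v ` I)"
    using assms card vec.card_eq_dim[of "v ` I" "v ` I"] vec.span_superset[of "v ` I"] by simp
qed

lemma vec_family_independentD:
  fixes v :: "'i \<Rightarrow> 'a::field^'n"
  assumes "finite I" "inj_on v I" "vec.independent (v ` I)"
    and "(\<Sum>i\<in>I. c i *s v i) = 0" "i \<in> I"
  shows "c i = 0"
proof -
  have "(\<Sum>x\<in>v ` I. c (the_inv_into I v x) *s x) = (\<Sum>i\<in>I. c i *s v i)"
    using assms(2) by (subst sum.reindex) (auto intro!: sum.cong simp: the_inv_into_f_f)
  then have "c (the_inv_into I v (v i)) = 0"
    using assms vec.independentD[of "v ` I" "v ` I" "\<lambda>x. c (the_inv_into I v x)" "v i"] by auto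
  then show ?thesis using assms by (simp add: the_inv_into_f_f)
qed

lemma vec_span_finite_image:
  fixes v :: "'i \<Rightarrow> 'a::field^'n"
  assumes "finite I" "inj_on v I" "x \<in> vec.span (v ` I)"
  obtains c where "x = (\<Sum>i\<in>I. c i *s v i)"
proof -
  obtain u where "x = (\<Sum>y\<in>v ` I. u y *s y)"
    using assms vec.span_finite[of "v ` I"] by auto
  then have "x = (\<Sum>i\<in>I. u (v i) *s v i)"
    using assms(2) by (simp add: sum.reindex)
  then show thesis by (rule that)
qed

text \<open>For \<open>b = 0\<close> these are eigenvectors; in general \<open>x s\<close> is a value of the resolvent of \<open>M\<close> at \<open>b\<close>.\<close>

lemma resolvent_independent:
  fixes M :: "'a::field^'n^'n"
  assumes "finite S" "\<And>s. s \<in> S \<Longrightarrow> M *v x s = s *s x s - b" "\<And>s. s \<in> S \<Longrightarrow> x s \<noteq> 0"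
    and "\<And>\<gamma>. \<gamma> *s b \<in> vec.span (x ` S) \<Longrightarrow> \<gamma> *s b = 0"
  shows "inj_on x S \<and> vec.independent (x ` S)"
  using assms
proof (induction S rule: finite_induct)
  case empty
  then show ?case by (simp add: vec.independent_empty)
next
  case (insert r S)
  have sub: "vec.span (x ` S) \<subseteq> vec.span (x ` insert r S)"
    by (intro vec.span_mono) auto
  have IH: "inj_on x S" "vec.independent (x ` S)"
    using insert sub by auto
  have "x r \<notin> vec.span (x ` S)"
  proof
    assume "x r \<in> vec.span (x ` S)"
    then obtain k where k: "x r = (\<Sum>s\<in>S. k s *s x s)"
      using vec_span_finite_image insert.hyps(1) IH(1) by blast
    have "r *s x r - b = M *v x r" using insert.prems(1) by simp
    also have "\<dots> = (\<Sum>s\<in>S. k s *s (M *v x s))"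
      unfolding k by (simp add: vec.linear_sum vec.linear_scale)
    also have "\<dots> = (\<Sum>s\<in>S. k s *s (s *s x s - b))"
      using insert.prems(1) by (intro sum.cong) auto
    also have "\<dots> = (\<Sum>s\<in>S. (k s * s) *s x s) - (\<Sum>s\<in>S. k s) *s b"
      by (simp add: vec.scale_right_diff_distrib sum_subtractf vec.scale_sum_left)
    finally have e: "r *s x r - b = (\<Sum>s\<in>S. (k s * s) *s x s) - (\<Sum>s\<in>S. k s) *s b" .
    \<comment> \<open>Subtracting \<open>r\<close> times the expansion of \<open>x r\<close> from
      its image under \<open>M\<close> leaves the coefficients \<open>k s * (s - r)\<close>, as for
      eigenvectors, at the price of a multiple of \<open>b\<close>. That multiple lies in the span,
      so the last premise makes it vanish.\<close>
    have "((\<Sum>s\<in>S. k s) - 1) *s b = (\<Sum>s\<in>S. (k s * s) *s x s) - r *s x r"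
      using e by (simp add: vec.scale_left_diff_distrib algebra_simps)
    also have "\<dots> = (\<Sum>s\<in>S. (k s * (s - r)) *s x s)"
    proof -
      have "r *s x r = (\<Sum>s\<in>S. (k s * r) *s x s)"
        unfolding k by (simp add: vec.scale_sum_right mult.commute)
      then show ?thesis
        by (simp add: right_diff_distrib vec.scale_left_diff_distrib sum_subtractf)
    qed
    finally have f: "((\<Sum>s\<in>S. k s) - 1) *s b = (\<Sum>s\<in>S. (k s * (s - r)) *s x s)" .
    moreover have "(\<Sum>s\<in>S. (k s * (s - r)) *s x s) \<in> vec.span (x ` S)"
      by (intro vec.span_sum vec.span_scale vec.span_base) auto
    ultimately have "(\<Sum>s\<in>S. (k s * (s - r)) *s x s) = 0"
      using insert.prems(3) sub by (metis subsetD)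
    then have "k s * (s - r) = 0" if "s \<in> S" for s
      using vec_family_independentD[OF insert.hyps(1) IH, of "\<lambda>s. k s * (s - r)"] that by simp
    then have "k s = 0" if "s \<in> S" for s
      using that insert.hyps(2) by fastforce
    then have "x r = 0" using k by simp
    then show False using insert.prems(2) by blast
  qed
  moreover from this have "x r \<notin> x ` S" by (rule contrapos_nn) (rule vec.span_base)
  ultimately show ?case
    using IH insert.hyps(2) by (simp add: vec.independent_insert)
qed

text \<open>If \<open>b\<close> lies outside the span, then no nonzero multiple of \<open>b\<close>
  lies in the span of a finite part of the family, and \<open>resolvent_independent\<close> yields
  \<open>CARD('n) + 1\<close> independent vectors.\<close>

lemma resolvent_infinite_in_span:
  fixes M :: "'a::field^'n^'n"
  assumes inf: "infinite \<Lambda>" and x: "\<And>s. s \<in> \<Lambda> \<Longrightarrow> M *v x s = s *s x s - b"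
  shows "b \<in> vec.span (x ` \<Lambda>)"
proof (rule ccontr)
  assume b: "b \<notin> vec.span (x ` \<Lambda>)"
  have b0: "b \<noteq> 0" using b vec.span_zero by auto
  obtain S where S: "S \<subseteq> \<Lambda>" "finite S" "card S = Suc (CARD('n))"
    using infinite_arbitrarily_large[OF inf] by metis
  have sub: "vec.span (x ` S) \<subseteq> vec.span (x ` \<Lambda>)"
    using S by (intro vec.span_mono) auto
  have "inj_on x S \<and> vec.independent (x ` S)"
  proof (rule resolvent_independent[OF S(2), of M x b])
    show "M *v x s = s *s x s - b" if "s \<in> S" for s using that S x by auto
    show "x s \<noteq> 0" if "s \<in> S" for s
    proof
      assume "x s = 0"
      then have "M *v 0 = - b" using x[of s] that S by auto
      then show False using b0 by simp
    qed
    show "\<gamma> *s b = 0" if "\<gamma> *s b \<in> vec.span (x ` S)" for \<gamma>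
    proof (rule ccontr)
      assume "\<gamma> *s b \<noteq> 0"
      then have "\<gamma> \<noteq> 0" by auto
      then have "b = inverse \<gamma> *s (\<gamma> *s b)" by (simp add: vector_smult_assoc)
      then have "b \<in> vec.span (x ` S)"
        using vec.span_scale[OF that, of "inverse \<gamma>"] by argo
      then show False using b sub by auto
    qed
  qed
  then have "Suc (CARD('n)) \<le> vec.dim (x ` S)"
    using S by (simp add: card_image[of x S] vec.dim_eq_card_independent[of "x ` S"])
  then show False
    using vec.dim_subset_UNIV[of "x ` S"] by (simp add: vec.dimension_def card_cart_basis)
qed

text \<open>The case \<open>b = 0\<close> of \<open>resolvent_independent\<close>. It allows the
  points where a resolvent does not exist to be removed from an infinite set.\<close>

lemma finite_matrix_eigenvalues:
  fixes M :: "'a::field^'n^'n"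
  shows "finite {s. \<exists>v. v \<noteq> 0 \<and> M *v v = s *s v}"
proof (rule ccontr)
  assume "infinite {s. \<exists>v. v \<noteq> 0 \<and> M *v v = s *s v}"
  from infinite_arbitrarily_large[OF this, of "Suc (CARD('n))"]
  obtain S where S: "S \<subseteq> {s. \<exists>v. v \<noteq> 0 \<and> M *v v = s *s v}" "finite S" "card S = Suc (CARD('n))"
    by blast
  from S(1) have "\<forall>s\<in>S. \<exists>v. v \<noteq> 0 \<and> M *v v = s *s v" by auto
  then have "\<exists>x. \<forall>s\<in>S. x s \<noteq> 0 \<and> M *v x s = s *s x s" by (rule bchoice)
  then obtain x where x: "\<And>s. s \<in> S \<Longrightarrow> x s \<noteq> 0 \<and> M *v x s = s *s x s" by blast
  have "inj_on x S \<and> vec.independent (x ` S)"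
    by (rule resolvent_independent[OF S(2), of M x 0]) (use x in auto)
  then have "Suc (CARD('n)) \<le> vec.dim (x ` S)"
    using S by (simp add: card_image[of x S] vec.dim_eq_card_independent[of "x ` S"])
  then show False
    using vec.dim_subset_UNIV[of "x ` S"] by (simp add: vec.dimension_def card_cart_basis)
qed

lemma matrix_scalar_mult_vec: "mat s *v x = s *s (x :: 'a::comm_ring_1^'n)"
  by (simp add: vec_eq_iff matrix_vector_mult_def mat_def if_distrib[of "\<lambda>x. x * _"] cong: if_cong)

lemma resolvent_surj:
  fixes M :: "'a::field^'n^'n"
  assumes "\<nexists>v. v \<noteq> 0 \<and> M *v v = s *s v"
  obtains x where "s *s x - M *v x = y"
proof -
  have e: "(mat s - M) *v x = s *s x - M *v x" for x
    by (simp add: matrix_vector_mult_diff_rdistrib matrix_scalar_mult_vec)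
  have "\<forall>x. (mat s - M) *v x = 0 \<longrightarrow> x = 0" using assms e by force
  then have "invertible (mat s - M)"
    by (simp add: invertible_left_inverse matrix_left_invertible_ker)
  then have "surj ((*v) (mat s - M))"
    by (metis invertible_right_inverse matrix_right_invertible_surjective)
  then show thesis using that e by (metis surjD)
qed

text \<open>The map \<open>s - M\<close> is injective and sends the invariant \<open>V\<close> into
  itself, hence onto itself by dimension. This keeps resolvent values inside reachability
  subspaces.\<close>

lemma resolvent_invariant_subspace:
  fixes M :: "'a::field^'n^'n"
  assumes "vec.subspace V" "\<And>x. x \<in> V \<Longrightarrow> M *v x \<in> V" "\<nexists>v. v \<noteq> 0 \<and> M *v v = s *s v"
    and "s *s x - M *v x \<in> V"
  shows "x \<in> V"
proof -
  let ?f = "(*v) (mat s - M)"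
  have e: "?f x = s *s x - M *v x" for x
    by (simp add: matrix_vector_mult_diff_rdistrib matrix_scalar_mult_vec)
  have inj: "inj ?f" using assms(3) e by (subst vec.inj_iff_eq_0) force
  have "?f ` V \<subseteq> V"
    using assms(1,2) e by (auto intro!: vec.subspace_diff vec.subspace_scale)
  moreover have "vec.subspace (?f ` V)"
    using assms(1) by (simp add: vec.linear_subspace_image)
  moreover have "vec.dim (?f ` V) = vec.dim V"
    by (rule vec.dim_image_eq) (use inj in \<open>auto intro: inj_on_subset\<close>)
  ultimately have "?f ` V = V"
    using assms(1) by (intro vec.subspace_dim_equal) auto
  then obtain y where "y \<in> V" "?f y = s *s x - M *v x" using assms(4) by (metis imageE)
  then show ?thesis using inj e by (metis injD)
qed

text \<open>With a right inverse \<open>Q\<close> of \<open>P\<close>, the vectors \<open>(1 - t Q E)\<^sup>-\<^sup>1 k\<close> solve the perturbed equation,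
  and they are rescaled values of the resolvent of \<open>Q E\<close> at \<open>k\<close>.\<close>

lemma perturbed_solutions_span:
  fixes P E :: "'a::field^'c^'r" and \<Lambda> :: "'a set"
  assumes "surj ((*v) P)" "P *v k = y" "infinite \<Lambda>"
  shows "k \<in> vec.span {k'. \<exists>t\<in>\<Lambda>. P *v k' - t *s (E *v k') = y}"
proof -
  obtain Q where Q: "P ** Q = mat 1"
    using assms(1) matrix_right_invertible_surjective by blast
  let ?N = "Q ** E"
  define bad where "bad = {s. \<exists>v. v \<noteq> 0 \<and> ?N *v v = s *s v}"
  have fin: "finite bad" unfolding bad_def by (rule finite_matrix_eigenvalues)
  \<comment> \<open>The solution at \<open>t\<close> comes from the resolvent of \<open>Q E\<close>
    at \<open>s = 1 / t\<close>, so \<open>t = 0\<close> and the eigenvalues of \<open>Q E\<close>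
    are excluded.\<close>
  let ?L = "inverse ` (\<Lambda> - {0}) - bad"
  have "infinite (inverse ` (\<Lambda> - {0}))"
    using assms(3) finite_imageD[of inverse "\<Lambda> - {0}"] by (auto simp: inj_on_def)
  then have inf: "infinite ?L" using fin by simp
  have "\<forall>s\<in>?L. \<exists>x. s *s x - ?N *v x = k"
    using resolvent_surj[of ?N] unfolding bad_def by (metis (mono_tags, lifting) DiffD2 mem_Collect_eq)
  then obtain x where x: "\<And>s. s \<in> ?L \<Longrightarrow> s *s x s - ?N *v x s = k" by metis
  have "k \<in> vec.span (x ` ?L)"
    by (rule resolvent_infinite_in_span[OF inf, of ?N]) (use x in \<open>force simp: algebra_simps\<close>)
  moreover have "x s \<in> vec.span {k'. \<exists>t\<in>\<Lambda>. P *v k' - t *s (E *v k') = y}" if s: "s \<in> ?L" for s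
  proof -
    from s obtain t where t: "t \<in> \<Lambda>" "t \<noteq> 0" "s = inverse t" by auto
    have "P *v k = s *s (P *v x s) - E *v x s"
      unfolding x[OF s, symmetric]
      by (simp add: vec.diff vec.scale matrix_vector_mul_assoc matrix_mul_assoc Q)
    \<comment> \<open>Because \<open>P Q = 1\<close>, the resolvent value scaled by \<open>s\<close>
      solves the equation perturbed by \<open>t = 1 / s\<close>.\<close>
    then have "P *v (s *s x s) - t *s (E *v (s *s x s)) = y"
      using t assms(2) by (simp add: vec.scale)
    then have "s *s x s \<in> vec.span {k'. \<exists>t\<in>\<Lambda>. P *v k' - t *s (E *v k') = y}"
      using t by (intro vec.span_base) auto
    then have "t *s (s *s x s) \<in> vec.span {k'. \<exists>t\<in>\<Lambda>. P *v k' - t *s (E *v k') = y}"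
      by (rule vec.span_scale)
    then show ?thesis using t by simp
  qed
  ultimately show ?thesis
    by (metis (no_types, lifting) image_subsetI subsetD vec.span_minimal vec.subspace_span)
qed

section \<open>Modes of the system pencil\<close>

lemma conj_vec_simps [simp]:
  "conj_vec (conj_vec v) = v"
  "conj_vec 0 = 0"
  "conj_vec (v + w) = conj_vec v + conj_vec w"
  "conj_vec (a *s v) = cnj a *s conj_vec v"
  "conj_vec (cvec x) = cvec x"
  "conj_vec (cmat M *v v) = cmat M *v conj_vec v"
  by (simp_all add: conj_vec_def cvec_def cmat_def vec_eq_iff map_matrix_def matrix_vector_mult_def)

lemma cvec_axis: "cvec (axis i 1) = axis i 1"
  by (simp add: cvec_def axis_def vec_eq_iff)

lemma cvec_0 [simp]: "cvec 0 = 0"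
  and cvec_add: "cvec (x + y) = cvec x + cvec y"
  and cvec_scale: "cvec (a *s x) = complex_of_real a *s cvec x"
  and cvec_mult: "cvec (M *v x) = cmat M *v cvec x"
  and cvec_eq_iff [simp]: "cvec x = cvec y \<longleftrightarrow> x = y"
  by (simp_all add: cvec_def cmat_def vec_eq_iff map_matrix_def matrix_vector_mult_def)

lemma cmat_add: "cmat (M + N) = cmat M + cmat N"
  and cmat_mult: "cmat (M ** N') = cmat M ** cmat N'"
  by (simp_all add: cmat_def vec_eq_iff map_matrix_def matrix_matrix_mult_def)

definition re_vec :: "complex^'n \<Rightarrow> real^'n" where
  "re_vec v = (\<chi> i. Re (v $ i))"

definition im_vec :: "complex^'n \<Rightarrow> real^'n" where
  "im_vec v = (\<chi> i. Im (v $ i))"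

lemma re_vec_simps [simp]:
  "re_vec (v + w) = re_vec v + re_vec w"
  "re_vec (complex_of_real a *s v) = a *s re_vec v"
  "re_vec (cmat M *v v) = M *v re_vec v"
  "re_vec (cvec x) = x" "re_vec 0 = 0"
  by (simp_all add: re_vec_def cmat_def cvec_def vec_eq_iff map_matrix_def matrix_vector_mult_def)

lemma im_vec_simps [simp]:
  "im_vec (v + w) = im_vec v + im_vec w"
  "im_vec (complex_of_real a *s v) = a *s im_vec v"
  "im_vec (cmat M *v v) = M *v im_vec v"
  "im_vec 0 = 0"
  by (simp_all add: im_vec_def cmat_def vec_eq_iff map_matrix_def matrix_vector_mult_def)

lemma re_im_vec: "v = cvec (re_vec v) + \<i> *s cvec (im_vec v)"
  by (simp add: re_vec_def im_vec_def cvec_def vec_eq_iff complex_eq mult.commute)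

lemma conj_vec_fixed: "conj_vec v = v \<Longrightarrow> v = cvec (re_vec v)"
  by (simp add: conj_vec_def re_vec_def cvec_def vec_eq_iff complex_eq_iff)

lemma cvec_span_subset:
  assumes "x \<in> vec.span X"
  shows "cvec x \<in> vec.span (cvec ` X)"
proof -
  have "vec.subspace {x. cvec x \<in> vec.span (cvec ` X)}"
    by (auto simp: vec.subspace_def cvec_add cvec_scale vec.span_zero intro: vec.span_add vec.span_scale)
  moreover have "X \<subseteq> {x. cvec x \<in> vec.span (cvec ` X)}"
    by (auto intro: vec.span_base)
  ultimately show ?thesis using vec.span_minimal assms by blast
qed

text \<open>A feedback with \<open>F v = w\<close> gives the closed loop the eigenvector \<open>v\<close> with eigenvalue \<open>s\<close>, seen at the
  output as \<open>y\<close>.\<close>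

definition mode ::
  "'a::field^'n^'n \<Rightarrow> 'a^'m^'n \<Rightarrow> 'a^'n^'p \<Rightarrow> 'a^'m^'p \<Rightarrow> 'a \<Rightarrow> 'a^'p \<Rightarrow> 'a^'n \<Rightarrow> 'a^'m \<Rightarrow> bool" where
  "mode A B C D s y v w \<longleftrightarrow> A *v v + B *v w = s *s v \<and> C *v v + D *v w = y"

section \<open>The pencil as a linear map on pairs of a state and an input\<close>

definition join_vec :: "'a^'n \<Rightarrow> 'a^'m \<Rightarrow> 'a^('n + 'm)" where
  "join_vec v w = (\<chi> i. case i of Inl k \<Rightarrow> v $ k | Inr k \<Rightarrow> w $ k)"

lemma join_vec_cases: obtains v w where "x = join_vec v w"
proof
  show "x = join_vec (\<chi> k. x $ Inl k) (\<chi> k. x $ Inr k)"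
    by (simp add: join_vec_def vec_eq_iff split: sum.split)
qed

lemma join_vec_eq_iff [simp]: "join_vec v w = join_vec v' w' \<longleftrightarrow> v = v' \<and> w = w'"
  by (auto simp: join_vec_def vec_eq_iff split: sum.splits)

text \<open>Stated over any field because reachability is argued with the real pencil, while the
  invariant zeros and the nonreal modes belong to the complex one.\<close>

definition pencil_matrix ::
  "'a::field^'n^'n \<Rightarrow> 'a^'m^'n \<Rightarrow> 'a^'n^'p \<Rightarrow> 'a^'m^'p \<Rightarrow> 'a \<Rightarrow> 'a^('n + 'm)^('n + 'p)" where
  "pencil_matrix A B C D s = (\<chi> i j.
     case i of
       Inl k \<Rightarrow> (case j of Inl l \<Rightarrow> A $ k $ l - (if k = l then s else 0) | Inr l \<Rightarrow> B $ k $ l)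
     | Inr k \<Rightarrow> (case j of Inl l \<Rightarrow> C $ k $ l | Inr l \<Rightarrow> D $ k $ l))"

lemma pencil_eq_matrix: "pencil A B C D s = pencil_matrix (cmat A) (cmat B) (cmat C) (cmat D) s"
  by (simp add: pencil_def rosenbrock_def pencil_matrix_def cmat_def map_matrix_def vec_eq_iff
      split: sum.split)

lemma sum_UNIV_sum_type: "(\<Sum>x\<in>UNIV. f x) = (\<Sum>x\<in>UNIV. f (Inl x)) + (\<Sum>x\<in>UNIV. f (Inr x))"
  for f :: "'a::finite + 'b::finite \<Rightarrow> 'c::comm_monoid_add"
  using sum.Plus[of "UNIV :: 'a set" "UNIV :: 'b set" f] by (simp add: comp_def)

lemma pencil_matrix_mult:
  "pencil_matrix A B C D s *v join_vec v w = join_vec (A *v v + B *v w - s *s v) (C *v v + D *v w)"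
proof -
  have "(\<Sum>j\<in>UNIV. (A $ k $ j - (if k = j then s else 0)) * v $ j) = (\<Sum>j\<in>UNIV. A $ k $ j * v $ j) - s * v $ k" for k
    by (simp add: left_diff_distrib sum_subtractf if_distrib[of "\<lambda>x. x * _"] cong: if_cong)
  then show ?thesis
    by (simp add: vec_eq_iff matrix_vector_mult_def sum_UNIV_sum_type pencil_matrix_def join_vec_def
        split: sum.split)
qed

lemma pencil_mode_iff:
  "pencil_matrix A B C D s *v join_vec v w = join_vec 0 y \<longleftrightarrow> mode A B C D s y v w"
  by (auto simp: pencil_matrix_mult mode_def)

lemma join_vec_diff_scale: "join_vec v w - t *s join_vec v' w' = join_vec (v - t *s v') (w - t *s w')"
  for t :: "'a::field"
  by (simp add: vec_eq_iff join_vec_def split: sum.split)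

text \<open>Projection to the state block is linear. It discards the inputs, since the dimension
  conditions concern states only.\<close>

lemma span_image_fst_join:
  fixes X :: "('a::field^('n::finite + 'm::finite)) set"
  assumes "join_vec v w \<in> vec.span X"
  shows "v \<in> vec.span {v'. \<exists>w'. join_vec v' w' \<in> X}"
proof -
  let ?f = "\<lambda>x::'a^('n + 'm). (\<chi> k. x $ Inl k) :: 'a^'n"
  have "vec.subspace {x. ?f x \<in> vec.span {v'. \<exists>w'. join_vec v' w' \<in> X}}"
  proof -
    have "?f 0 = 0" "\<And>x y. ?f (x + y) = ?f x + ?f y" "\<And>a x. ?f (a *s x) = a *s ?f x"
      by (simp_all add: vec_eq_iff)
    then show ?thesis
      unfolding vec.subspace_def by (auto intro: vec.span_add vec.span_scale vec.span_zero)
  qed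
  moreover have f: "?f (join_vec v w) = v" for v :: "'a^'n" and w :: "'a^'m"
    by (simp add: vec_eq_iff join_vec_def)
  have "X \<subseteq> {x. ?f x \<in> vec.span {v'. \<exists>w'. join_vec v' w' \<in> X}}"
  proof
    fix x assume x: "x \<in> X"
    obtain v w where e: "x = join_vec v w" by (rule join_vec_cases)
    show "x \<in> {x. ?f x \<in> vec.span {v'. \<exists>w'. join_vec v' w' \<in> X}}"
      using x unfolding e mem_Collect_eq f by (intro vec.span_base) auto
  qed
  ultimately have "join_vec v w \<in> {x. ?f x \<in> vec.span {v'. \<exists>w'. join_vec v' w' \<in> X}}"
    using vec.span_minimal assms by blast
  then show ?thesis using f by simp
qed

lemma mode_span_other_points:
  fixes \<Lambda> :: "'a::field set"
  assumes "surj ((*v) (pencil_matrix A B C D s))" "mode A B C D s y v w" "infinite \<Lambda>"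
  shows "v \<in> vec.span {v'. \<exists>s'\<in>\<Lambda>. \<exists>w'. mode A B C D s' y v' w'}"
proof -
  \<comment> \<open>This is the identity on the state block and zero elsewhere, so subtracting
    \<open>s' - s\<close> times it turns the pencil at \<open>s\<close> into the pencil at
    \<open>s'\<close>.\<close>
  let ?E = "pencil_matrix 0 0 0 0 (-1)"
  let ?T = "(\<lambda>s'. s' - s) ` \<Lambda>"
  have "infinite ?T"
    using assms(3) by (auto dest!: finite_imageD simp: inj_on_def)
  then have "join_vec v w \<in> vec.span {k'. \<exists>t\<in>?T. pencil_matrix A B C D s *v k' - t *s (?E *v k') = join_vec 0 y}"
    using assms by (intro perturbed_solutions_span) (auto simp: pencil_mode_iff)
  then have "v \<in> vec.span {v'. \<exists>w'. join_vec v' w' \<in>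
    {k'. \<exists>t\<in>?T. pencil_matrix A B C D s *v k' - t *s (?E *v k') = join_vec 0 y}}"
    by (rule span_image_fst_join)
  moreover have "pencil_matrix A B C D s *v join_vec v' w' - (s' - s) *s (?E *v join_vec v' w') = join_vec 0 y
      \<longleftrightarrow> mode A B C D s' y v' w'" for v' w' s'
    unfolding pencil_matrix_mult join_vec_diff_scale join_vec_eq_iff mode_def
    by (auto simp: vec.scale_left_diff_distrib algebra_simps)
  then have "{v'. \<exists>w'. join_vec v' w' \<in>
    {k'. \<exists>t\<in>?T. pencil_matrix A B C D s *v k' - t *s (?E *v k') = join_vec 0 y}}
    = {v'. \<exists>s'\<in>\<Lambda>. \<exists>w'. mode A B C D s' y v' w'}"
    by blast
  ultimately show ?thesis by simp
qed

lemma mode_add: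
  "mode A B C D s y v w \<Longrightarrow> mode A B C D s y' v' w' \<Longrightarrow> mode A B C D s (y + y') (v + v') (w + w')"
  by (auto simp: mode_def matrix_vector_right_distrib vec.scale_right_distrib algebra_simps)

lemma mode_scale: "mode A B C D s y v w \<Longrightarrow> mode A B C D s (a *s y) (a *s v) (a *s w)"
  by (auto simp: mode_def vec.scale simp flip: vec.scale_right_distrib)

lemma mode_cvec:
  "mode (cmat A) (cmat B) (cmat C) (cmat D) (complex_of_real s) (cvec y) (cvec v) (cvec w)
     \<longleftrightarrow> mode A B C D s y v w"
  unfolding mode_def cvec_mult[symmetric] cvec_add[symmetric] cvec_scale[symmetric] by simp

lemma mode_re_im:
  assumes "mode (cmat A) (cmat B) (cmat C) (cmat D) (complex_of_real s) y v w"
  shows "mode A B C D s (re_vec y) (re_vec v) (re_vec w)"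
    and "mode A B C D s (im_vec y) (im_vec v) (im_vec w)"
  using assms unfolding mode_def by (metis re_vec_simps(1-3), metis im_vec_simps(1-3))

lemma mode_conj:
  assumes "mode (cmat A) (cmat B) (cmat C) (cmat D) s y v w"
  shows "mode (cmat A) (cmat B) (cmat C) (cmat D) (cnj s) (conj_vec y) (conj_vec v) (conj_vec w)"
  using assms unfolding mode_def by (metis conj_vec_simps(3,4,6))

lemma null_directions_iff:
  "v \<in> null_directions A B C D s \<longleftrightarrow> (\<exists>w. mode (cmat A) (cmat B) (cmat C) (cmat D) s 0 v w)"
  by (simp add: null_directions_def mode_def matrix_vector_mult_diff_rdistrib matrix_scalar_mult_vec
      algebra_simps)

lemma subspace_null_directions: "vec.subspace (null_directions A B C D s)"
proof -
  let ?m = "mode (cmat A) (cmat B) (cmat C) (cmat D) s 0"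
  have "?m 0 0" by (simp add: mode_def)
  moreover have "?m (v + v') (w + w')" if "?m v w" "?m v' w'" for v v' w w'
    using mode_add[OF that] by simp
  moreover have "?m (a *s v) (a *s w)" if "?m v w" for a v w
    using mode_scale[OF that, of a] by simp
  ultimately show ?thesis
    unfolding vec.subspace_def Ball_def null_directions_iff by blast
qed

lemma null_directions_conj:
  "conj_vec v \<in> null_directions A B C D (cnj s) \<longleftrightarrow> v \<in> null_directions A B C D s"
  unfolding null_directions_iff using mode_conj by (metis complex_cnj_cnj conj_vec_simps(1,2))

section \<open>Right invertibility and surjectivity of the pencil\<close>

lemma full_row_rank_surj:
  fixes P :: "'a::field^'c^'r"
  assumes "rank P = CARD('r)"
  shows "surj ((*v) P)"
proof -
  have "rows P = range (\<lambda>i. row i P)" by (auto simp: rows_def)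
  then have d: "vec.dim (range (\<lambda>i. row i P)) = CARD('r)"
    using assms by (simp add: row_rank_def_gen)
  note ind = vec_family_independent[OF finite d]
  have "\<forall>c. (\<Sum>i\<in>UNIV. c i *s row i P) = 0 \<longrightarrow> (\<forall>i. c i = 0)"
    using vec_family_independentD[OF finite ind] by blast
  then show ?thesis
    by (simp add: matrix_right_invertible_independent_rows flip: matrix_right_invertible_surjective)
qed

lemma rank_le_card_rows:
  fixes P :: "'a::field^'c^'r"
  shows "rank P \<le> CARD('r)"
proof -
  have "rows P = range (\<lambda>i. row i P)" by (auto simp: rows_def)
  then have "rank P \<le> card (range (\<lambda>i. row i P))"
    unfolding row_rank_def_gen by (metis finite finite_imageI vec.dim_le_card vec.span_superset)
  also have "\<dots> \<le> CARD('r)" by (rule card_image_le) simp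
  finally show ?thesis .
qed

context
  fixes A :: "real^'n^'n" and B :: "real^'m^'n" and C :: "real^'n^'p" and D :: "real^'m^'p"
  assumes ri: "right_invertible A B C D"
begin

text \<open>The exceptional set is finite, so some complex point attains the bound given by the
  number of rows. The invariant zeros thereby become the points where the pencil is not
  onto.\<close>

lemma normal_rank_right_invertible: "normal_rank A B C D = CARD('n) + CARD('p)"
proof -
  have le: "rank (pencil A B C D s) \<le> CARD('n) + CARD('p)" for s
    using rank_le_card_rows[of "pencil A B C D s"] by simp
  have fin: "finite (range (\<lambda>s. rank (pencil A B C D s)))"
    by (rule finite_subset[of _ "{..CARD('n) + CARD('p)}"]) (use le in auto)
  obtain s where "rank (pencil A B C D s) = CARD('n) + CARD('p)"
    using ri ex_new_if_finite[OF infinite_UNIV_char_0] unfolding right_invertible_def by blast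
  then have "CARD('n) + CARD('p) \<in> range (\<lambda>s. rank (pencil A B C D s))"
    by (metis rangeI)
  then show ?thesis
    unfolding normal_rank_def using fin le by (intro Max_eqI) auto
qed

lemma finite_invariant_zeros: "finite (invariant_zeros A B C D)"
  using ri unfolding right_invertible_def invariant_zeros_def normal_rank_right_invertible
  by (rule rev_finite_subset) auto

lemma pencil_surj:
  assumes "s \<notin> invariant_zeros A B C D"
  shows "surj ((*v) (pencil_matrix (cmat A) (cmat B) (cmat C) (cmat D) s))"
proof -
  have "rank (pencil A B C D s) = CARD('n + 'p)"
    using assms rank_le_card_rows[of "pencil A B C D s"]
    by (simp add: invariant_zeros_def normal_rank_right_invertible)
  then show ?thesis using full_row_rank_surj[of "pencil A B C D s"] by (simp add: pencil_eq_matrix)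
qed

text \<open>At a real point the real part of a complex preimage of a real vector is again a
  preimage.\<close>

lemma real_pencil_surj:
  assumes "complex_of_real s \<notin> invariant_zeros A B C D"
  shows "surj ((*v) (pencil_matrix A B C D s))"
proof -
  have "\<exists>k. y = pencil_matrix A B C D s *v k" for y
  proof -
    obtain a b where y: "y = join_vec a b" by (rule join_vec_cases)
    obtain k where "pencil_matrix (cmat A) (cmat B) (cmat C) (cmat D) (complex_of_real s) *v k = join_vec (cvec a) (cvec b)"
      using pencil_surj[OF assms] by (metis surjD)
    moreover obtain v w where "k = join_vec v w" by (rule join_vec_cases)
    ultimately have "cmat A *v v + cmat B *v w - complex_of_real s *s v = cvec a"
      "cmat C *v v + cmat D *v w = cvec b"
      by (simp_all add: pencil_matrix_mult)
    then have "cmat A *v v + cmat B *v w = cvec a + complex_of_real s *s v"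
      "cmat C *v v + cmat D *v w = cvec b"
      by (simp_all add: algebra_simps)
    then have "A *v re_vec v + B *v re_vec w = a + s *s re_vec v" "C *v re_vec v + D *v re_vec w = b"
      by (metis re_vec_simps)+
    then have "pencil_matrix A B C D s *v join_vec (re_vec v) (re_vec w) = y"
      by (simp add: pencil_matrix_mult y)
    then show ?thesis by metis
  qed
  then show ?thesis unfolding surj_def by blast
qed

text \<open>The output is free to choose: a unit vector switches on one output, and at the dc point
  a reference gives its steady state.\<close>

lemma real_mode_exists:
  assumes "complex_of_real s \<notin> invariant_zeros A B C D"
  obtains v w where "mode A B C D s y v w"
  using real_pencil_surj[OF assms] by (metis join_vec_cases pencil_mode_iff surjD)

end

section \<open>Reachability subspaces and spanning modes\<close>

lemma subspace_reachable: "subspace (reachable_subspace A B)"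
  unfolding reachable_subspace_def by (rule subspace_span)

lemma reachable_input: "B *v u \<in> reachable_subspace A B"
proof -
  have "B *v u \<in> (\<Union>k. range (\<lambda>u. (((*v) A) ^^ k) (B *v u)))"
    by (auto intro!: exI[of _ 0])
  then show ?thesis unfolding reachable_subspace_def by (rule span_base)
qed

lemma reachable_invariant:
  assumes "x \<in> reachable_subspace A B"
  shows "A *v x \<in> reachable_subspace A B"
  using assms unfolding reachable_subspace_def
proof (induction rule: span_induct)
  case base
  show ?case
    by (auto simp: subspace_def matrix_vector_right_distrib matrix_vector_mult_scaleR
        intro: span_add span_scale span_zero)
next
  case (step x)
  then obtain k u where "x = (((*v) A) ^^ k) (B *v u)" by auto
  then have "A *v x = (((*v) A) ^^ (Suc k)) (B *v u)" by simp
  then have "A *v x \<in> (\<Union>k. range (\<lambda>u. (((*v) A) ^^ k) (B *v u)))" by blast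
  then show ?case by (simp add: span_base)
qed

lemma reachable_minimal:
  assumes "subspace V" "\<And>x. x \<in> V \<Longrightarrow> A *v x \<in> V" "\<And>u. B *v u \<in> V"
  shows "reachable_subspace A B \<subseteq> V"
proof -
  have "(((*v) A) ^^ k) (B *v u) \<in> V" for k u
    using assms(2,3) by (induction k) auto
  then show ?thesis
    unfolding reachable_subspace_def using assms(1) by (intro span_minimal) auto
qed

text \<open>Such an \<open>F\<close> is called a friend of \<open>V\<close> in geometric control.
  Pointwise inputs are chosen on a basis of \<open>V\<close> and extended linearly; the states at
  which \<open>F\<close> behaves as required form a subspace because \<open>V\<close> is
  one.\<close>

lemma friend_exists:
  fixes A :: "real^'n^'n" and B :: "real^'m^'n" and C :: "real^'n^'p" and D :: "real^'m^'p"
  assumes V: "subspace V"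
    and ex: "\<And>x. x \<in> V \<Longrightarrow> \<exists>u. A *v x + B *v u \<in> V \<and> (\<forall>j\<in>S. (C *v x + D *v u) $ j = 0)"
  obtains F where "\<And>x. x \<in> V \<Longrightarrow> (A + B ** F) *v x \<in> V"
    and "\<And>x j. x \<in> V \<Longrightarrow> j \<in> S \<Longrightarrow> ((C + D ** F) *v x) $ j = 0"
proof -
  obtain b where b: "b \<subseteq> V" "independent b" "V \<subseteq> span b"
    using basis_exists by metis
  have "\<forall>x\<in>b. \<exists>u. A *v x + B *v u \<in> V \<and> (\<forall>j\<in>S. (C *v x + D *v u) $ j = 0)"
    using b ex by blast
  from bchoice[OF this] obtain f
    where f: "\<forall>x\<in>b. A *v x + B *v f x \<in> V \<and> (\<forall>j\<in>S. (C *v x + D *v f x) $ j = 0)" by blast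
  obtain g where g: "linear g" "\<forall>x\<in>b. g x = f x"
    using linear_independent_extend[OF b(2), of f] by blast
  define F where "F = matrix g"
  have Fx: "F *v x = g x" for x
    unfolding F_def using g(1) by (simp add: matrix_works linear_matrix_vector_mul_eq)
  let ?W = "{x. (A + B ** F) *v x \<in> V \<and> (\<forall>j\<in>S. ((C + D ** F) *v x) $ j = 0)}"
  have "subspace ?W"
    using V by (auto simp: subspace_def matrix_vector_right_distrib matrix_vector_mult_scaleR)
  moreover have "b \<subseteq> ?W"
  proof
    fix x assume "x \<in> b"
    then have "F *v x = f x" using g(2) Fx by simp
    then show "x \<in> ?W"
      using f \<open>x \<in> b\<close> by (simp add: matrix_vector_mult_add_rdistrib flip: matrix_vector_mul_assoc)
  qed
  ultimately have "V \<subseteq> ?W" using b(3) span_minimal by blast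
  then show thesis by (intro that[of F]) auto
qed

lemma infinite_UNIV_minus_finite:
  "finite X \<Longrightarrow> infinite {s::real. s \<notin> X}"
  by (metis Compl_eq Diff_infinite_finite Compl_eq_Diff_UNIV infinite_UNIV_char_0)

lemma infinite_stable_reals: "infinite {s. complex_of_real s \<in> stable_region T}"
proof -
  \<comment> \<open>This interval lies in the open left half-plane and in the open unit
    disc.\<close>
  have "{-1<..<0} \<subseteq> {s. complex_of_real s \<in> stable_region T}"
    by (auto simp: stable_region_def split: time_domain.split)
  moreover have "infinite {-1<..<0::real}" by (rule infinite_Ioo) simp
  ultimately show ?thesis using finite_subset by blast
qed

context
  fixes A :: "real^'n^'n" and B :: "real^'m^'n" and C :: "real^'n^'p" and D :: "real^'m^'p"
  assumes ri: "right_invertible A B C D"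
begin

text \<open>Let \<open>F\<close> be a friend of the span \<open>V\<close> of all real modes seen at
  most at output \<open>i\<close>, and \<open>M = A + B ** F\<close>. Off the spectrum of
  \<open>M\<close>, a mode \<open>(v', w')\<close> at \<open>s'\<close> is the resolvent value of
  \<open>M\<close> at \<open>B u\<close> with \<open>u = w' - F v'\<close>. It therefore lies in the
  reachability subspace generated by \<open>B u\<close>, which stays inside \<open>V\<close> and is
  output-nulling. A mode at a given point may sit on the spectrum of \<open>M\<close>, so it is
  first written as a combination of modes with the same output at other points.\<close>

lemma mode_in_R_star:
  assumes nz: "complex_of_real s \<notin> invariant_zeros A B C D"
    and m: "mode A B C D s (a *s axis i 1) v w"
  shows "v \<in> R_star A B C D i"
proof -
  define y where "y = a *s (axis i 1 :: real^'p)"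
  have y: "y $ j = 0" if "j \<noteq> i" for j using that by (simp add: y_def axis_def)
  \<comment> \<open>The real points \<open>s\<close> are unrestricted. The input of a mode sends its
    state to a multiple of itself, so the span meets the hypothesis of
    \<open>friend_exists\<close>.\<close>
  define G where "G = {v. \<exists>s w y. mode A B C D s y v w \<and> (\<forall>j\<in>-{i}. y $ j = 0)}"
  define V where "V = span G"
  have V: "subspace V" by (simp add: V_def)
  have ex: "\<exists>u. A *v x + B *v u \<in> V \<and> (\<forall>j\<in>-{i}. (C *v x + D *v u) $ j = 0)" if "x \<in> V" for x
    using that unfolding V_def
  proof (induction rule: span_induct)
    case base
    show ?case
      unfolding subspace_def
    proof (intro conjI ballI allI, goal_cases)
      case 1
      show ?case by (auto simp: span_zero intro!: exI[of _ 0])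
    next
      case (2 x x')
      then obtain u u' where "A *v x + B *v u \<in> span G" "\<forall>j\<in>-{i}. (C *v x + D *v u) $ j = 0"
        "A *v x' + B *v u' \<in> span G" "\<forall>j\<in>-{i}. (C *v x' + D *v u') $ j = 0" by auto
      moreover have "A *v (x + x') + B *v (u + u') = (A *v x + B *v u) + (A *v x' + B *v u')"
        "C *v (x + x') + D *v (u + u') = (C *v x + D *v u) + (C *v x' + D *v u')"
        by (simp_all add: matrix_vector_right_distrib)
      ultimately have "A *v (x + x') + B *v (u + u') \<in> span G \<and>
        (\<forall>j\<in>-{i}. (C *v (x + x') + D *v (u + u')) $ j = 0)"
        using span_add by (metis add.right_neutral vector_add_component)
      then show ?case by blast
    next
      case (3 c x)
      then obtain u where "A *v x + B *v u \<in> span G" "\<forall>j\<in>-{i}. (C *v x + D *v u) $ j = 0" by auto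
      moreover have "A *v (c *\<^sub>R x) + B *v (c *\<^sub>R u) = c *\<^sub>R (A *v x + B *v u)"
        "C *v (c *\<^sub>R x) + D *v (c *\<^sub>R u) = c *\<^sub>R (C *v x + D *v u)"
        by (simp_all add: matrix_vector_mult_scaleR scaleR_right_distrib)
      ultimately have "A *v (c *\<^sub>R x) + B *v (c *\<^sub>R u) \<in> span G \<and>
        (\<forall>j\<in>-{i}. (C *v (c *\<^sub>R x) + D *v (c *\<^sub>R u)) $ j = 0)"
        using span_scale by (metis scaleR_zero_right vector_scaleR_component real_scaleR_def)
      then show ?case by blast
    qed
  next
    case (step x)
    then obtain s w y where "mode A B C D s y x w" "\<forall>j\<in>-{i}. y $ j = 0" by (auto simp: G_def)
    then show ?case
      using span_scale[OF span_base[OF step], of s]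
      by (auto simp: mode_def scalar_mult_eq_scaleR intro!: exI[of _ w])
  qed
  obtain F where F: "\<And>x. x \<in> V \<Longrightarrow> (A + B ** F) *v x \<in> V"
    and F0: "\<And>x j. x \<in> V \<Longrightarrow> j \<in> -{i} \<Longrightarrow> ((C + D ** F) *v x) $ j = 0"
    using friend_exists[OF V ex] by metis
  define M where "M = A + B ** F"
  define \<Lambda> where "\<Lambda> = {s. s \<notin> {s. \<exists>v. v \<noteq> 0 \<and> M *v v = s *s v}}"
  have "infinite \<Lambda>"
    unfolding \<Lambda>_def by (intro infinite_UNIV_minus_finite finite_matrix_eigenvalues)
  then have "v \<in> vec.span {v'. \<exists>s'\<in>\<Lambda>. \<exists>w'. mode A B C D s' y v' w'}"
    using mode_span_other_points[OF real_pencil_surj[OF ri nz] m] y_def by blast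
  moreover have "v' \<in> R_star A B C D i" if s': "s' \<in> \<Lambda>" and m': "mode A B C D s' y v' w'" for s' v' w'
  proof -
    define u where "u = w' - F *v v'"
    \<comment> \<open>All columns of \<open>L\<close> are \<open>u\<close>, so the image of
      \<open>B ** L\<close> is the line through \<open>B *v u\<close>.\<close>
    define L :: "real^'m^'m" where "L = (\<chi> i j. u $ i)"
    have L: "L *v q = (\<Sum>j\<in>UNIV. q $ j) *\<^sub>R u" for q
      by (simp add: L_def vec_eq_iff matrix_vector_mult_def sum_distrib_left mult.commute)
    have v'V: "v' \<in> V"
      unfolding V_def G_def using m' y by (intro span_base) auto
    have Bu: "B *v u = s' *s v' - M *v v'"
      using m' by (simp add: mode_def u_def M_def vec.diff matrix_vector_mult_add_rdistrib
          algebra_simps matrix_vector_mul_assoc)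
    then have BuV: "B *v u \<in> V"
      using v'V F V by (auto simp: M_def scalar_mult_eq_scaleR intro!: subspace_diff subspace_scale)
    have "D *v u = y - (C + D ** F) *v v'"
      using m' by (simp add: mode_def u_def vec.diff matrix_vector_mult_add_rdistrib
          algebra_simps matrix_vector_mul_assoc)
    then have Du: "(D *v u) $ j = 0" if "j \<in> -{i}" for j
      using F0[OF v'V that] y that by simp
    define R where "R = reachable_subspace M (B ** L)"
    have RV: "R \<subseteq> V" unfolding R_def
    proof (rule reachable_minimal[OF V])
      show "M *v x \<in> V" if "x \<in> V" for x using F that by (simp add: M_def)
      show "(B ** L) *v q \<in> V" for q
        using BuV V by (simp add: L matrix_vector_mult_scaleR subspace_scale flip: matrix_vector_mul_assoc)
    qed
    have "((D ** L) *v q) $ j = 0" if "j \<in> -{i}" for q j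
      using Du[OF that] by (simp add: L matrix_vector_mult_scaleR flip: matrix_vector_mul_assoc)
    then have "R \<in> output_nulling_reachability_subspaces A B C D (- {i})"
      unfolding output_nulling_reachability_subspaces_def R_def M_def
      using F0 RV unfolding R_def M_def by blast
    then have R: "R \<subseteq> R_star A B C D i"
      unfolding R_star_def using span_superset by fastforce
    have "(B ** L) *v axis k 1 = B *v u" for k
      by (simp add: L axis_def flip: matrix_vector_mul_assoc)
    then have "B *v u \<in> R"
      unfolding R_def using reachable_input[of "B ** L" "axis k 1" M for k] by metis
    then have "v' \<in> R"
      using resolvent_invariant_subspace[of R M s' v'] s' Bu reachable_invariant[of _ M "B ** L"]
      by (simp add: R_def \<Lambda>_def subspace_vec_eq subspace_reachable)
    then show ?thesis using R by blast
  qed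
  then have "{v'. \<exists>s'\<in>\<Lambda>. \<exists>w'. mode A B C D s' y v' w'} \<subseteq> R_star A B C D i" by blast
  then have "vec.span {v'. \<exists>s'\<in>\<Lambda>. \<exists>w'. mode A B C D s' y v' w'} \<subseteq> R_star A B C D i"
    unfolding span_vec_eq by (rule span_minimal) (simp add: R_star_def)
  ultimately show ?thesis by blast
qed

text \<open>In a reachability subspace of \<open>M = A + B ** F\<close> the resolvent values of
  \<open>M\<close> at an input vector \<open>b\<close> stay in the subspace, so with input
  \<open>F x + L u\<close> they are modes seen at most at output \<open>i\<close>. Over infinitely
  many points they span an invariant subspace containing \<open>b\<close>, hence all iterates of
  \<open>M\<close> on \<open>b\<close>.\<close>

lemma R_star_subset_span_modes:
  assumes inf\<Lambda>: "infinite \<Lambda>" and nz: "\<And>s. s \<in> \<Lambda> \<Longrightarrow> complex_of_real s \<notin> invariant_zeros A B C D"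
  shows "R_star A B C D i \<subseteq> vec.span {v. \<exists>s\<in>\<Lambda>. \<exists>a w. a \<noteq> 0 \<and> mode A B C D s (a *s axis i 1) v w}"
    (is "_ \<subseteq> vec.span ?G")
proof -
  \<comment> \<open>Spanning modes must be visible at output \<open>i\<close>. An invisible one is
    the difference of two visible ones, obtained by adding a mode with output the unit vector at the
    same point.\<close>
  have all: "v \<in> vec.span ?G" if s: "s \<in> \<Lambda>" and m: "mode A B C D s (a *s axis i 1) v w" for s a v w
  proof (cases "a = 0")
    case False
    then show ?thesis using that by (intro vec.span_base) blast
  next
    case True
    obtain v' w' where m': "mode A B C D s (1 *s axis i 1) v' w'"
      using real_mode_exists[OF ri nz[OF s]] by metis
    have "mode A B C D s (1 *s axis i 1) (v + v') (w + w')"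
      using mode_add[OF m m'] True by simp
    moreover have "x \<in> ?G" if "mode A B C D s (1 *s axis i 1) x u" for x u
      using s that zero_neq_one by (intro CollectI bexI[OF _ s] exI[of _ 1] exI[of _ u]) simp
    ultimately have "v + v' \<in> ?G" "v' \<in> ?G"
      using m' by - assumption+
    then have "v + v' - v' \<in> vec.span ?G" by (intro vec.span_diff vec.span_base)
    then show ?thesis by simp
  qed
  have "R \<subseteq> vec.span ?G" if "R \<in> output_nulling_reachability_subspaces A B C D (- {i})" for R
  proof -
    from that obtain F and L :: "real^'m^'m" where R: "R = reachable_subspace (A + B ** F) (B ** L)"
      and null: "\<forall>x\<in>reachable_subspace (A + B ** F) (B ** L). \<forall>j\<in>-{i}. ((C + D ** F) *v x) $ j = 0" "\<forall>u. \<forall>j\<in>-{i}. ((D ** L) *v u) $ j = 0"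
      unfolding output_nulling_reachability_subspaces_def by blast
    have n1: "((C + D ** F) *v x) $ j = 0" if "x \<in> R" "j \<noteq> i" for x j
      using null(1) that R by blast
    have n2: "((D ** L) *v u) $ j = 0" if "j \<noteq> i" for u j
      using null(2) that by blast
    define M where "M = A + B ** F"
    have "(((*v) M) ^^ k) ((B ** L) *v u) \<in> vec.span ?G" for k u
    proof -
      define b where "b = (B ** L) *v u"
      define \<Lambda>' where "\<Lambda>' = \<Lambda> - {s. \<exists>v. v \<noteq> 0 \<and> M *v v = s *s v}"
      have inf: "infinite \<Lambda>'"
        unfolding \<Lambda>'_def using inf\<Lambda> finite_matrix_eigenvalues[of M] by simp
      have "\<forall>s\<in>\<Lambda>'. \<exists>x. s *s x - M *v x = b"
        unfolding \<Lambda>'_def using resolvent_surj[of M] by (metis (mono_tags, lifting) DiffD2 mem_Collect_eq)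
      then have "\<exists>x. \<forall>s\<in>\<Lambda>'. s *s x s - M *v x s = b" by (rule bchoice)
      then obtain x where x: "\<And>s. s \<in> \<Lambda>' \<Longrightarrow> s *s x s - M *v x s = b" by blast
      then have Mx: "M *v x s = s *s x s - b" if "s \<in> \<Lambda>'" for s
        using that by (metis diff_diff_eq2 add_diff_cancel_left')
      have bR: "b \<in> R" unfolding b_def R by (rule reachable_input)
      have xG: "x s \<in> vec.span ?G" if s: "s \<in> \<Lambda>'" for s
      proof -
        have xR: "x s \<in> R"
          using resolvent_invariant_subspace[of R M s "x s"] s x[OF s] bR
            reachable_invariant[of _ M "B ** L"]
          by (simp add: R \<Lambda>'_def M_def subspace_vec_eq subspace_reachable)
        define y where "y = C *v x s + D *v (F *v x s + L *v u)"
        have "y = (C + D ** F) *v x s + (D ** L) *v u"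
          by (simp add: y_def matrix_vector_right_distrib matrix_vector_mult_add_rdistrib
              matrix_vector_mul_assoc)
        then have "y $ j = 0" if "j \<noteq> i" for j using n1[OF xR that] n2[OF that] by simp
        then have y: "y = (y $ i) *s axis i 1" by (auto simp: vec_eq_iff axis_def)
        have "A *v x s + B *v (F *v x s + L *v u) = M *v x s + b"
          by (simp add: M_def b_def matrix_vector_right_distrib matrix_vector_mult_add_rdistrib
              matrix_vector_mul_assoc)
        also have "\<dots> = s *s x s" using Mx[OF s] by simp
        finally have "mode A B C D s ((y $ i) *s axis i 1) (x s) (F *v x s + L *v u)"
          unfolding mode_def y[symmetric] by (simp add: y_def)
        then show ?thesis using all s by (auto simp: \<Lambda>'_def)
      qed
      have bW: "b \<in> vec.span (x ` \<Lambda>')"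
        by (rule resolvent_infinite_in_span[OF inf Mx])
      \<comment> \<open>Invariance follows from \<open>M x = s x - b\<close> on the generators,
        since \<open>b\<close> itself lies in the span.\<close>
      have MW: "M *v y \<in> vec.span (x ` \<Lambda>')" if "y \<in> vec.span (x ` \<Lambda>')" for y
      proof -
        have "vec.subspace {y. M *v y \<in> vec.span (x ` \<Lambda>')}"
          by (auto simp: vec.subspace_def vec.add vec.scale vec.span_zero
              intro: vec.span_add vec.span_scale)
        moreover have "x ` \<Lambda>' \<subseteq> {y. M *v y \<in> vec.span (x ` \<Lambda>')}"
          using bW by (auto simp: Mx intro!: vec.span_diff vec.span_scale[OF vec.span_base])
        ultimately show ?thesis using that vec.span_minimal by blast
      qed
      have "(((*v) M) ^^ k) b \<in> vec.span (x ` \<Lambda>')"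
        using bW MW by (induction k) auto
      moreover have "vec.span (x ` \<Lambda>') \<subseteq> vec.span ?G"
        using xG by (intro vec.span_minimal) auto
      ultimately show ?thesis unfolding b_def by blast
    qed
    then show ?thesis
      unfolding R reachable_subspace_def M_def span_vec_eq
      by (intro span_minimal) auto
  qed
  then show ?thesis
    unfolding R_star_def span_vec_eq by (intro span_minimal) auto
qed

text \<open>At a real point, even a zero, real and imaginary parts of a null direction are real
  modes. At a nonreal stable point outside the listed zeros the pencil is onto, so the mode can be
  moved to stable real points. The target points may include real zeros, because surjectivity is
  needed only at the starting point.\<close>

lemma E_set_0_subset_span_modes:
  "E_set T A B C D z 0 \<subseteq>
     vec.span (cvec ` {v. \<exists>s w. complex_of_real s \<in> stable_region T \<and> mode A B C D s 0 v w})"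
    (is "_ \<subseteq> vec.span (cvec ` ?G)")
proof -
  have real: "v \<in> vec.span (cvec ` ?G)"
    if "complex_of_real s \<in> stable_region T"
      "mode (cmat A) (cmat B) (cmat C) (cmat D) (complex_of_real s) 0 v w" for s v w
  proof -
    have "re_vec v \<in> ?G" "im_vec v \<in> ?G"
      using that(1) mode_re_im[OF that(2)] by auto
    then have "cvec (re_vec v) + \<i> *s cvec (im_vec v) \<in> vec.span (cvec ` ?G)"
      by (intro vec.span_add vec.span_scale vec.span_base) auto
    then show ?thesis by (simp add: re_im_vec[symmetric])
  qed
  show ?thesis
  proof
    fix v assume "v \<in> E_set T A B C D z 0"
    then obtain s w where s: "s \<in> stable_region T" "s \<notin> nonreal_stable_zeros T A B C D"
      and m: "mode (cmat A) (cmat B) (cmat C) (cmat D) s 0 v w"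
      by (auto simp: E_set_def null_directions_iff)
    show "v \<in> vec.span (cvec ` ?G)"
    proof (cases "s \<in> \<real>")
      case True
      then show ?thesis using real s m by (auto elim!: Reals_cases)
    next
      case False
      then have nz: "s \<notin> invariant_zeros A B C D"
        using s by (auto simp: nonreal_stable_zeros_def)
      have "infinite (complex_of_real ` {s. complex_of_real s \<in> stable_region T})"
        using infinite_stable_reals by (simp add: finite_image_iff inj_on_def)
      from mode_span_other_points[OF pencil_surj[OF ri nz] m this]
      show ?thesis
      proof (rule subsetD[OF vec.span_minimal, rotated 2])
        show "{v'. \<exists>s'\<in>complex_of_real ` {s. complex_of_real s \<in> stable_region T}.
           \<exists>w'. mode (cmat A) (cmat B) (cmat C) (cmat D) s' 0 v' w'} \<subseteq> vec.span (cvec ` ?G)"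
          using real by blast
      qed simp
    qed
  qed
qed

end

section \<open>Independent transversals and conjugate pairs\<close>

text \<open>Rado's theorem on independent transversals, relative to the vectors \<open>X\<close>. The induction follows
  Halmos and Vaughan: either no proper subfamily is tight and any admissible vector can be chosen
  first, or a tight subfamily is treated first and its transversal joins \<open>X\<close>.\<close>

lemma rado_relative:
  fixes S :: "'i \<Rightarrow> ('a::field^'n) set"
  assumes "finite I" "\<And>K. K \<subseteq> I \<Longrightarrow> vec.dim X + card K \<le> vec.dim (X \<union> (\<Union>a\<in>K. S a))"
  shows "\<exists>v. (\<forall>a\<in>I. v a \<in> S a) \<and> vec.dim (X \<union> v ` I) = vec.dim X + card I"
  using assms
proof (induction "card I" arbitrary: I X rule: less_induct)
  case less
  note fin = less.prems(1) and rado = less.prems(2)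
  show ?case
  proof (cases "I = {}")
    case True
    then show ?thesis by simp
  next
    case nonempty: False
    show ?thesis
    proof (cases "\<exists>K. K \<subset> I \<and> K \<noteq> {} \<and> vec.dim (X \<union> (\<Union>a\<in>K. S a)) = vec.dim X + card K")
      case True
      then obtain K where K: "K \<subset> I" "K \<noteq> {}" and tight: "vec.dim (X \<union> (\<Union>a\<in>K. S a)) = vec.dim X + card K"
        by blast
      have finK: "finite K" and finIK: "finite (I - K)" using fin K finite_subset by auto
      have "\<exists>v. (\<forall>a\<in>K. v a \<in> S a) \<and> vec.dim (X \<union> v ` K) = vec.dim X + card K"
        by (rule less.hyps) (use K fin rado psubset_card_mono in \<open>auto simp: finK\<close>)
      then obtain v1 where v1: "\<And>a. a \<in> K \<Longrightarrow> v1 a \<in> S a"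
        and d1: "vec.dim (X \<union> v1 ` K) = vec.dim X + card K" by blast
      let ?X = "X \<union> v1 ` K"
      have sub: "?X \<subseteq> X \<union> (\<Union>a\<in>K. S a)" using v1 by blast
      \<comment> \<open>Tightness means that the transversal already spans everything the subfamily
        offers, so the condition for \<open>K \<union> L\<close> becomes the condition for
        \<open>L\<close> relative to \<open>?X\<close>.\<close>
      have sp: "vec.span ?X = vec.span (X \<union> (\<Union>a\<in>K. S a))"
      proof (rule vec.subspace_dim_equal)
        show "vec.span ?X \<subseteq> vec.span (X \<union> (\<Union>a\<in>K. S a))" using sub by (rule vec.span_mono)
      qed (use d1 tight in simp_all)
      have "\<exists>v. (\<forall>a\<in>I - K. v a \<in> S a) \<and> vec.dim (?X \<union> v ` (I - K)) = vec.dim ?X + card (I - K)"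
      proof (rule less.hyps[OF _ finIK])
        show "card (I - K) < card I"
          using K fin by (intro psubset_card_mono) auto
        fix L assume L: "L \<subseteq> I - K"
        have "vec.dim ?X + card L = vec.dim X + card (K \<union> L)"
          using L finK finIK d1 by (subst card_Un_disjoint) (auto intro: finite_subset)
        also have "\<dots> \<le> vec.dim (X \<union> (\<Union>a\<in>K \<union> L. S a))"
          using L K by (intro rado) auto
        also have "\<dots> \<le> vec.dim (?X \<union> (\<Union>a\<in>L. S a))"
        proof (rule vec.dim_mono)
          have "X \<union> (\<Union>a\<in>K. S a) \<subseteq> vec.span ?X"
            unfolding sp by (rule vec.span_superset)
          also have "\<dots> \<subseteq> vec.span (?X \<union> (\<Union>a\<in>L. S a))"
            by (intro vec.span_mono) auto
          finally show "X \<union> (\<Union>a\<in>K \<union> L. S a) \<subseteq> vec.span (?X \<union> (\<Union>a\<in>L. S a))"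
            using vec.span_superset[of "?X \<union> (\<Union>a\<in>L. S a)"] by auto
        qed
        finally show "vec.dim ?X + card L \<le> vec.dim (?X \<union> (\<Union>a\<in>L. S a))" .
      qed
      then obtain v2 where v2: "\<And>a. a \<in> I - K \<Longrightarrow> v2 a \<in> S a"
        and d2: "vec.dim (?X \<union> v2 ` (I - K)) = vec.dim ?X + card (I - K)" by blast
      define v where "v a = (if a \<in> K then v1 a else v2 a)" for a
      have "X \<union> v ` I = ?X \<union> v2 ` (I - K)" using K by (auto simp: v_def)
      moreover have "card I = card K + card (I - K)"
        using K fin finK by (simp add: card_Diff_subset card_mono psubset_imp_subset)
      ultimately have "vec.dim (X \<union> v ` I) = vec.dim X + card I" using d1 d2 by simp
      moreover have "\<forall>a\<in>I. v a \<in> S a" using v1 v2 by (auto simp: v_def)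
      ultimately show ?thesis by blast
    next
      case False
      obtain a where a: "a \<in> I" using nonempty by blast
      have "vec.dim X < vec.dim (X \<union> S a)" using rado[of "{a}"] a by simp
      then have "\<not> X \<union> S a \<subseteq> vec.span X" using vec.dim_mono by (metis leD)
      then obtain x where x: "x \<in> S a" "x \<notin> vec.span X"
        using vec.span_superset[of X] by blast
      have dx: "vec.dim (insert x X) = vec.dim X + 1" using x by (simp add: vec.dim_insert)
      have "\<exists>v. (\<forall>b\<in>I - {a}. v b \<in> S b) \<and>
        vec.dim (insert x X \<union> v ` (I - {a})) = vec.dim (insert x X) + card (I - {a})"
      proof (rule less.hyps)
        show "card (I - {a}) < card I" using a fin by (intro psubset_card_mono) auto
        show "finite (I - {a})" using fin by simp
        fix K assume K: "K \<subseteq> I - {a}"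
        \<comment> \<open>A nonempty \<open>K\<close> avoiding \<open>a\<close> is a proper
          subfamily and hence not tight; its spare dimension pays for \<open>x\<close>.\<close>
        show "vec.dim (insert x X) + card K \<le> vec.dim (insert x X \<union> (\<Union>a\<in>K. S a))"
        proof (cases "K = {}")
          case False
          then have "vec.dim (X \<union> (\<Union>a\<in>K. S a)) \<noteq> vec.dim X + card K"
            using \<open>\<nexists>K. _ K\<close> K a by auto
          moreover have "vec.dim X + card K \<le> vec.dim (X \<union> (\<Union>a\<in>K. S a))"
            using K by (intro rado) auto
          moreover have "vec.dim (X \<union> (\<Union>a\<in>K. S a)) \<le> vec.dim (insert x X \<union> (\<Union>a\<in>K. S a))"
            by (intro vec.dim_subset) auto
          ultimately show ?thesis using dx by simp
        qed simp
      qed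
      then obtain v where v: "\<And>b. b \<in> I - {a} \<Longrightarrow> v b \<in> S b"
        and d: "vec.dim (insert x X \<union> v ` (I - {a})) = vec.dim (insert x X) + card (I - {a})" by blast
      have "X \<union> (v(a := x)) ` I = insert x X \<union> v ` (I - {a})" using a by (auto simp: image_iff)
      moreover have "card I = Suc (card (I - {a}))" using fin a by (rule card.remove)
      ultimately have "vec.dim (X \<union> (v(a := x)) ` I) = vec.dim X + card I"
        unfolding \<open>X \<union> (v(a := x)) ` I = _\<close> d dx by simp
      moreover have "\<forall>b\<in>I. (v(a := x)) b \<in> S b" using v x by auto
      ultimately show ?thesis by blast
    qed
  qed
qed

lemma rado:
  fixes S :: "'i \<Rightarrow> ('a::field^'n) set"
  assumes "finite I" "\<And>K. K \<subseteq> I \<Longrightarrow> card K \<le> vec.dim (\<Union>a\<in>K. S a)"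
  obtains v where "\<And>a. a \<in> I \<Longrightarrow> v a \<in> S a" "vec.dim (v ` I) = card I"
  using rado_relative[of I "{}" S] assms by auto

section \<open>Bases as families of rows with nonzero determinant\<close>

lemma rows_lambda: "rows (\<chi> k. u k) = range u"
  by (auto simp: rows_def row_def)

text \<open>The determinant form of being a basis makes the exchange of conjugate pairs a question
  about a multilinear form.\<close>

lemma det_rows_nonzero_iff:
  fixes u :: "'n::finite \<Rightarrow> 'a::field^'n"
  shows "det (\<chi> k. u k) \<noteq> 0 \<longleftrightarrow> vec.span (range u) = UNIV"
  using matrix_left_invertible_span_rows_gen[of "\<chi> k. u k"]
  by (simp add: rows_lambda invertible_det_nz[symmetric] invertible_left_inverse)

lemma det_rows_nonzeroD:
  fixes u :: "'n::finite \<Rightarrow> 'a::field^'n"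
  assumes "det (\<chi> k. u k) \<noteq> 0"
  shows "vec.span (range u) = UNIV" "inj u" "vec.independent (range u)"
proof -
  show sp: "vec.span (range u) = UNIV" using assms det_rows_nonzero_iff by blast
  have "vec.dim (range u) = CARD('n)"
    using vec.dim_span[of "range u"] by (simp add: sp card_cart_basis del: vec.dim_span)
  then show "inj u" "vec.independent (range u)"
    using vec_family_independent[of UNIV u] by simp_all
qed

lemma det_row_upd_add:
  "det (\<chi> i. (u(k := x + y)) i) = det (\<chi> i. (u(k := x)) i) + det (\<chi> i. (u(k := y)) i)"
  using det_row_add[of k "\<lambda>_. x" "\<lambda>_. y" u] by (simp add: fun_upd_def)

lemma det_row_upd_scale:
  "det (\<chi> i. (u(k := c *s x)) i) = c * det (\<chi> i. (u(k := x)) i)"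
  using det_row_mul[of k c "\<lambda>_. x" u] by (simp add: fun_upd_def)

text \<open>With \<open>u p = x\<close> and \<open>u q = conj_vec y\<close> the determinant is sesquilinear in \<open>(x, y)\<close>, so by polarization
  it does not vanish on the whole diagonal.\<close>

lemma conjugate_pair_exchange:
  fixes u :: "'n::finite \<Rightarrow> complex^'n"
  assumes pq: "p \<noteq> q" and U: "vec.subspace U" "u p \<in> U" "conj_vec (u q) \<in> U"
    and d: "det (\<chi> k. u k) \<noteq> 0"
  obtains x where "x \<in> U" "det (\<chi> k. (u(p := x, q := conj_vec x)) k) \<noteq> 0"
proof -
  define g where "g x y = det (\<chi> k. (u(p := x, q := conj_vec y)) k)" for x y
  have add1: "g (x + x') y = g x y + g x' y" for x x' y
    using pq det_row_upd_add[of "u(q := conj_vec y)" p x x'] by (simp add: g_def fun_upd_twist)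
  have add2: "g x (y + y') = g x y + g x y'" for x y y'
    using det_row_upd_add[of "u(p := x)" q "conj_vec y" "conj_vec y'"] by (simp add: g_def)
  have sc1: "g (a *s x) y = a * g x y" for a x y
    using pq det_row_upd_scale[of "u(q := conj_vec y)" p a x] by (simp add: g_def fun_upd_twist)
  have sc2: "g x (a *s y) = cnj a * g x y" for a x y
    using det_row_upd_scale[of "u(p := x)" q "cnj a" "conj_vec y"] by (simp add: g_def)
  have "\<exists>x\<in>U. g x x \<noteq> 0"
  proof (rule ccontr)
    assume "\<not> (\<exists>x\<in>U. g x x \<noteq> 0)"
    then have z: "g x x = 0" if "x \<in> U" for x using that by blast
    define x where "x = u p"
    define y where "y = conj_vec (u q)"
    have xy: "x \<in> U" "y \<in> U" using U by (simp_all add: x_def y_def)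
    \<comment> \<open>Vanishing at \<open>x + y\<close> gives \<open>g x y + g y x = 0\<close>, and
      at \<open>x + \<i> *s y\<close> it gives \<open>g y x = g x y\<close>. Hence
      \<open>g x y = 0\<close>, although \<open>g x y\<close> is the original determinant.\<close>
    have "g (x + y) (x + y) = 0" "g (x + \<i> *s y) (x + \<i> *s y) = 0"
      using U(1) xy by (auto intro!: z vec.subspace_add vec.subspace_scale)
    then have "g x y + g y x = 0" "- \<i> * g x y + \<i> * g y x = 0"
      by (simp_all add: add1 add2 sc1 sc2 z xy)
    then have "g x y + g y x = 0" "\<i> * (g y x - g x y) = 0"
      by (simp_all add: algebra_simps)
    then have "g x y = 0" by simp
    moreover have "g x y = det (\<chi> k. u k)" by (simp add: g_def x_def y_def)
    ultimately show False using d by simp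
  qed
  then show thesis using that g_def by auto
qed

text \<open>Pairs are treated one after another: each exchange keeps the determinant nonzero, and
  disjointness of the indices leaves finished pairs intact.\<close>

lemma conjugate_pairs_exchange:
  fixes u :: "'n::finite \<Rightarrow> complex^'n"
  assumes "finite R" "inj_on p R" "inj_on q R" "p ` R \<inter> q ` R = {}"
    and "\<And>r. r \<in> R \<Longrightarrow> vec.subspace (U r) \<and> u (p r) \<in> U r \<and> conj_vec (u (q r)) \<in> U r"
    and "det (\<chi> k. u k) \<noteq> 0"
  shows "\<exists>u'. det (\<chi> k. u' k) \<noteq> 0 \<and> (\<forall>k. k \<notin> p ` R \<union> q ` R \<longrightarrow> u' k = u k) \<and>
    (\<forall>r\<in>R. u' (p r) \<in> U r \<and> u' (q r) = conj_vec (u' (p r)))"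
  using assms
proof (induction R rule: finite_induct)
  case empty
  then show ?case by auto
next
  case (insert r R)
  have "\<exists>u'. det (\<chi> k. u' k) \<noteq> 0 \<and> (\<forall>k. k \<notin> p ` R \<union> q ` R \<longrightarrow> u' k = u k) \<and>
    (\<forall>r\<in>R. u' (p r) \<in> U r \<and> u' (q r) = conj_vec (u' (p r)))"
    using insert.prems by (intro insert.IH) auto
  then obtain u' where u': "det (\<chi> k. u' k) \<noteq> 0" "\<And>k. k \<notin> p ` R \<union> q ` R \<Longrightarrow> u' k = u k"
    "\<And>r. r \<in> R \<Longrightarrow> u' (p r) \<in> U r \<and> u' (q r) = conj_vec (u' (p r))" by blast
  have notin: "p r \<notin> p ` R \<union> q ` R" "q r \<notin> p ` R \<union> q ` R" "p r \<noteq> q r"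
    using insert.prems(1,2,3) insert.hyps(2) by auto
  obtain x where x: "x \<in> U r" "det (\<chi> k. (u'(p r := x, q r := conj_vec x)) k) \<noteq> 0"
    using conjugate_pair_exchange[of "p r" "q r" "U r" u'] insert.prems(4)[of r] u'(1,2) notin
    by auto
  have ne: "p r' \<noteq> p r" "p r' \<noteq> q r" "q r' \<noteq> p r" "q r' \<noteq> q r" if "r' \<in> R" for r'
    using notin imageI[OF that, of p] imageI[OF that, of q] by (metis UnI1 UnI2)+
  show ?case
    by (rule exI[of _ "u'(p r := x, q r := conj_vec x)"]) (use x u' notin ne in auto)
qed

text \<open>A complex matrix \<open>H\<close> with \<open>H b k = w k\<close> exists because the
  \<open>b k\<close> form a basis. Closure of the data under conjugation makes the conjugate of
  \<open>H\<close> satisfy the same equations, so their mean, the entrywise real part of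
  \<open>H\<close>, does too.\<close>

lemma feedback_exists:
  fixes b :: "'n::finite \<Rightarrow> complex^'n" and w :: "'n \<Rightarrow> complex^'m"
  assumes d: "det (\<chi> k. b k) \<noteq> 0"
    and conj: "\<And>k. \<exists>k'. b k' = conj_vec (b k) \<and> w k' = conj_vec (w k)"
  obtains F :: "real^'n^'m" where "\<And>k. cmat F *v b k = w k"
proof -
  note b = det_rows_nonzeroD[OF d]
  obtain g where g: "Vector_Spaces.linear (*s) (*s) g" "\<forall>x\<in>range b. g x = w (inv b x)"
    using vec.linear_independent_extend[OF b(3), of "\<lambda>x. w (inv b x)"] by blast
  define H where "H = matrix g"
  have H: "H *v b k = w k" for k
    unfolding H_def using g b(2) by (simp add: matrix_works)
  define F :: "real^'n^'m" where "F = (\<chi> i j. Re (H $ i $ j))"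
  have "cmat F *v b k = w k" for k
  proof -
    obtain k' where k': "b k' = conj_vec (b k)" "w k' = conj_vec (w k)" using conj by blast
    have "conj_vec (H *v conj_vec (b k)) = w k"
      using H[of k'] k' by simp
    then have *: "cnj (\<Sum>j\<in>UNIV. H $ i $ j * cnj (b k $ j)) = w k $ i" for i
      by (auto simp: conj_vec_def matrix_vector_mult_def vec_eq_iff)
    have **: "(\<Sum>j\<in>UNIV. H $ i $ j * b k $ j) = w k $ i" for i
      using H[of k] by (auto simp: matrix_vector_mult_def vec_eq_iff)
    have re: "complex_of_real (Re h) = (h + cnj h) / 2" for h
      by (simp add: complex_eq_iff)
    have "(cmat F *v b k) $ i = ((\<Sum>j\<in>UNIV. H $ i $ j * b k $ j) + cnj (\<Sum>j\<in>UNIV. H $ i $ j * cnj (b k $ j))) / 2" for i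
      by (simp add: matrix_vector_mult_def cmat_def map_matrix_def F_def re sum.distrib[symmetric]
          sum_divide_distrib algebra_simps)
    then show ?thesis unfolding * ** by (simp add: vec_eq_iff)
  qed
  then show thesis by (rule that)
qed

text \<open>Comparing coefficients in the eigenbasis removes every mode with another eigenvalue.
  Both the spectrum and the observable eigenvalues of the closed loop are computed from
  this.\<close>

lemma eigenvector_expansion:
  fixes b :: "'n::finite \<Rightarrow> 'a::field^'n"
  assumes d: "det (\<chi> k. b k) \<noteq> 0" and eig: "\<And>k. M *v b k = \<mu> k *s b k"
    and v: "M *v v = s *s v"
  obtains c where "v = (\<Sum>k\<in>{k. \<mu> k = s}. c k *s b k)"
proof -
  note b = det_rows_nonzeroD[OF d]
  obtain c where c: "v = (\<Sum>k\<in>UNIV. c k *s b k)"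
    using vec_span_finite_image[of UNIV b v] b by auto
  have "M *v v = (\<Sum>k\<in>UNIV. (c k * \<mu> k) *s b k)"
    unfolding c by (simp add: vec.sum vec.scale eig)
  moreover have "s *s v = (\<Sum>k\<in>UNIV. (c k * s) *s b k)"
    unfolding c by (simp add: vec.scale_sum_right mult.commute)
  ultimately have "(\<Sum>k\<in>UNIV. (c k * \<mu> k - c k * s) *s b k) = 0"
    using v by (simp add: vec.scale_left_diff_distrib sum_subtractf)
  then have "c k * \<mu> k - c k * s = 0" for k
    using vec_family_independentD[of UNIV b "\<lambda>k. c k * \<mu> k - c k * s" k] b by simp
  then have "c k = 0" if "\<mu> k \<noteq> s" for k
    using that by (metis eq_iff_diff_eq_0 mult_cancel_left)
  then have "v = (\<Sum>k\<in>{k. \<mu> k = s}. c k *s b k)"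
    unfolding c by (intro sum.mono_neutral_right) auto
  then show thesis by (rule that)
qed

section \<open>Closed-loop synthesis\<close>

lemma scalar_linear_ode_decay:
  fixes f :: "real \<Rightarrow> complex"
  assumes f: "\<And>t. t \<ge> 0 \<Longrightarrow> (f has_vector_derivative \<mu> * f t) (at t within {0..})" and \<mu>: "Re \<mu> < 0"
  shows "(f \<longlongrightarrow> 0) at_top"
proof -
  have e: "((\<lambda>t. exp (of_real t * (- \<mu>))) has_vector_derivative exp (of_real t * (- \<mu>)) * (- \<mu>)) (at t within {0..})" for t :: real
    using exp_scaleR_has_vector_derivative_right[of "- \<mu>" t] by (simp only: scaleR_conv_of_real)
  \<comment> \<open>The integrating factor makes the product constant, so \<open>f\<close> is a
    multiple of \<open>exp (\<mu> t)\<close>.\<close>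
  have "((\<lambda>t. f t * exp (of_real t * (- \<mu>))) has_vector_derivative 0) (at t within {0..})" if "t \<in> {0..}" for t
    using has_vector_derivative_mult[OF f[of t] e[of t]] that by (simp add: algebra_simps)
  then obtain k where k: "\<And>t. t \<in> {0..} \<Longrightarrow> f t * exp (of_real t * (- \<mu>)) = k"
    using has_vector_derivative_zero_constant[of "{0..}" "\<lambda>t. f t * exp (of_real t * (- \<mu>))"] convex_real_interval
    by blast
  have ft: "f t = k * exp (of_real t * \<mu>)" if "t \<ge> 0" for t
    using k[of t] that by (simp add: exp_minus field_simps)
  have "((\<lambda>t. norm k * exp (Re \<mu> * t)) \<longlongrightarrow> 0) at_top"
  proof (rule tendsto_mult_right_zero)
    have "filterlim (\<lambda>t. Re \<mu> * t) at_bot at_top"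
      using \<mu> by (rule filterlim_tendsto_neg_mult_at_bot[OF tendsto_const _ filterlim_ident])
    then show "((\<lambda>t. exp (Re \<mu> * t)) \<longlongrightarrow> 0) at_top"
      using filterlim_compose[OF exp_at_bot] by blast
  qed
  then show ?thesis
  proof (rule Lim_null_comparison[rotated])
    show "\<forall>\<^sub>F t in at_top. norm (f t) \<le> norm k * exp (Re \<mu> * t)"
      using eventually_ge_at_top[of 0]
      by eventually_elim (simp add: ft norm_mult mult.commute)
  qed
qed

text \<open>The rows of \<open>L\<close> are the left eigenvectors, so \<open>L *v cvec x\<close> collects the modal coordinates of \<open>x\<close>.\<close>

lemma modal_coordinates:
  fixes b :: "'n::finite \<Rightarrow> complex^'n"
  assumes d: "det (\<chi> k. b k) \<noteq> 0" and eig: "\<And>k. M *v b k = \<mu> k *s b k"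
  obtains L where "\<And>x k. (L *v (M *v x)) $ k = \<mu> k * (L *v x) $ k"
    and "\<And>x. x = (\<Sum>k\<in>UNIV. (L *v x) $ k *s b k)"
proof -
  define V where "V = transpose (\<chi> k. b k)"
  have "invertible V"
    unfolding V_def invertible_det_nz using d by (simp add: det_transpose)
  then obtain L where L: "V ** L = mat 1" "L ** V = mat 1" unfolding invertible_def by blast
  have col: "V *v y = (\<Sum>k\<in>UNIV. y $ k *s b k)" for y
    by (simp add: V_def matrix_mult_sum column_def transpose_def)
  have exp: "x = (\<Sum>k\<in>UNIV. (L *v x) $ k *s b k)" for x
    unfolding col[symmetric] by (simp add: matrix_vector_mul_assoc L)
  have LV: "L *v (V *v y) = y" for y
    by (simp add: matrix_vector_mul_assoc L)
  have "(L *v (M *v x)) $ k = \<mu> k * (L *v x) $ k" for x k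
  proof -
    let ?y = "\<chi> k. \<mu> k * (L *v x) $ k"
    have "M *v x = M *v (\<Sum>k\<in>UNIV. (L *v x) $ k *s b k)" using exp[of x] by simp
    also have "\<dots> = V *v ?y"
      by (simp add: col vec.sum vec.scale eig mult.commute)
    finally show ?thesis by (simp add: LV)
  qed
  then show thesis using exp that by blast
qed

lemma tendsto_0_of_modal_coordinates:
  fixes \<xi> :: "'t \<Rightarrow> real^'n"
  assumes x: "\<And>x. x = (\<Sum>k\<in>UNIV. (L *v x) $ k *s b k)"
    and lim: "\<And>k. ((\<lambda>t. (L *v cvec (\<xi> t)) $ k) \<longlongrightarrow> 0) G"
  shows "(\<xi> \<longlongrightarrow> 0) G"
proof (rule vec_tendstoI)
  fix i
  have "\<xi> t $ i = Re (\<Sum>k\<in>UNIV. (L *v cvec (\<xi> t)) $ k * b k $ i)" for t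
  proof -
    have "\<xi> t $ i = Re (cvec (\<xi> t) $ i)" by (simp add: cvec_def)
    also have "cvec (\<xi> t) = (\<Sum>k\<in>UNIV. (L *v cvec (\<xi> t)) $ k *s b k)" by (rule x)
    finally show ?thesis by simp
  qed
  moreover have "((\<lambda>t. Re (\<Sum>k\<in>UNIV. (L *v cvec (\<xi> t)) $ k * b k $ i)) \<longlongrightarrow> Re (\<Sum>k\<in>UNIV. 0 * b k $ i)) G"
    by (intro tendsto_intros lim)
  ultimately show "((\<lambda>t. \<xi> t $ i) \<longlongrightarrow> 0 $ i) G" by simp
qed

lemma tendsto_matrix_vector_mult [tendsto_intros]:
  fixes M :: "real^'n^'m"
  shows "(f \<longlongrightarrow> l) G \<Longrightarrow> ((\<lambda>t. M *v f t) \<longlongrightarrow> M *v l) G"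
  by (rule bounded_linear.tendsto[OF matrix_vector_mul_bounded_linear])

text \<open>The deviation from the equilibrium obeys the homogeneous closed loop, and each of its
  modal coordinates satisfies a scalar equation with stable multiplier, so the state converges to
  the equilibrium and the output to \<open>r\<close>.\<close>

lemma tracks_constants_if_equilibria:
  fixes A :: "real^'n^'n" and B :: "real^'m^'n" and C :: "real^'n^'p" and D :: "real^'m^'p"
    and b :: "'n \<Rightarrow> complex^'n"
  assumes d: "det (\<chi> k. b k) \<noteq> 0" and eig: "\<And>k. cmat (A + B ** F) *v b k = \<mu> k *s b k"
    and stable: "\<And>k. \<mu> k \<in> stable_region T"
    and equil: "\<And>r. \<exists>x\<^sub>0. A *v x\<^sub>0 + B *v (F *v x\<^sub>0 + G *v r) = dc_point T *s x\<^sub>0 \<and>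
        C *v x\<^sub>0 + D *v (F *v x\<^sub>0 + G *v r) = r"
  shows "tracks_constants T A B C D F G"
proof -
  obtain L where L: "\<And>x k. (L *v (cmat (A + B ** F) *v x)) $ k = \<mu> k * (L *v x) $ k"
    and expand: "\<And>x. x = (\<Sum>k\<in>UNIV. (L *v x) $ k *s b k)"
    using modal_coordinates[OF d eig] by metis
  define \<phi> where "\<phi> k x = (L *v cvec x) $ k" for k and x :: "real^'n"
  have \<phi>M: "\<phi> k ((A + B ** F) *v x) = \<mu> k * \<phi> k x" for k x
    by (simp add: \<phi>_def cvec_mult L)
  have to0: "(\<xi> \<longlongrightarrow> 0) H" if "\<And>k. ((\<lambda>t. \<phi> k (\<xi> t)) \<longlongrightarrow> 0) H" for \<xi> and H :: "'t filter"
    using tendsto_0_of_modal_coordinates[OF expand] that unfolding \<phi>_def by blast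
  have out: "(y \<longlongrightarrow> r) H"
    if lim: "((\<lambda>t. x t - x\<^sub>0) \<longlongrightarrow> 0) H" and r: "C *v x\<^sub>0 + D *v (F *v x\<^sub>0 + G *v r) = r"
      and ev: "\<forall>\<^sub>F t in H. y t = C *v x t + D *v (F *v x t + G *v r)"
    for x\<^sub>0 r x y and H :: "'t filter"
  proof -
    have "(x \<longlongrightarrow> x\<^sub>0) H" using lim by (simp add: LIM_zero_iff)
    then have "((\<lambda>t. C *v x t + D *v (F *v x t + G *v r)) \<longlongrightarrow> C *v x\<^sub>0 + D *v (F *v x\<^sub>0 + G *v r)) H"
      by (intro tendsto_intros)
    then show ?thesis unfolding r by (rule Lim_transform_eventually) (use ev in eventually_elim, simp)
  qed
  \<comment> \<open>One identity serves both time domains: the dc value is 0 when the right side is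
    a derivative and 1 when it is the next state.\<close>
  have step: "A *v x + B *v (F *v x + G *v r) = dc_point T *s x\<^sub>0 + (A + B ** F) *v (x - x\<^sub>0)"
    if "A *v x\<^sub>0 + B *v (F *v x\<^sub>0 + G *v r) = dc_point T *s x\<^sub>0" for x x\<^sub>0 r
    unfolding that[symmetric]
    by (simp add: vec.diff vec.add matrix_vector_mult_add_rdistrib flip: matrix_vector_mul_assoc)
  show ?thesis
  proof (cases T)
    case Continuous
    have "(y \<longlongrightarrow> r) at_top"
      if sys: "\<And>t. t \<ge> 0 \<Longrightarrow> (x has_vector_derivative A *v x t + B *v u t) (at t within {0..}) \<and>
         u t = F *v x t + G *v r \<and> y t = C *v x t + D *v u t" for r x u y
    proof -
      obtain x\<^sub>0 where x0: "A *v x\<^sub>0 + B *v (F *v x\<^sub>0 + G *v r) = dc_point T *s x\<^sub>0"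
        "C *v x\<^sub>0 + D *v (F *v x\<^sub>0 + G *v r) = r" using equil by blast
      have der: "((\<lambda>t. x t - x\<^sub>0) has_vector_derivative (A + B ** F) *v (x t - x\<^sub>0)) (at t within {0..})"
        if "t \<ge> 0" for t
        using sys[OF that] step[OF x0(1), of "x t"] Continuous
        by (auto simp: dc_point_def intro!: derivative_eq_intros)
      have "((\<lambda>t. \<phi> k (x t - x\<^sub>0)) \<longlongrightarrow> 0) at_top" for k
      proof (rule scalar_linear_ode_decay)
        have "linear (\<phi> k)"
          by (rule linearI) (simp_all add: \<phi>_def cvec_add vec.add vec.scale cvec_scale
              scalar_mult_eq_scaleR[symmetric] scaleR_conv_of_real)
        then have bl: "bounded_linear (\<phi> k)" by (simp add: linear_linear)
        show "((\<lambda>t. \<phi> k (x t - x\<^sub>0)) has_vector_derivative \<mu> k * \<phi> k (x t - x\<^sub>0)) (at t within {0..})"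
          if "t \<ge> 0" for t
          using bounded_linear.has_vector_derivative[OF bl der[OF that]] by (simp add: \<phi>M)
        show "Re (\<mu> k) < 0" using stable[of k] Continuous by (simp add: stable_region_def)
      qed
      then have "((\<lambda>t. x t - x\<^sub>0) \<longlongrightarrow> 0) at_top" by (rule to0)
      then show ?thesis
      proof (rule out[OF _ x0(2)])
        show "\<forall>\<^sub>F t in at_top. y t = C *v x t + D *v (F *v x t + G *v r)"
          using eventually_ge_at_top[of 0] by eventually_elim (use sys in simp)
      qed
    qed
    then show ?thesis unfolding tracks_constants_def Continuous time_domain.case by blast
  next
    case Discrete
    have "y \<longlonglongrightarrow> r"
      if sys: "\<And>t. x (Suc t) = A *v x t + B *v u t \<and> u t = F *v x t + G *v r \<and>
         y t = C *v x t + D *v u t" for r x u y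
    proof -
      obtain x\<^sub>0 where x0: "A *v x\<^sub>0 + B *v (F *v x\<^sub>0 + G *v r) = dc_point T *s x\<^sub>0"
        "C *v x\<^sub>0 + D *v (F *v x\<^sub>0 + G *v r) = r" using equil by blast
      have suc: "x (Suc t) - x\<^sub>0 = (A + B ** F) *v (x t - x\<^sub>0)" for t
        using sys[of t] step[OF x0(1), of "x t"] Discrete by (simp add: dc_point_def)
      have "(\<lambda>t. \<phi> k (x t - x\<^sub>0)) \<longlonglongrightarrow> 0" for k
      proof -
        define \<phi>\<^sub>0 where "\<phi>\<^sub>0 = \<phi> k (x 0 - x\<^sub>0)"
        have "\<phi> k (x t - x\<^sub>0) = \<mu> k ^ t * \<phi>\<^sub>0" for t
          by (induction t) (simp_all add: suc \<phi>M \<phi>\<^sub>0_def)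
        moreover have "(\<lambda>t. \<mu> k ^ t) \<longlonglongrightarrow> 0"
          using stable[of k] Discrete by (intro LIMSEQ_power_zero) (simp add: stable_region_def)
        ultimately show ?thesis by (simp add: tendsto_mult_left_zero)
      qed
      then have "(\<lambda>t. x t - x\<^sub>0) \<longlonglongrightarrow> 0" by (rule to0)
      then show ?thesis by (rule out[OF _ x0(2)]) (use sys in simp)
    qed
    then show ?thesis unfolding tracks_constants_def Discrete time_domain.case by blast
  qed
qed

lemma dc_point_unstable: "complex_of_real (dc_point T) \<notin> stable_region T"
  by (simp add: dc_point_def stable_region_def split: time_domain.split)

context
  fixes A :: "real^'n^'n" and B :: "real^'m^'n" and C :: "real^'n^'p" and D :: "real^'m^'p" and T
  assumes ri: "right_invertible A B C D"
    and dc: "complex_of_real (dc_point T) \<notin> invariant_zeros A B C D"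
begin

text \<open>The dc point is no closed-loop eigenvalue, so the gain is defined. It is onto because a
  mode \<open>(x, w)\<close> at the dc point with output \<open>r\<close> is the steady state
  produced by the external input \<open>w - F x\<close>.\<close>

lemma dc_gain_right_inverse_exists:
  assumes "eigenvalues (A + B ** F) \<subseteq> stable_region T"
  obtains G where "closed_loop_dc_gain T A B C D F ** G = mat 1"
    and "\<And>r. \<exists>x\<^sub>0. A *v x\<^sub>0 + B *v (F *v x\<^sub>0 + G *v r) = dc_point T *s x\<^sub>0 \<and>
        C *v x\<^sub>0 + D *v (F *v x\<^sub>0 + G *v r) = r"
proof -
  let ?s = "dc_point T"
  define M where "M = A + B ** F"
  define N where "N = mat ?s - M"
  let ?K = "closed_loop_dc_gain T A B C D F"
  have Nx: "N *v x = ?s *s x - M *v x" for x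
    by (simp add: N_def matrix_vector_mult_diff_rdistrib matrix_scalar_mult_vec)
  have "x = 0" if "N *v x = 0" for x
  proof (rule ccontr)
    assume "x \<noteq> 0"
    then have "cvec x \<noteq> 0" using cvec_eq_iff[of x 0] by simp
    moreover have "cmat M *v cvec x = complex_of_real ?s *s cvec x"
      using that Nx[of x] by (simp flip: cvec_mult cvec_scale)
    ultimately have "complex_of_real ?s \<in> eigenvalues M" unfolding eigenvalues_def by blast
    then show False using assms dc_point_unstable M_def by blast
  qed
  then have "invertible N" by (simp add: invertible_left_inverse matrix_left_invertible_ker)
  then have inv: "N ** matrix_inv N = mat 1" "matrix_inv N ** N = mat 1"
    unfolding matrix_inv_def invertible_def by (rule someI2_ex, simp)+
  have K: "?K *v u = (C + D ** F) *v (matrix_inv N *v (B *v u)) + D *v u" for u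
    by (simp add: closed_loop_dc_gain_def N_def M_def matrix_vector_mult_add_rdistrib
        matrix_vector_mul_assoc matrix_mul_assoc)
  have "\<exists>u. r = ?K *v u" for r
  proof -
    obtain x w where m: "mode A B C D ?s r x w" using real_mode_exists[OF ri dc] by metis
    define u where "u = w - F *v x"
    have "B *v u = N *v x"
      using m by (simp add: mode_def u_def Nx M_def vec.diff matrix_vector_mult_add_rdistrib
          algebra_simps matrix_vector_mul_assoc)
    then have x: "matrix_inv N *v (B *v u) = x" by (simp add: matrix_vector_mul_assoc inv)
    have "?K *v u = (C + D ** F) *v x + D *v u" unfolding K x ..
    also have "\<dots> = C *v x + D *v w"
      by (simp add: u_def vec.diff matrix_vector_mult_add_rdistrib flip: matrix_vector_mul_assoc)
    finally have "?K *v u = r" using m by (simp add: mode_def)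
    then show ?thesis by metis
  qed
  then have "surj ((*v) ?K)" unfolding surj_def by blast
  then obtain G where G: "?K ** G = mat 1" using matrix_right_invertible_surjective by blast
  moreover have "\<exists>x\<^sub>0. A *v x\<^sub>0 + B *v (F *v x\<^sub>0 + G *v r) = ?s *s x\<^sub>0 \<and>
        C *v x\<^sub>0 + D *v (F *v x\<^sub>0 + G *v r) = r" for r
  proof -
    define x where "x = matrix_inv N *v (B *v (G *v r))"
    have "N *v x = B *v (G *v r)" by (simp add: x_def matrix_vector_mul_assoc[of N] inv)
    then have "A *v x + B *v (F *v x + G *v r) = ?s *s x"
      by (simp add: Nx M_def vec.add matrix_vector_mult_add_rdistrib algebra_simps
          flip: matrix_vector_mul_assoc)
    moreover have "?K *v (G *v r) = r" by (simp add: matrix_vector_mul_assoc G)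
    then have "C *v x + D *v (F *v x + G *v r) = r"
      by (simp add: K x_def[symmetric] vec.add matrix_vector_mult_add_rdistrib algebra_simps
          flip: matrix_vector_mul_assoc)
    ultimately show ?thesis by blast
  qed
  ultimately show thesis by (rule that)
qed

text \<open>Modes are indexed here by the coordinates of the state space, so that the determinant
  criterion applies; \<open>e\<close> carries them to the index pairs of
  \<open>decoupling_eigenbasis\<close>.\<close>

lemma solvable_of_modes:
  fixes b :: "'n \<Rightarrow> complex^'n" and w :: "'n \<Rightarrow> complex^'m" and y :: "'n \<Rightarrow> complex^'p"
    and \<mu> :: "'n \<Rightarrow> complex" and e :: "'n \<Rightarrow> 'p option \<times> nat"
  assumes d: "det (\<chi> k. b k) \<noteq> 0"
    and modes: "\<And>k. mode (cmat A) (cmat B) (cmat C) (cmat D) (\<mu> k) (y k) (b k) (w k)"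
    and e: "bij_betw e UNIV (mode_indices \<nu>\<^sub>0 \<nu>)"
    and y_None: "\<And>k. fst (e k) = None \<Longrightarrow> y k = 0"
    and y_Some: "\<And>k i. fst (e k) = Some i \<Longrightarrow> \<exists>\<alpha>. \<alpha> \<noteq> 0 \<and> y k = \<alpha> *s axis i 1"
    and stable: "\<And>k. \<mu> k \<in> stable_region T"
    and real: "\<And>k. \<mu> k \<in> \<real> \<Longrightarrow> conj_vec (b k) = b k \<and> conj_vec (w k) = w k"
    and nonreal: "\<And>k. \<mu> k \<notin> \<real> \<Longrightarrow> \<exists>k'. fst (e k') = fst (e k) \<and> \<mu> k' = cnj (\<mu> k) \<and>
        b k' = conj_vec (b k) \<and> w k' = conj_vec (w k)"
    and inj: "\<And>i. inj_on \<mu> {k. fst (e k) = Some i}"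
    and nz: "\<And>k. fst (e k) \<noteq> None \<Longrightarrow> \<mu> k \<notin> invariant_zeros A B C D"
    and free: "\<And>k. \<mu> k \<notin> \<real> \<Longrightarrow> \<mu> k \<in> invariant_zeros A B C D"
  shows "problem_1C_solvable T A B C D \<nu>\<^sub>0 \<nu>"
proof -
  note basis = det_rows_nonzeroD[OF d]
  obtain F :: "real^'n^'m" where F: "\<And>k. cmat F *v b k = w k"
    using feedback_exists[OF d, of w] real nonreal by metis
  have eig: "cmat (A + B ** F) *v b k = \<mu> k *s b k" and out: "cmat (C + D ** F) *v b k = y k" for k
    using modes[of k] F[of k]
    by (simp_all add: mode_def cmat_add cmat_mult matrix_vector_mult_add_rdistrib
        flip: matrix_vector_mul_assoc)
  have b0: "b k \<noteq> 0" for k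
    using basis(3) vec.dependent_zero by (metis rangeI)
  have eigs: "eigenvalues (A + B ** F) \<subseteq> range \<mu>"
  proof
    fix s assume "s \<in> eigenvalues (A + B ** F)"
    then obtain v where v: "v \<noteq> 0" "cmat (A + B ** F) *v v = s *s v"
      by (auto simp: eigenvalues_def)
    obtain c where c: "v = (\<Sum>k\<in>{k. \<mu> k = s}. c k *s b k)"
      using eigenvector_expansion[OF d eig v(2)] by metis
    show "s \<in> range \<mu>"
    proof (rule ccontr)
      assume "s \<notin> range \<mu>"
      then have "{k. \<mu> k = s} = {}" by auto
      then show False using c v(1) by simp
    qed
  qed
  then have stab: "eigenvalues (A + B ** F) \<subseteq> stable_region T" using stable by auto
  \<comment> \<open>An eigenvector visible at output \<open>i\<close> is a combination of modes with
    its own eigenvalue, and one of these must be labelled by \<open>i\<close>, since modes labelled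
    otherwise have zero there.\<close>
  have obs: "observable_eigenvalues A B C D F i = \<mu> ` {k. fst (e k) = Some i}" for i
  proof (intro equalityI subsetI)
    fix s assume "s \<in> observable_eigenvalues A B C D F i"
    then obtain v where v: "(cmat (C + D ** F) *v v) $ i \<noteq> 0" "cmat (A + B ** F) *v v = s *s v"
      by (auto simp: observable_eigenvalues_def)
    obtain c where c: "v = (\<Sum>k\<in>{k. \<mu> k = s}. c k *s b k)"
      using eigenvector_expansion[OF d eig v(2)] by metis
    have "cmat (C + D ** F) *v v = (\<Sum>k\<in>{k. \<mu> k = s}. c k *s y k)"
      unfolding c by (simp add: vec.sum vec.scale out)
    then have "(\<Sum>k\<in>{k. \<mu> k = s}. c k * y k $ i) \<noteq> 0" using v(1) by simp
    then obtain k where k: "\<mu> k = s" "y k $ i \<noteq> 0"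
      by (metis (mono_tags, lifting) mem_Collect_eq mult_zero_right sum.neutral)
    have "fst (e k) = Some i"
    proof (cases "fst (e k)")
      case None
      then show ?thesis using y_None k(2) by auto
    next
      case (Some j)
      then show ?thesis using y_Some[OF Some] k(2) by (auto simp: axis_def split: if_splits)
    qed
    then show "s \<in> \<mu> ` {k. fst (e k) = Some i}" using k(1) by blast
  next
    fix s assume "s \<in> \<mu> ` {k. fst (e k) = Some i}"
    then obtain k where k: "s = \<mu> k" "fst (e k) = Some i" by blast
    then have "(cmat (C + D ** F) *v b k) $ i \<noteq> 0"
      using y_Some[OF k(2)] by (auto simp: out axis_def)
    then show "s \<in> observable_eigenvalues A B C D F i"
      unfolding observable_eigenvalues_def using eig k(1) by blast
  qed
  obtain G where G: "closed_loop_dc_gain T A B C D F ** G = mat 1"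
    and equil: "\<And>r. \<exists>x\<^sub>0. A *v x\<^sub>0 + B *v (F *v x\<^sub>0 + G *v r) = dc_point T *s x\<^sub>0 \<and>
        C *v x\<^sub>0 + D *v (F *v x\<^sub>0 + G *v r) = r"
    using dc_gain_right_inverse_exists[OF stab] by metis
  have tracks: "tracks_constants T A B C D F G"
    by (rule tracks_constants_if_equilibria[OF d eig stable equil])
  define f where "f = inv_into UNIV e"
  have fe: "f (e k) = k" for k
    unfolding f_def using e by (simp add: bij_betw_def)
  have ef: "e (f a) = a" if "a \<in> mode_indices \<nu>\<^sub>0 \<nu>" for a
    unfolding f_def using e that by (simp add: bij_betw_def f_inv_into_f)
  have eI: "e k \<in> mode_indices \<nu>\<^sub>0 \<nu>" for k using e by (auto simp: bij_betw_def)
  have fI: "f ` mode_indices \<nu>\<^sub>0 \<nu> = UNIV"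
    using fe eI by (metis UNIV_eq_I image_eqI)
  have dec: "decoupling_eigenbasis A B C D F \<nu>\<^sub>0 \<nu> (\<mu> \<circ> f) (b \<circ> f)"
    unfolding decoupling_eigenbasis_def Let_def
  proof (intro conjI)
    show "inj_on (b \<circ> f) (mode_indices \<nu>\<^sub>0 \<nu>)"
      by (rule inj_onI) (metis basis(2) comp_apply ef injD)
    show "vec.independent ((b \<circ> f) ` mode_indices \<nu>\<^sub>0 \<nu>)" "vec.span ((b \<circ> f) ` mode_indices \<nu>\<^sub>0 \<nu>) = UNIV"
      unfolding image_comp[symmetric] fI using basis by blast+
    show "\<forall>a\<in>mode_indices \<nu>\<^sub>0 \<nu>. cmat (A + B ** F) *v (b \<circ> f) a = (\<mu> \<circ> f) a *s (b \<circ> f) a"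
      by (simp add: eig)
    show "\<forall>a\<in>mode_indices \<nu>\<^sub>0 \<nu>. if (\<mu> \<circ> f) a \<in> \<real> then conj_vec ((b \<circ> f) a) = (b \<circ> f) a
       else \<exists>a'\<in>mode_indices \<nu>\<^sub>0 \<nu>. fst a' = fst a \<and> (\<mu> \<circ> f) a' = cnj ((\<mu> \<circ> f) a) \<and>
         (b \<circ> f) a' = conj_vec ((b \<circ> f) a)"
    proof
      fix a assume a: "a \<in> mode_indices \<nu>\<^sub>0 \<nu>"
      show "if (\<mu> \<circ> f) a \<in> \<real> then conj_vec ((b \<circ> f) a) = (b \<circ> f) a
       else \<exists>a'\<in>mode_indices \<nu>\<^sub>0 \<nu>. fst a' = fst a \<and> (\<mu> \<circ> f) a' = cnj ((\<mu> \<circ> f) a) \<and>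
         (b \<circ> f) a' = conj_vec ((b \<circ> f) a)"
      proof (cases "\<mu> (f a) \<in> \<real>")
        case False
        then obtain k' where "fst (e k') = fst (e (f a))" "\<mu> k' = cnj (\<mu> (f a))" "b k' = conj_vec (b (f a))"
          using nonreal by blast
        then show ?thesis using False eI[of k'] fe[of k'] ef[OF a] by (auto intro!: bexI[of _ "e k'"])
      qed (use real in simp)
    qed
    show "\<forall>j<\<nu>\<^sub>0. cmat (C + D ** F) *v (b \<circ> f) (None, j) = 0"
    proof (intro allI impI)
      fix j assume "j < \<nu>\<^sub>0"
      then have "(None, j) \<in> mode_indices \<nu>\<^sub>0 \<nu>" by (simp add: mode_indices_def)
      then show "cmat (C + D ** F) *v (b \<circ> f) (None, j) = 0" using y_None ef by (simp add: out)
    qed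
    show "\<forall>i. \<forall>j<\<nu> i. \<exists>\<alpha>. \<alpha> \<noteq> 0 \<and> cmat (C + D ** F) *v (b \<circ> f) (Some i, j) = \<alpha> *s axis i 1"
    proof (intro allI impI)
      fix i j assume "j < \<nu> i"
      then have "(Some i, j) \<in> mode_indices \<nu>\<^sub>0 \<nu>" by (simp add: mode_indices_def)
      then show "\<exists>\<alpha>. \<alpha> \<noteq> 0 \<and> cmat (C + D ** F) *v (b \<circ> f) (Some i, j) = \<alpha> *s axis i 1"
        using y_Some[of "f (Some i, j)" i] ef by (simp add: out)
    qed
  qed
  have bij: "bij_betw (\<lambda>j. (\<mu> \<circ> f) (Some i, j)) {..<\<nu> i} (observable_eigenvalues A B C D F i)" for i
  proof -
    have mem: "(Some i, j) \<in> mode_indices \<nu>\<^sub>0 \<nu> \<longleftrightarrow> j < \<nu> i" for j by (simp add: mode_indices_def)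
    have "inj_on (\<lambda>j. (\<mu> \<circ> f) (Some i, j)) {..<\<nu> i}"
    proof (rule inj_onI)
      fix j j' assume j: "j \<in> {..<\<nu> i}" "j' \<in> {..<\<nu> i}" "(\<mu> \<circ> f) (Some i, j) = (\<mu> \<circ> f) (Some i, j')"
      then have *: "e (f (Some i, j)) = (Some i, j)" "e (f (Some i, j')) = (Some i, j')"
        using ef mem by auto
      then have "f (Some i, j) = f (Some i, j')"
        using inj_onD[OF inj[of i]] j(3) by simp
      then show "j = j'" using * by (metis prod.inject)
    qed
    moreover have "(\<lambda>j. (\<mu> \<circ> f) (Some i, j)) ` {..<\<nu> i} = \<mu> ` {k. fst (e k) = Some i}"
    proof (intro equalityI subsetI)
      fix s assume "s \<in> (\<lambda>j. (\<mu> \<circ> f) (Some i, j)) ` {..<\<nu> i}"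
      then show "s \<in> \<mu> ` {k. fst (e k) = Some i}" using ef mem by auto
    next
      fix s assume "s \<in> \<mu> ` {k. fst (e k) = Some i}"
      then obtain k where k: "s = \<mu> k" "fst (e k) = Some i" by blast
      then have ek: "e k = (Some i, snd (e k))" by (metis prod.collapse)
      then have "snd (e k) < \<nu> i" using eI[of k] mem by metis
      moreover have "s = (\<mu> \<circ> f) (Some i, snd (e k))" using fe[of k] ek k by simp
      ultimately show "s \<in> (\<lambda>j. (\<mu> \<circ> f) (Some i, j)) ` {..<\<nu> i}" by blast
    qed
    ultimately show ?thesis unfolding bij_betw_def obs by blast
  qed
  have disj: "observable_eigenvalues A B C D F i \<inter> invariant_zeros A B C D = {}" for i
    unfolding obs using nz by auto
  have real_or_zero: "eigenvalues (A + B ** F) - invariant_zeros A B C D \<subseteq> \<real>"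
    using eigs free by auto
  have eigenbasis: "\<exists>\<mu> v. decoupling_eigenbasis A B C D F \<nu>\<^sub>0 \<nu> \<mu> v \<and>
      (\<forall>i. bij_betw (\<lambda>j. \<mu> (Some i, j)) {..<\<nu> i} (observable_eigenvalues A B C D F i))"
    by (rule exI[of _ "\<mu> \<circ> f"], rule exI[of _ "b \<circ> f"], rule conjI[OF dec], rule allI, rule bij)
  show ?thesis
    unfolding problem_1C_solvable_def
    by (rule exI[of _ F], rule exI[of _ G]) (use stab G tracks eigenbasis disj real_or_zero in simp)
qed

end

section \<open>Counting modes\<close>

lemma sum_sets_subset_subspace:
  fixes E :: "'i \<Rightarrow> ('a::field^'n) set"
  assumes "vec.subspace V" "\<And>i. i \<in> Q \<Longrightarrow> E i \<subseteq> V"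
  shows "sum E Q \<subseteq> V"
  using assms(2)
proof (induction Q rule: infinite_finite_induct)
  case (insert i Q)
  then have "E i \<subseteq> V" "sum E Q \<subseteq> V" by auto
  then show ?case using assms(1) insert.hyps by (auto simp: set_plus_def intro: vec.subspace_add)
\<comment> \<open>The sum of sets over an empty or infinite index set is \<open>{0}\<close>.\<close>
qed (use vec.subspace_0[OF assms(1)] in \<open>auto simp: set_zero\<close>)

lemma zero_in_sum_sets:
  fixes E :: "'i \<Rightarrow> ('a::field^'n) set"
  assumes "\<And>i. i \<in> Q \<Longrightarrow> 0 \<in> E i"
  shows "0 \<in> sum E Q"
  using assms
proof (induction Q rule: infinite_finite_induct)
  case (insert i Q)
  then have "0 + 0 \<in> E i + sum E Q" by (intro set_plus_intro) auto
  then show ?case using insert.hyps by simp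
qed (simp_all add: set_zero)

lemma subset_sum_sets:
  fixes E :: "'i \<Rightarrow> ('a::field^'n) set"
  assumes "finite Q" "i \<in> Q" "\<And>i. i \<in> Q \<Longrightarrow> 0 \<in> E i"
  shows "E i \<subseteq> sum E Q"
proof
  fix x assume "x \<in> E i"
  then have "x + 0 \<in> E i + sum E (Q - {i})"
    using assms(3) by (intro set_plus_intro zero_in_sum_sets) auto
  then show "x \<in> sum E Q" using sum.remove[OF assms(1,2), of E] by simp
qed

lemma odd_Suc_le_double: "odd i \<Longrightarrow> i \<le> 2 * c \<Longrightarrow> Suc i \<le> 2 * c"
  by presburger

lemma sum_pairs_odd:
  fixes f :: "nat \<Rightarrow> 'a::comm_monoid_add"
  shows "(\<Sum>i\<in>{1..2 * c}. f i) = (\<Sum>i\<in>{i \<in> {1..2 * c}. odd i}. f i + f (i + 1))"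
proof -
  let ?J = "{i \<in> {1..2 * c}. odd i}"
  have un: "{1..2 * c} = ?J \<union> (\<lambda>i. i + 1) ` ?J"
  proof (intro equalityI subsetI)
    fix i assume i: "i \<in> {1..2 * c}"
    show "i \<in> ?J \<union> (\<lambda>i. i + 1) ` ?J"
    proof (cases "odd i")
      case False
      then have "i = (i - 1) + 1" "i - 1 \<in> ?J" using i by (auto elim!: evenE)
      then show ?thesis by blast
    qed (use i in simp)
  qed (auto intro: odd_Suc_le_double)
  have "(\<Sum>i\<in>{1..2 * c}. f i) = (\<Sum>i\<in>?J. f i) + (\<Sum>i\<in>(\<lambda>i. i + 1) ` ?J. f i)"
    by (subst un, rule sum.union_disjoint) auto
  also have "(\<Sum>i\<in>(\<lambda>i. i + 1) ` ?J. f i) = (\<Sum>i\<in>?J. f (i + 1))"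
    by (subst sum.reindex) (auto simp: comp_def)
  finally show ?thesis by (simp add: sum.distrib)
qed

lemma mode_indices_eq:
  "mode_indices \<nu>\<^sub>0 \<nu> = Pair None ` {..<\<nu>\<^sub>0} \<union> (\<Union>i. Pair (Some i) ` {..<\<nu> i})"
proof (rule set_eqI)
  fix a :: "'a option \<times> nat"
  obtain k j where a: "a = (k, j)" by (cases a)
  show "a \<in> mode_indices \<nu>\<^sub>0 \<nu> \<longleftrightarrow> a \<in> Pair None ` {..<\<nu>\<^sub>0} \<union> (\<Union>i. Pair (Some i) ` {..<\<nu> i})"
    unfolding a by (cases k) (auto simp: mode_indices_def)
qed

lemma finite_mode_indices: "finite (mode_indices \<nu>\<^sub>0 (\<nu> :: 'p::finite \<Rightarrow> nat))"
  by (simp add: mode_indices_eq)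

lemma card_mode_indices:
  "card (mode_indices \<nu>\<^sub>0 (\<nu> :: 'p::finite \<Rightarrow> nat)) = \<nu>\<^sub>0 + (\<Sum>i\<in>UNIV. \<nu> i)"
proof -
  have "card (\<Union>i. Pair (Some i) ` {..<\<nu> i}) = (\<Sum>i\<in>UNIV. card (Pair (Some i) ` {..<\<nu> i}))"
    by (rule card_UN_disjoint) auto
  then show ?thesis
    unfolding mode_indices_eq by (subst card_Un_disjoint) (auto simp: card_image inj_on_def)
qed

text \<open>Pairing of naturals splits a sequence into infinitely many subsequences. Used to reserve
  eigenvalues for each position, so that those at one output differ whatever vectors are
  picked.\<close>

lemma disjoint_infinite_subsets:
  assumes "infinite (X :: 'a set)"
  obtains \<Lambda> :: "nat \<Rightarrow> 'a set" where "\<And>j. infinite (\<Lambda> j)" "\<And>j. \<Lambda> j \<subseteq> X"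
    "\<And>j j'. j \<noteq> j' \<Longrightarrow> \<Lambda> j \<inter> \<Lambda> j' = {}"
proof -
  obtain g :: "nat \<Rightarrow> 'a" where g: "inj g" "range g \<subseteq> X"
    using infinite_countable_subset[OF assms] by blast
  show thesis
  proof (rule that)
    show "infinite (range (\<lambda>k. g (prod_encode (j, k))))" for j
      using g(1) by (intro range_inj_infinite injI) (auto dest: injD)
    show "range (\<lambda>k. g (prod_encode (j, k))) \<inter> range (\<lambda>k. g (prod_encode (j', k))) = {}" if "j \<noteq> j'" for j j'
      using g(1) that by (auto dest: injD)
  qed (use g in auto)
qed

text \<open>The sum of sets in the theorem. Necessity uses that it contains its summands,
  sufficiency that it lies in every subspace containing them.\<close>

definition mode_sum ::
  "time_domain \<Rightarrow> real^'n^'n \<Rightarrow> real^'m^'n \<Rightarrow> real^'n^'p \<Rightarrow> real^'m^'p \<Rightarrow> (nat \<Rightarrow> complex)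
    \<Rightarrow> nat set \<Rightarrow> nat set \<Rightarrow> nat set \<Rightarrow> 'p set \<Rightarrow> (complex^'n) set" where
  "mode_sum T A B C D z Q0 Q Q' P =
    (\<Sum>i\<in>Q0. E_space T A B C D z i) + (\<Sum>i\<in>Q. E_space T A B C D z i) +
    (\<Sum>i\<in>Q'. conj_vec ` E_space T A B C D z i) + (\<Sum>i\<in>P. R_star_complex A B C D i)"

lemma mode_sum_subset:
  assumes V: "vec.subspace V" and "\<And>i. i \<in> Q0 \<union> Q \<Longrightarrow> E_space T A B C D z i \<subseteq> V"
    "\<And>i. i \<in> Q' \<Longrightarrow> conj_vec ` E_space T A B C D z i \<subseteq> V" "\<And>i. i \<in> P \<Longrightarrow> R_star_complex A B C D i \<subseteq> V"
  shows "mode_sum T A B C D z Q0 Q Q' P \<subseteq> V"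
proof -
  have plus: "a + b \<subseteq> V" if "a \<subseteq> V" "b \<subseteq> V" for a b
    using that V by (auto simp: set_plus_def intro!: vec.subspace_add)
  have "(\<Sum>i\<in>Q0. E_space T A B C D z i) \<subseteq> V" "(\<Sum>i\<in>Q. E_space T A B C D z i) \<subseteq> V"
    "(\<Sum>i\<in>Q'. conj_vec ` E_space T A B C D z i) \<subseteq> V" "(\<Sum>i\<in>P. R_star_complex A B C D i) \<subseteq> V"
    by (intro sum_sets_subset_subspace[OF V] assms; simp)+
  then show ?thesis
    unfolding mode_sum_def by (intro plus)
qed

lemma mode_sum_superset:
  fixes A :: "real^'n^'n" and B :: "real^'m^'n" and C :: "real^'n^'p" and D :: "real^'m^'p"
  assumes fin: "finite Q0" "finite Q" "finite Q'"
  shows "i \<in> Q0 \<union> Q \<Longrightarrow> E_space T A B C D z i \<subseteq> mode_sum T A B C D z Q0 Q Q' P"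
    and "i \<in> Q' \<Longrightarrow> conj_vec ` E_space T A B C D z i \<subseteq> mode_sum T A B C D z Q0 Q Q' P"
    and "k \<in> P \<Longrightarrow> R_star_complex A B C D k \<subseteq> mode_sum T A B C D z Q0 Q Q' P"
proof -
  have 0: "0 \<in> E_space T A B C D z i" "0 \<in> conj_vec ` E_space T A B C D z i" "0 \<in> R_star_complex A B C D k" for i k
    by (auto simp: E_space_def R_star_complex_def vec.span_zero intro!: image_eqI[of _ _ 0])
  let ?a = "\<Sum>i\<in>Q0. E_space T A B C D z i" and ?b = "\<Sum>i\<in>Q. E_space T A B C D z i"
    and ?c = "\<Sum>i\<in>Q'. conj_vec ` E_space T A B C D z i" and ?d = "\<Sum>i\<in>P. R_star_complex A B C D i"
  have z: "0 \<in> ?a" "0 \<in> ?b" "0 \<in> ?c" "0 \<in> ?d"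
    by (intro zero_in_sum_sets 0)+
  have plus: "a \<subseteq> a + b" "b \<subseteq> a + b" if "0 \<in> a" "0 \<in> b" for a b :: "(complex^'n) set"
    using set_zero_plus2[OF that(1), of b] set_zero_plus2[OF that(2), of a] by (auto simp: add.commute)
  note p1 = plus[OF z(1,2)]
  have z1: "0 \<in> ?a + ?b" using p1(1) z(1) by (rule subsetD)
  note p2 = plus[OF z1 z(3)]
  have z2: "0 \<in> ?a + ?b + ?c" using p2(1) z1 by (rule subsetD)
  note p3 = plus[OF z2 z(4)]
  have sub: "?a \<subseteq> mode_sum T A B C D z Q0 Q Q' P" "?b \<subseteq> mode_sum T A B C D z Q0 Q Q' P"
    "?c \<subseteq> mode_sum T A B C D z Q0 Q Q' P" "?d \<subseteq> mode_sum T A B C D z Q0 Q Q' P"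
    unfolding mode_sum_def
    by (rule order_trans[OF order_trans[OF p1(1) p2(1)] p3(1)]
        order_trans[OF order_trans[OF p1(2) p2(1)] p3(1)] order_trans[OF p2(2) p3(1)] p3(2))+
  let ?E = "E_space T A B C D z"
  show "?E i \<subseteq> mode_sum T A B C D z Q0 Q Q' P" if "i \<in> Q0 \<union> Q"
  proof (cases "i \<in> Q0")
    case True
    show ?thesis by (rule order_trans[OF subset_sum_sets[where E = ?E, OF fin(1) True 0(1)] sub(1)])
  next
    case False
    then have i: "i \<in> Q" using that by blast
    show ?thesis by (rule order_trans[OF subset_sum_sets[where E = ?E, OF fin(2) i 0(1)] sub(2)])
  qed
  show "conj_vec ` ?E i \<subseteq> mode_sum T A B C D z Q0 Q Q' P" if "i \<in> Q'"
    by (rule order_trans[OF subset_sum_sets[where E = "\<lambda>i. conj_vec ` ?E i", OF fin(3) that 0(2)] sub(3)])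
  show "R_star_complex A B C D k \<subseteq> mode_sum T A B C D z Q0 Q Q' P" if "k \<in> P"
    by (rule order_trans[OF subset_sum_sets[where E = "R_star_complex A B C D", OF finite that 0(3)] sub(4)])
qed

section \<open>The two directions of the equivalence\<close>

context
  fixes A :: "real^'n^'n" and B :: "real^'m^'n" and C :: "real^'n^'p" and D :: "real^'m^'p" and T
    and \<nu> :: "'p \<Rightarrow> nat" and \<nu>\<^sub>0 :: nat and c :: nat and z :: "nat \<Rightarrow> complex" and J :: "nat set"
  assumes ri: "right_invertible A B C D"
    and dc: "complex_of_real (dc_point T) \<notin> invariant_zeros A B C D"
    and z: "bij_betw z {1..2 * c} (nonreal_stable_zeros T A B C D)"
    and z_conj: "\<And>i. i \<in> {1..2 * c} \<Longrightarrow> odd i \<Longrightarrow> z (i + 1) = cnj (z i)"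
    and total: "\<nu>\<^sub>0 + (\<Sum>i\<in>UNIV. \<nu> i) = CARD('n)"
    and J: "J = {i \<in> {1..2 * c}. odd i}"
begin

lemma finite_J: "finite J" by (simp add: J)

lemma J_facts:
  assumes "i \<in> J"
  shows "i \<noteq> 0" "z i \<in> nonreal_stable_zeros T A B C D" "cnj (z i) \<in> nonreal_stable_zeros T A B C D"
    "cnj (z i) = z (i + 1)" "z i \<notin> \<real>"
proof -
  have i: "i \<in> {1..2 * c}" "i + 1 \<in> {1..2 * c}" "odd i" using assms odd_Suc_le_double[of i c] by (auto simp: J)
  then show "i \<noteq> 0" "z i \<in> nonreal_stable_zeros T A B C D" using z by (auto simp: bij_betw_def)
  then show "z i \<notin> \<real>" by (auto simp: nonreal_stable_zeros_def)
  show c: "cnj (z i) = z (i + 1)" using z_conj i by simp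
  show "cnj (z i) \<in> nonreal_stable_zeros T A B C D"
    unfolding c using z i by (auto simp: bij_betw_def)
qed

text \<open>The conjugate of \<open>z j\<close> has the even index \<open>j + 1\<close>, so the odd
  indices represent each conjugate pair once.\<close>

lemma z_J_inj:
  assumes "i \<in> J" "j \<in> J"
  shows "z i = z j \<longleftrightarrow> i = j" "z i \<noteq> cnj (z j)"
proof -
  have inj: "inj_on z {1..2 * c}" using z by (simp add: bij_betw_def)
  have ij: "i \<in> {1..2 * c}" "j \<in> {1..2 * c}" "j + 1 \<in> {1..2 * c}" "odd i" "odd j"
    using assms odd_Suc_le_double[of j c] by (auto simp: J)
  show "z i = z j \<longleftrightarrow> i = j" using inj_on_eq_iff[OF inj] ij by blast
  have "i \<noteq> j + 1" using ij by presburger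
  then show "z i \<noteq> cnj (z j)"
    using inj_on_eq_iff[OF inj, of i "j + 1"] ij J_facts(4)[OF assms(2)] by simp
qed

text \<open>The multiplicities are read off the closed loop: \<open>\<eta> 0\<close> counts the
  unobservable modes outside the nonreal stable zeros and \<open>\<eta> i\<close> those at
  \<open>z i\<close>. They do not depend on the index sets, so one choice serves all
  inequalities.\<close>

lemma eigenbasis_dimension_bound:
  assumes stab: "eigenvalues (A + B ** F) \<subseteq> stable_region T"
    and dec: "decoupling_eigenbasis A B C D F \<nu>\<^sub>0 \<nu> \<mu> v"
    and obs: "\<And>i. observable_eigenvalues A B C D F i \<inter> invariant_zeros A B C D = {}"
    and free: "eigenvalues (A + B ** F) - invariant_zeros A B C D \<subseteq> \<real>"
    and Q: "Q0 \<subseteq> {0}" "Q \<subseteq> J" "Q' \<subseteq> J"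
  defines "\<eta> \<equiv> \<lambda>i. if i = 0 then card {j. j < \<nu>\<^sub>0 \<and> \<mu> (None, j) \<notin> nonreal_stable_zeros T A B C D}
      else card {j. j < \<nu>\<^sub>0 \<and> \<mu> (None, j) = z i}"
  shows "\<eta> 0 + (\<Sum>i\<in>J. 2 * \<eta> i) = \<nu>\<^sub>0"
    and "(\<Sum>i\<in>Q0. \<eta> i) + (\<Sum>i\<in>Q. \<eta> i) + (\<Sum>i\<in>Q'. \<eta> i) + (\<Sum>i\<in>P. \<nu> i)
      \<le> vec.dim (mode_sum T A B C D z Q0 Q Q' P)"
proof -
  let ?N = "nonreal_stable_zeros T A B C D"
  let ?I = "mode_indices \<nu>\<^sub>0 \<nu>"
  have inj: "inj_on v ?I" and indep: "vec.independent (v ` ?I)"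
    and eig: "\<And>a. a \<in> ?I \<Longrightarrow> cmat (A + B ** F) *v v a = \<mu> a *s v a"
    and conj: "\<And>a. a \<in> ?I \<Longrightarrow> if \<mu> a \<in> \<real> then conj_vec (v a) = v a
              else \<exists>b\<in>?I. fst b = fst a \<and> \<mu> b = cnj (\<mu> a) \<and> v b = conj_vec (v a)"
    and unobs: "\<And>j. j < \<nu>\<^sub>0 \<Longrightarrow> cmat (C + D ** F) *v v (None, j) = 0"
    and out: "\<And>i j. j < \<nu> i \<Longrightarrow> \<exists>\<alpha>. \<alpha> \<noteq> 0 \<and> cmat (C + D ** F) *v v (Some i, j) = \<alpha> *s axis i 1"
    using dec unfolding decoupling_eigenbasis_def Let_def by blast+
  have I_None: "(None, j) \<in> ?I \<longleftrightarrow> j < \<nu>\<^sub>0" and I_Some: "(Some i, j) \<in> ?I \<longleftrightarrow> j < \<nu> i" for i j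
    by (simp_all add: mode_indices_def)
  have v0: "v a \<noteq> 0" if "a \<in> ?I" for a
    using indep vec.dependent_zero that by (metis imageI)
  have mu_eig: "\<mu> a \<in> eigenvalues (A + B ** F)" if "a \<in> ?I" for a
    unfolding eigenvalues_def using v0 eig that by blast
  have modes: "mode (cmat A) (cmat B) (cmat C) (cmat D) (\<mu> a) (cmat (C + D ** F) *v v a) (v a) (cmat F *v v a)"
    if "a \<in> ?I" for a
    using eig[OF that] by (simp add: mode_def cmat_add cmat_mult matrix_vector_mult_add_rdistrib
        flip: matrix_vector_mul_assoc)
  have null: "v (None, j) \<in> null_directions A B C D (\<mu> (None, j))" if "j < \<nu>\<^sub>0" for j
    unfolding null_directions_iff using modes[of "(None, j)"] unobs[OF that] that I_None by auto
  have vR: "v (Some i, j) \<in> R_star_complex A B C D i" if j: "j < \<nu> i" for i j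
  proof -
    let ?a = "(Some i, j)"
    have a: "?a \<in> ?I" using j I_Some by blast
    obtain \<alpha> where \<alpha>: "\<alpha> \<noteq> 0" "cmat (C + D ** F) *v v ?a = \<alpha> *s axis i 1" using out[OF j] by blast
    have "\<mu> ?a \<in> observable_eigenvalues A B C D F i"
      unfolding observable_eigenvalues_def using eig[OF a] \<alpha> by (auto simp: axis_def)
    then have nz: "\<mu> ?a \<notin> invariant_zeros A B C D" using obs by blast
    \<comment> \<open>An observable eigenvalue is no zero, hence freely selected and real. Its
      eigenvector is then real as well, which brings it into the range of the real result
      \<open>mode_in_R_star\<close>.\<close>
    then have "\<mu> ?a \<in> \<real>" using free mu_eig[OF a] by blast
    then obtain s where s: "\<mu> ?a = complex_of_real s" by (auto elim: Reals_cases)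
    have "conj_vec (v ?a) = v ?a" using conj[OF a] \<open>\<mu> ?a \<in> \<real>\<close> by simp
    then have vr: "v ?a = cvec (re_vec (v ?a))" by (rule conj_vec_fixed)
    have "re_vec (\<alpha> *s axis i 1) = Re \<alpha> *s (axis i 1 :: real^'p)"
      by (simp add: re_vec_def axis_def vec_eq_iff)
    then have "mode A B C D s (Re \<alpha> *s axis i 1) (re_vec (v ?a)) (re_vec (cmat F *v v ?a))"
      using mode_re_im(1)[OF modes[OF a, unfolded s \<alpha>(2)]] by simp
    then have "re_vec (v ?a) \<in> R_star A B C D i"
      using mode_in_R_star[OF ri] nz s by simp
    then show ?thesis
      unfolding R_star_complex_def using vr by (metis imageI vec.span_base)
  qed
  define cnt where "cnt s = card {j. j < \<nu>\<^sub>0 \<and> \<mu> (None, j) = s}" for s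
  \<comment> \<open>Conjugation injects the modes at \<open>s\<close> into those at
    \<open>cnj s\<close>; applied to both points of a pair it shows the counts equal.\<close>
  have cnt_le: "cnt s \<le> cnt (cnj s)" if s: "s \<notin> \<real>" for s
  proof -
    have "\<forall>j\<in>{j. j < \<nu>\<^sub>0 \<and> \<mu> (None, j) = s}. \<exists>j'. j' < \<nu>\<^sub>0 \<and> \<mu> (None, j') = cnj s \<and> v (None, j') = conj_vec (v (None, j))"
    proof
      fix j assume j: "j \<in> {j. j < \<nu>\<^sub>0 \<and> \<mu> (None, j) = s}"
      then obtain b where b: "b \<in> ?I" "fst b = None" "\<mu> b = cnj s" "v b = conj_vec (v (None, j))"
        using conj[of "(None, j)"] s I_None by auto
      then show "\<exists>j'. j' < \<nu>\<^sub>0 \<and> \<mu> (None, j') = cnj s \<and> v (None, j') = conj_vec (v (None, j))"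
        using I_None by (metis prod.collapse)
    qed
    from bchoice[OF this] obtain h where h: "\<And>j. j < \<nu>\<^sub>0 \<Longrightarrow> \<mu> (None, j) = s \<Longrightarrow>
      h j < \<nu>\<^sub>0 \<and> \<mu> (None, h j) = cnj s \<and> v (None, h j) = conj_vec (v (None, j))" by blast
    show ?thesis
      unfolding cnt_def
    proof (rule card_inj_on_le[where f = h])
      show "inj_on h {j. j < \<nu>\<^sub>0 \<and> \<mu> (None, j) = s}"
      proof (rule inj_onI)
        fix j k assume jk: "j \<in> {j. j < \<nu>\<^sub>0 \<and> \<mu> (None, j) = s}" "k \<in> {j. j < \<nu>\<^sub>0 \<and> \<mu> (None, j) = s}" "h j = h k"
        then have "conj_vec (v (None, j)) = conj_vec (v (None, k))" using h by (metis (mono_tags) mem_Collect_eq)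
        then have "v (None, j) = v (None, k)" by (metis conj_vec_simps(1))
        then show "j = k" using inj_onD[OF inj] jk I_None by blast
      qed
    qed (use h in auto)
  qed
  have cnt_cnj: "cnt (cnj (z i)) = cnt (z i)" if "i \<in> J" for i
    using cnt_le[of "z i"] cnt_le[of "cnj (z i)"] J_facts(5)[OF that] Reals_cnj_iff[of "z i"]
    by (metis antisym complex_cnj_cnj Reals_cnj_iff complex_cnj_cancel_iff)
  have \<eta>0: "\<eta> 0 = card {j. j < \<nu>\<^sub>0 \<and> \<mu> (None, j) \<notin> ?N}" by (simp add: \<eta>_def)
  have \<eta>J: "\<eta> i = cnt (z i)" if "i \<in> J" for i using J_facts(1)[OF that] by (simp add: \<eta>_def cnt_def)
  have NZ: "?N = z ` {1..2 * c}" and zinj: "inj_on z {1..2 * c}" using z by (auto simp: bij_betw_def)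
  show "\<eta> 0 + (\<Sum>i\<in>J. 2 * \<eta> i) = \<nu>\<^sub>0"
  proof -
    have "card (\<Union>i\<in>{1..2 * c}. {j. j < \<nu>\<^sub>0 \<and> \<mu> (None, j) = z i}) = (\<Sum>i\<in>{1..2 * c}. cnt (z i))"
      unfolding cnt_def by (rule card_UN_disjoint) (auto simp: inj_on_eq_iff[OF zinj])
    also have "(\<Union>i\<in>{1..2 * c}. {j. j < \<nu>\<^sub>0 \<and> \<mu> (None, j) = z i}) = {j. j < \<nu>\<^sub>0 \<and> \<mu> (None, j) \<in> ?N}"
      unfolding NZ by auto
    also have "(\<Sum>i\<in>{1..2 * c}. cnt (z i)) = (\<Sum>i\<in>J. cnt (z i) + cnt (z (i + 1)))"
      unfolding J by (rule sum_pairs_odd)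
    also have "\<dots> = (\<Sum>i\<in>J. 2 * \<eta> i)"
      using J_facts(4) cnt_cnj \<eta>J by (intro sum.cong) (simp_all add: mult_2)
    finally have "card {j. j < \<nu>\<^sub>0 \<and> \<mu> (None, j) \<in> ?N} = (\<Sum>i\<in>J. 2 * \<eta> i)" .
    moreover have "card {j. j < \<nu>\<^sub>0 \<and> \<mu> (None, j) \<notin> ?N} + card {j. j < \<nu>\<^sub>0 \<and> \<mu> (None, j) \<in> ?N}
      = card ({j. j < \<nu>\<^sub>0 \<and> \<mu> (None, j) \<notin> ?N} \<union> {j. j < \<nu>\<^sub>0 \<and> \<mu> (None, j) \<in> ?N})"
      by (subst card_Un_disjoint) auto
    moreover have "{j. j < \<nu>\<^sub>0 \<and> \<mu> (None, j) \<notin> ?N} \<union> {j. j < \<nu>\<^sub>0 \<and> \<mu> (None, j) \<in> ?N} = {..<\<nu>\<^sub>0}" by auto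
    ultimately show ?thesis by (simp add: \<eta>0)
  qed
  let ?W = "mode_sum T A B C D z Q0 Q Q' P"
  have fin: "finite Q0" "finite Q" "finite Q'"
    using finite_subset[OF Q(1)] finite_subset[OF Q(2) finite_J] finite_subset[OF Q(3) finite_J] by simp_all
  \<comment> \<open>The unobservable modes split by eigenvalue: outside the nonreal zeros, at some
    \<open>z i\<close>, at some \<open>cnj (z i)\<close>. These classes are disjoint, so the
    cardinalities add up to the right side of the inequality.\<close>
  define K0 where "K0 = {j. j < \<nu>\<^sub>0 \<and> 0 \<in> Q0 \<and> \<mu> (None, j) \<notin> ?N}"
  define KQ where "KQ = (\<Union>i\<in>Q. {j. j < \<nu>\<^sub>0 \<and> \<mu> (None, j) = z i})"
  define KQ' where "KQ' = (\<Union>i\<in>Q'. {j. j < \<nu>\<^sub>0 \<and> \<mu> (None, j) = cnj (z i)})"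
  define KP where "KP = (\<Union>i\<in>P. Pair (Some i) ` {..<\<nu> i})"
  let ?K = "Pair None ` (K0 \<union> KQ \<union> KQ') \<union> KP"
  have cards: "card K0 = (\<Sum>i\<in>Q0. \<eta> i)" "card KQ = (\<Sum>i\<in>Q. \<eta> i)" "card KQ' = (\<Sum>i\<in>Q'. \<eta> i)"
    "card KP = (\<Sum>i\<in>P. \<nu> i)"
  proof -
    show "card K0 = (\<Sum>i\<in>Q0. \<eta> i)"
      using Q(1) by (cases "0 \<in> Q0") (auto simp: K0_def \<eta>0 subset_singleton_iff)
    have "card KQ = (\<Sum>i\<in>Q. cnt (z i))"
      unfolding KQ_def cnt_def using fin z_J_inj(1)[OF subsetD[OF Q(2)] subsetD[OF Q(2)]] by (intro card_UN_disjoint) force+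
    then show "card KQ = (\<Sum>i\<in>Q. \<eta> i)" using \<eta>J Q(2) by (auto intro!: sum.cong)
    have "card KQ' = (\<Sum>i\<in>Q'. cnt (cnj (z i)))"
      unfolding KQ'_def cnt_def using fin z_J_inj(1)[OF subsetD[OF Q(3)] subsetD[OF Q(3)]] by (intro card_UN_disjoint) force+
    then show "card KQ' = (\<Sum>i\<in>Q'. \<eta> i)" using \<eta>J cnt_cnj Q(3) by (auto intro!: sum.cong)
    have "card KP = (\<Sum>i\<in>P. card (Pair (Some i) ` {..<\<nu> i}))"
      unfolding KP_def by (rule card_UN_disjoint) auto
    then show "card KP = (\<Sum>i\<in>P. \<nu> i)" by (simp add: card_image inj_on_def)
  qed
  have finK: "finite K0" "finite KQ" "finite KQ'" "finite KP"
    using fin by (auto simp: K0_def KQ_def KQ'_def KP_def)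
  have "card ?K = card (Pair (None :: 'p option) ` (K0 \<union> KQ \<union> KQ')) + card KP"
    using finK by (intro card_Un_disjoint) (auto simp: KP_def)
  also have "card (Pair (None :: 'p option) ` (K0 \<union> KQ \<union> KQ')) = card (K0 \<union> KQ \<union> KQ')"
    by (simp add: card_image inj_on_def)
  also have "\<dots> = card (K0 \<union> KQ) + card KQ'"
    using finK Q J_facts(3) z_J_inj(2) by (intro card_Un_disjoint) (auto simp: K0_def KQ_def KQ'_def subset_iff)
  also have "card (K0 \<union> KQ) = card K0 + card KQ"
    using finK Q J_facts(2) by (intro card_Un_disjoint) (auto simp: K0_def KQ_def subset_iff)
  finally have cardK: "card ?K = (\<Sum>i\<in>Q0. \<eta> i) + (\<Sum>i\<in>Q. \<eta> i) + (\<Sum>i\<in>Q'. \<eta> i) + (\<Sum>i\<in>P. \<nu> i)"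
    by (simp add: cards)
  have KI: "?K \<subseteq> ?I"
    using I_None I_Some by (auto simp: K0_def KQ_def KQ'_def KP_def)
  have E: "null_directions A B C D (z i) \<subseteq> E_space T A B C D z i" if "i \<in> J" for i
    using J_facts(1)[OF that] vec.span_superset by (auto simp: E_space_def E_set_def)
  have "v ` ?K \<subseteq> ?W"
  proof (intro image_subsetI)
    fix a assume "a \<in> ?K"
    then consider j where "a = (None, j)" "j \<in> K0" | j where "a = (None, j)" "j \<in> KQ"
      | j where "a = (None, j)" "j \<in> KQ'" | "a \<in> KP" by blast
    then show "v a \<in> ?W"
    proof cases
      case 1
      then have "v a \<in> E_set T A B C D z 0"
        using null[of j] stab mu_eig[of a] I_None by (auto simp: K0_def E_set_def)
      then have "v a \<in> E_space T A B C D z 0" unfolding E_space_def by (rule vec.span_base)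
      moreover have "0 \<in> Q0 \<union> Q" using 1 by (simp add: K0_def)
      ultimately show ?thesis using mode_sum_superset(1)[OF fin] by blast
    next
      case 2
      then obtain i where i: "i \<in> Q" "j < \<nu>\<^sub>0" "\<mu> a = z i" by (auto simp: KQ_def)
      then have "v a \<in> E_space T A B C D z i" using null[of j] 2 E Q(2) by auto
      then show ?thesis using mode_sum_superset(1)[OF fin, of i] i(1) by blast
    next
      case 3
      then obtain i where i: "i \<in> Q'" "j < \<nu>\<^sub>0" "\<mu> a = cnj (z i)" by (auto simp: KQ'_def)
      then have "conj_vec (v a) \<in> null_directions A B C D (z i)"
        using null[of j] 3 null_directions_conj[of "v a" A B C D "cnj (z i)"] by simp
      then have "conj_vec (v a) \<in> E_space T A B C D z i" using E Q(3) i(1) by auto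
      then have "v a \<in> conj_vec ` E_space T A B C D z i" by (metis conj_vec_simps(1) imageI)
      then show ?thesis using mode_sum_superset(2)[OF fin, of i] i(1) by blast
    next
      case 4
      then obtain i j where i: "i \<in> P" "j < \<nu> i" "a = (Some i, j)" by (auto simp: KP_def)
      then show ?thesis using vR[OF i(2)] mode_sum_superset(3)[OF fin, of i P] by blast
    qed
  qed
  moreover have "vec.independent (v ` ?K)"
    using indep KI by (meson image_mono vec.independent_mono)
  ultimately have "card (v ` ?K) \<le> vec.dim ?W" by (rule vec.independent_card_le_dim)
  moreover have "card (v ` ?K) = card ?K"
    using inj KI by (intro card_image) (rule inj_on_subset)
  ultimately show "(\<Sum>i\<in>Q0. \<eta> i) + (\<Sum>i\<in>Q. \<eta> i) + (\<Sum>i\<in>Q'. \<eta> i) + (\<Sum>i\<in>P. \<nu> i) \<le> vec.dim ?W"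
    unfolding cardK by simp
qed

text \<open>The label \<open>(i, b, l)\<close> of an unobservable mode gives the index \<open>i\<close> of its invariant zero (0 for
  the real modes) and tells in \<open>b\<close> whether the eigenvalue is \<open>cnj (z i)\<close> rather than \<open>z i\<close>.\<close>

lemma solvable_of_dimension_bound:
  fixes \<eta> :: "nat \<Rightarrow> nat"
  assumes eta: "\<eta> 0 + (\<Sum>i\<in>J. 2 * \<eta> i) = \<nu>\<^sub>0"
    and dim: "\<And>Q0 Q Q' P. Q0 \<subseteq> {0} \<Longrightarrow> Q \<subseteq> J \<Longrightarrow> Q' \<subseteq> J \<Longrightarrow>
      (\<Sum>i\<in>Q0. \<eta> i) + (\<Sum>i\<in>Q. \<eta> i) + (\<Sum>i\<in>Q'. \<eta> i) + (\<Sum>i\<in>P. \<nu> i)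
      \<le> vec.dim (mode_sum T A B C D z Q0 Q Q' P)"
  shows "problem_1C_solvable T A B C D \<nu>\<^sub>0 \<nu>"
proof -
  let ?I = "mode_indices \<nu>\<^sub>0 \<nu>"
  note JF = J_facts
  have finJ: "finite J" by (simp add: J)
  have J0: "0 \<notin> J" by (simp add: J)
  \<comment> \<open>Index 0 carries a single flag and each odd index both flags, which accounts for
    the factor 2 in the sum.\<close>
  define Z where "Z = {0} \<times> {False} \<times> {..<\<eta> 0} \<union> (SIGMA i:J. UNIV \<times> {..<\<eta> i})"
  have finZ: "finite Z" using finJ by (simp add: Z_def)
  have "card Z = \<eta> 0 + (\<Sum>i\<in>J. 2 * \<eta> i)"
    unfolding Z_def using J0 finJ
    by (subst card_Un_disjoint) (auto simp: card_cartesian_product card_SigmaI)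
  then have "card {..<\<nu>\<^sub>0} = card Z" using eta by simp
  then obtain lab where lab: "bij_betw lab {..<\<nu>\<^sub>0} Z"
    using finite_same_card_bij[OF _ finZ] by blast
  have labZ: "lab j \<in> Z" if "j < \<nu>\<^sub>0" for j using lab that by (auto simp: bij_betw_def)
  have infL: "infinite {s. complex_of_real s \<in> stable_region T \<and> complex_of_real s \<notin> invariant_zeros A B C D}"
  proof -
    have "finite {s. complex_of_real s \<in> invariant_zeros A B C D}"
      using finite_vimageI[OF finite_invariant_zeros[OF ri], of complex_of_real] by (simp add: vimage_def inj_on_def)
    moreover have "{s. complex_of_real s \<in> stable_region T \<and> complex_of_real s \<notin> invariant_zeros A B C D}
      = {s. complex_of_real s \<in> stable_region T} - {s. complex_of_real s \<in> invariant_zeros A B C D}" by auto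
    ultimately show ?thesis using infinite_stable_reals by simp
  qed
  \<comment> \<open>Position \<open>j\<close> may use only eigenvalues in \<Lambda> j. The same sets
    serve all outputs, because distinctness is required only within one output.\<close>
  obtain \<Lambda> :: "nat \<Rightarrow> real set" where \<Lambda>: "\<And>j. infinite (\<Lambda> j)"
    "\<And>j. \<Lambda> j \<subseteq> {s. complex_of_real s \<in> stable_region T \<and> complex_of_real s \<notin> invariant_zeros A B C D}"
    "\<And>j j'. j \<noteq> j' \<Longrightarrow> \<Lambda> j \<inter> \<Lambda> j' = {}"
    by (rule disjoint_infinite_subsets[OF infL], rule that)
  define R where "R i = null_directions A B C D (z i)" for i
  define S0 where "S0 = cvec ` {v. \<exists>s w. complex_of_real s \<in> stable_region T \<and> mode A B C D s 0 v w}"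
  define SN where "SN l = (if fst l = 0 then S0 else if fst (snd l) then conj_vec ` R (fst l) else R (fst l))"
    for l :: "nat \<times> bool \<times> nat"
  define SS where "SS i j = cvec ` {v. \<exists>s\<in>\<Lambda> j. \<exists>a w. a \<noteq> 0 \<and> mode A B C D s (a *s axis i 1) v w}" for i j
  define S where "S a = (case fst a of None \<Rightarrow> SN (lab (snd a)) | Some i \<Rightarrow> SS i (snd a))" for a
  have E: "E_space T A B C D z i = R i" if "i \<in> J" for i
    using JF(1)[OF that] by (simp add: E_space_def E_set_def R_def subspace_null_directions vec.span_eq_iff[THEN iffD2])
  have "card K \<le> vec.dim (\<Union>a\<in>K. S a)" if K: "K \<subseteq> ?I" for K
  proof -
    \<comment> \<open>These are the classes of modes that occur in \<open>K\<close>. One member of a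
      class already spans the whole summand; for the outputs this holds at every position
      \<open>j\<close>, since \<open>SS i j\<close> spans at least the complexified
      \<open>R_star\<close> for each infinite \<Lambda> j. So the inequality for full classes covers
      every \<open>K\<close>.\<close>
    define Q0 where "Q0 = {i::nat. i = 0 \<and> (\<exists>j l. (None, j) \<in> K \<and> lab j = (0, False, l))}"
    define Q where "Q = {i \<in> J. \<exists>j l. (None, j) \<in> K \<and> lab j = (i, False, l)}"
    define Q' where "Q' = {i \<in> J. \<exists>j l. (None, j) \<in> K \<and> lab j = (i, True, l)}"
    define P where "P = {i. \<exists>j. (Some i, j) \<in> K}"
    let ?V = "vec.span (\<Union>a\<in>K. S a)"
    have SV: "S a \<subseteq> ?V" if "a \<in> K" for a
      using that vec.span_superset[of "\<Union>a\<in>K. S a"] by blast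
    have "mode_sum T A B C D z Q0 Q Q' P \<subseteq> ?V"
    proof (rule mode_sum_subset)
      fix i assume "i \<in> Q0 \<union> Q"
      then show "E_space T A B C D z i \<subseteq> ?V"
      proof
        assume "i \<in> Q0"
        then obtain j l where j: "i = 0" "(None, j) \<in> K" "lab j = (0, False, l)" by (auto simp: Q0_def)
        then have "S (None, j) = S0" by (simp add: S_def SN_def)
        then have "vec.span S0 \<subseteq> ?V" using SV[OF j(2)] by (intro vec.span_minimal) auto
        moreover have "E_space T A B C D z 0 \<subseteq> vec.span S0"
          unfolding E_space_def S0_def using E_set_0_subset_span_modes[OF ri] by (intro vec.span_minimal) auto
        ultimately show ?thesis using j(1) by blast
      next
        assume "i \<in> Q"
        then obtain j l where j: "i \<in> J" "(None, j) \<in> K" "lab j = (i, False, l)" by (auto simp: Q_def)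
        then have "S (None, j) = R i" using JF(1)[OF j(1)] by (simp add: S_def SN_def)
        then show ?thesis using SV[OF j(2)] E[OF j(1)] by simp
      qed
    next
      fix i assume "i \<in> Q'"
      then obtain j l where j: "i \<in> J" "(None, j) \<in> K" "lab j = (i, True, l)" by (auto simp: Q'_def)
      then have "S (None, j) = conj_vec ` R i" using JF(1)[OF j(1)] by (simp add: S_def SN_def)
      then show "conj_vec ` E_space T A B C D z i \<subseteq> ?V" using SV[OF j(2)] E[OF j(1)] by simp
    next
      fix i assume "i \<in> P"
      then obtain j where j: "(Some i, j) \<in> K" by (auto simp: P_def)
      then have "SS i j \<subseteq> ?V" using SV[OF j] by (simp add: S_def)
      moreover have "cvec ` R_star A B C D i \<subseteq> vec.span (SS i j)"
      proof (rule image_subsetI)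
        fix x assume "x \<in> R_star A B C D i"
        moreover have "complex_of_real s \<notin> invariant_zeros A B C D" if "s \<in> \<Lambda> j" for s
          using \<Lambda>(2) that by blast
        ultimately show "cvec x \<in> vec.span (SS i j)"
          unfolding SS_def using R_star_subset_span_modes[OF ri \<Lambda>(1)] by (intro cvec_span_subset) blast
      qed
      ultimately show "R_star_complex A B C D i \<subseteq> ?V"
        unfolding R_star_complex_def by (meson order_trans vec.span_minimal vec.subspace_span)
    qed simp
    then have "vec.dim (mode_sum T A B C D z Q0 Q Q' P) \<le> vec.dim (\<Union>a\<in>K. S a)"
      by (rule vec.dim_mono)
    moreover have "card K \<le> (\<Sum>i\<in>Q0. \<eta> i) + (\<Sum>i\<in>Q. \<eta> i) + (\<Sum>i\<in>Q'. \<eta> i) + (\<Sum>i\<in>P. \<nu> i)"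
    proof -
      let ?SZ = "SIGMA i:Q0. {False} \<times> {..<\<eta> i}" and ?SF = "SIGMA i:Q. {False} \<times> {..<\<eta> i}"
        and ?ST = "SIGMA i:Q'. {True} \<times> {..<\<eta> i}" and ?SP = "SIGMA i:P. {..<\<nu> i}"
      have fin: "finite Q0" "finite Q" "finite Q'"
        using finJ by (simp_all add: Q0_def Q_def Q'_def)
      \<comment> \<open>This injects \<open>K\<close> into the disjoint union of the classes it
        meets, whose sizes form the right side.\<close>
      define h where "h a = (case fst a of None \<Rightarrow> Inl (lab (snd a)) | Some i \<Rightarrow> Inr (i, snd a))"
        for a :: "'p option \<times> nat"
      have "card K \<le> card (Inl ` (?SZ \<union> ?SF \<union> ?ST) \<union> Inr ` ?SP)"
      proof (rule card_inj_on_le[where f = h])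
        show "inj_on h K"
        proof (rule inj_onI)
          fix a b assume ab: "a \<in> K" "b \<in> K" "h a = h b"
          obtain k j k' j' where e: "a = (k, j)" "b = (k', j')" by (cases a, cases b)
          show "a = b"
          proof (cases k)
            case None
            then have "k' = None" using ab e by (auto simp: h_def split: option.splits)
            then have "lab j = lab j'" "j < \<nu>\<^sub>0" "j' < \<nu>\<^sub>0"
              using ab e None K by (auto simp: h_def mode_indices_def)
            then show ?thesis
              using inj_onD[OF bij_betw_imp_inj_on[OF lab]] None \<open>k' = None\<close> e by auto
          next
            case (Some i)
            then show ?thesis using ab e by (auto simp: h_def split: option.splits)
          qed
        qed
        show "h ` K \<subseteq> Inl ` (?SZ \<union> ?SF \<union> ?ST) \<union> Inr ` ?SP"
        proof (rule image_subsetI)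
          fix a assume a: "a \<in> K"
          obtain k j where e: "a = (k, j)" by (cases a)
          show "h a \<in> Inl ` (?SZ \<union> ?SF \<union> ?ST) \<union> Inr ` ?SP"
          proof (cases k)
            case None
            then have "lab j \<in> Z" using a e K labZ by (auto simp: mode_indices_def)
            moreover obtain i b l where l: "lab j = (i, b, l)" by (cases "lab j")
            ultimately consider "i = 0" "b = False" "l < \<eta> 0" | "i \<in> J" "l < \<eta> i"
              by (auto simp: Z_def)
            then have "lab j \<in> ?SZ \<union> ?SF \<union> ?ST"
            proof cases
              case 1
              then have "i \<in> Q0"
                unfolding Q0_def using a e None l by (intro CollectI conjI exI[of _ j] exI[of _ l]) simp_all
              then show ?thesis using 1 l by simp
            next
              case 2
              show ?thesis
              proof (cases b)
                case True
                then have "i \<in> Q'"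
                  unfolding Q'_def using a e None l 2 by (intro CollectI conjI exI[of _ j] exI[of _ l]) simp_all
                then show ?thesis using 2 l True by simp
              next
                case False
                then have "i \<in> Q"
                  unfolding Q_def using a e None l 2 by (intro CollectI conjI exI[of _ j] exI[of _ l]) simp_all
                then show ?thesis using 2 l False by simp
              qed
            qed
            then show ?thesis using None e by (auto simp: h_def)
          next
            case (Some i)
            then have "i \<in> P" "j < \<nu> i" using a e K by (auto simp: P_def mode_indices_def)
            then show ?thesis using Some e by (auto simp: h_def)
          qed
        qed
        show "finite (Inl ` (?SZ \<union> ?SF \<union> ?ST) \<union> Inr ` ?SP)" using fin by simp
      qed
      also have "\<dots> \<le> card (Inl ` (?SZ \<union> ?SF \<union> ?ST) :: ((nat \<times> bool \<times> nat) + ('p \<times> nat)) set) +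
          card (Inr ` ?SP :: ((nat \<times> bool \<times> nat) + ('p \<times> nat)) set)"
        by (rule card_Un_le)
      also have "\<dots> = card (?SZ \<union> ?SF \<union> ?ST) + card ?SP"
        by (simp add: card_image)
      also have "\<dots> \<le> card ?SZ + card ?SF + card ?ST + card ?SP"
        using card_Un_le[of "?SZ \<union> ?SF" ?ST] card_Un_le[of ?SZ ?SF] by linarith
      finally show ?thesis using fin by (simp add: card_SigmaI)
    qed
    moreover have "Q0 \<subseteq> {0}" "Q \<subseteq> J" "Q' \<subseteq> J" by (auto simp: Q0_def Q_def Q'_def)
    then have "(\<Sum>i\<in>Q0. \<eta> i) + (\<Sum>i\<in>Q. \<eta> i) + (\<Sum>i\<in>Q'. \<eta> i) + (\<Sum>i\<in>P. \<nu> i)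
      \<le> vec.dim (mode_sum T A B C D z Q0 Q Q' P)" by (rule dim)
    ultimately show ?thesis by linarith
  qed
  then obtain u where uS: "\<And>a. a \<in> ?I \<Longrightarrow> u a \<in> S a" and udim: "vec.dim (u ` ?I) = card ?I"
    using rado[OF finite_mode_indices[of \<nu>\<^sub>0 \<nu>], of S] by blast
  have cardI: "card ?I = CARD('n)" using total by (simp add: card_mode_indices)
  then obtain e :: "'n \<Rightarrow> 'p option \<times> nat" where e: "bij_betw e UNIV ?I"
    using finite_same_card_bij[of "UNIV :: 'n set" ?I] finite_mode_indices[of \<nu>\<^sub>0 \<nu>] by auto
  have eI: "e k \<in> ?I" for k using e by (auto simp: bij_betw_def)
  have einj: "inj e" using e by (simp add: bij_betw_def)
  define f where "f = inv_into UNIV e"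
  have fe: "f (e k) = k" for k unfolding f_def using einj by simp
  have ef: "e (f a) = a" if "a \<in> ?I" for a
    unfolding f_def using e that by (simp add: bij_betw_def f_inv_into_f)
  have "vec.span (range (\<lambda>k. u (e k))) = UNIV"
  proof -
    have "range (\<lambda>k. u (e k)) = u ` ?I" using e by (auto simp: bij_betw_def image_image[symmetric])
    then show ?thesis using udim cardI vec.dim_eq_full[of "u ` ?I"]
      by (simp add: vec.dimension_def card_cart_basis)
  qed
  then have d0: "det (\<chi> k. u (e k)) \<noteq> 0" by (simp add: det_rows_nonzero_iff)
  define idx where "idx l = f (None, inv_into {..<\<nu>\<^sub>0} lab l)" for l
  have idx: "e (idx l) = (None, inv_into {..<\<nu>\<^sub>0} lab l)" "lab (snd (e (idx l))) = l" if "l \<in> Z" for l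
  proof -
    have "inv_into {..<\<nu>\<^sub>0} lab l < \<nu>\<^sub>0"
      using lab that inv_into_into[of l lab "{..<\<nu>\<^sub>0}"] by (auto simp: bij_betw_def)
    then have *: "(None, inv_into {..<\<nu>\<^sub>0} lab l) \<in> ?I" by (simp add: mode_indices_def)
    then show "e (idx l) = (None, inv_into {..<\<nu>\<^sub>0} lab l)" using ef by (simp add: idx_def)
    then show "lab (snd (e (idx l))) = l" using lab that by (simp add: bij_betw_def f_inv_into_f)
  qed
  have idx_lab: "k = idx (lab (snd (e k)))" if "fst (e k) = None" for k
  proof -
    have ek: "e k = (None, snd (e k))" using that by (metis prod.collapse)
    then have "snd (e k) < \<nu>\<^sub>0" using eI[of k] unfolding mode_indices_def by auto
    then have "inv_into {..<\<nu>\<^sub>0} lab (lab (snd (e k))) = snd (e k)"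
      using lab by (simp add: bij_betw_def)
    then show ?thesis unfolding idx_def using ek fe[of k] by simp
  qed
  \<comment> \<open>One element per pair of conjugate modes; \<open>p\<close> and \<open>q\<close>
    locate the member at \<open>z i\<close> and the member at its conjugate.\<close>
  define Rr where "Rr = (SIGMA i:J. {..<\<eta> i})"
  define p where "p r = idx (fst r, False, snd r)" for r
  define q where "q r = idx (fst r, True, snd r)" for r
  have lp: "fst (e (p r)) = None" "lab (snd (e (p r))) = (fst r, False, snd r)"
    and lq: "fst (e (q r)) = None" "lab (snd (e (q r))) = (fst r, True, snd r)" if "r \<in> Rr" for r
  proof -
    have "(fst r, False, snd r) \<in> Z" "(fst r, True, snd r) \<in> Z" using that by (auto simp: Rr_def Z_def)
    then show "fst (e (p r)) = None" "lab (snd (e (p r))) = (fst r, False, snd r)"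
      "fst (e (q r)) = None" "lab (snd (e (q r))) = (fst r, True, snd r)"
      using idx by (simp_all add: p_def q_def)
  qed
  have rJ: "fst r \<in> J" if "r \<in> Rr" for r using that by (auto simp: Rr_def)
  have injp: "inj_on p Rr" by (rule inj_onI) (metis lp(2) prod.inject prod.collapse)
  have injq: "inj_on q Rr" by (rule inj_onI) (metis lq(2) prod.inject prod.collapse)
  have pq: "p r \<noteq> q r'" if "r \<in> Rr" "r' \<in> Rr" for r r' using lp(2) lq(2) that by (metis prod.inject)
  have uS': "u (e k) \<in> S (e k)" for k using uS eI by blast
  have "\<exists>b. det (\<chi> k. b k) \<noteq> 0 \<and> (\<forall>k. k \<notin> p ` Rr \<union> q ` Rr \<longrightarrow> b k = u (e k)) \<and>
    (\<forall>r\<in>Rr. b (p r) \<in> R (fst r) \<and> b (q r) = conj_vec (b (p r)))"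
  proof (rule conjugate_pairs_exchange[OF _ injp injq _ _ d0])
    show "finite Rr" using finJ by (simp add: Rr_def)
    show "p ` Rr \<inter> q ` Rr = {}" using pq by auto
    fix r assume r: "r \<in> Rr"
    have "u (e (p r)) \<in> R (fst r)"
      using uS'[of "p r"] lp[OF r] JF(1)[OF rJ[OF r]] by (simp add: S_def SN_def)
    moreover have "u (e (q r)) \<in> conj_vec ` R (fst r)"
      using uS'[of "q r"] lq[OF r] JF(1)[OF rJ[OF r]] by (simp add: S_def SN_def)
    ultimately show "vec.subspace (R (fst r)) \<and> u (e (p r)) \<in> R (fst r) \<and> conj_vec (u (e (q r))) \<in> R (fst r)"
      by (auto simp: R_def subspace_null_directions)
  qed
  then obtain b where d: "det (\<chi> k. b k) \<noteq> 0" and b_other: "\<And>k. k \<notin> p ` Rr \<union> q ` Rr \<Longrightarrow> b k = u (e k)"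
    and b_pair: "\<And>r. r \<in> Rr \<Longrightarrow> b (p r) \<in> R (fst r) \<and> b (q r) = conj_vec (b (p r))" by blast
  let ?M = "mode (cmat A) (cmat B) (cmat C) (cmat D)"
  \<comment> \<open>Inputs are chosen only for the members at \<open>z i\<close>. The conjugate
    members receive the conjugate inputs, as \<open>feedback_exists\<close> demands.\<close>
  have "\<forall>r\<in>Rr. \<exists>w. ?M (z (fst r)) 0 (b (p r)) w"
    using b_pair by (auto simp: R_def null_directions_iff)
  from bchoice[OF this] obtain W where W: "\<And>r. r \<in> Rr \<Longrightarrow> ?M (z (fst r)) 0 (b (p r)) (W r)" by blast
  define real_mode where "real_mode k s w y \<longleftrightarrow> complex_of_real s \<in> stable_region T \<and> conj_vec (b k) = b k \<and>
      ?M (complex_of_real s) y (b k) (cvec w) \<and>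
      (case fst (e k) of None \<Rightarrow> y = 0
       | Some i \<Rightarrow> s \<in> \<Lambda> (snd (e k)) \<and> (\<exists>\<alpha>. \<alpha> \<noteq> 0 \<and> y = \<alpha> *s axis i 1))" for k s w y
  have other: "\<exists>s w y. real_mode k s w y" if k: "k \<notin> p ` Rr \<union> q ` Rr" for k
  proof (cases "fst (e k)")
    case None
    obtain i t l where l: "lab (snd (e k)) = (i, t, l)" by (cases "lab (snd (e k))")
    have "e k = (None, snd (e k))" using None by (metis prod.collapse)
    then have "snd (e k) < \<nu>\<^sub>0" using eI[of k] unfolding mode_indices_def by auto
    then have lZ: "(i, t, l) \<in> Z" using labZ l by metis
    \<comment> \<open>A label with odd index would make \<open>k\<close> a member of a pair, so the
      remaining unobservable modes are the real ones.\<close>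
    have "i = 0"
    proof (rule ccontr)
      assume "i \<noteq> 0"
      then have "(i, l) \<in> Rr" using lZ by (auto simp: Z_def Rr_def)
      moreover have "k = p (i, l) \<or> k = q (i, l)"
        using idx_lab[OF None] l by (cases t) (simp_all add: p_def q_def)
      ultimately show False using k by blast
    qed
    then have "b k \<in> S0" using uS'[of k] b_other[OF k] None l by (simp add: S_def SN_def)
    then obtain s v w where "b k = cvec v" "complex_of_real s \<in> stable_region T" "mode A B C D s 0 v w"
      by (auto simp: S0_def)
    then show ?thesis
      using None mode_cvec[of A B C D s 0 v w]
      by (auto simp: real_mode_def intro!: exI[of _ s] exI[of _ w])
  next
    case (Some i)
    then have "b k \<in> SS i (snd (e k))" using uS'[of k] b_other[OF k] by (simp add: S_def)
    then obtain s a v w where v: "b k = cvec v" "s \<in> \<Lambda> (snd (e k))" "a \<noteq> 0" "mode A B C D s (a *s axis i 1) v w"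
      by (auto simp: SS_def)
    then have "?M (complex_of_real s) (complex_of_real a *s axis i 1) (cvec v) (cvec w)"
      using mode_cvec[of A B C D s "a *s axis i 1" v w] by (simp add: cvec_scale cvec_axis)
    moreover have "complex_of_real s \<in> stable_region T" using \<Lambda>(2) v(2) by blast
    ultimately show ?thesis
      using Some v(1-3)
      by (intro exI[of _ s] exI[of _ w] exI[of _ "complex_of_real a *s axis i 1"]) (auto simp: real_mode_def)
  qed
  then have "\<forall>k. \<exists>s w y. k \<notin> p ` Rr \<union> q ` Rr \<longrightarrow> real_mode k s w y" by blast
  then obtain s w\<^sub>0 y\<^sub>0 where "\<And>k. k \<notin> p ` Rr \<union> q ` Rr \<Longrightarrow> real_mode k (s k) (w\<^sub>0 k) (y\<^sub>0 k)"
    by metis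
  then have real: "complex_of_real (s k) \<in> stable_region T \<and> conj_vec (b k) = b k \<and>
      ?M (complex_of_real (s k)) (y\<^sub>0 k) (b k) (cvec (w\<^sub>0 k)) \<and>
      (case fst (e k) of None \<Rightarrow> y\<^sub>0 k = 0
       | Some i \<Rightarrow> s k \<in> \<Lambda> (snd (e k)) \<and> (\<exists>\<alpha>. \<alpha> \<noteq> 0 \<and> y\<^sub>0 k = \<alpha> *s axis i 1))" if "k \<notin> p ` Rr \<union> q ` Rr" for k
    using that unfolding real_mode_def by blast
  define rp where "rp = inv_into Rr p"
  define rq where "rq = inv_into Rr q"
  define \<mu> where "\<mu> k = (if k \<in> p ` Rr then z (fst (rp k)) else if k \<in> q ` Rr then cnj (z (fst (rq k)))
    else complex_of_real (s k))" for k
  define w where "w k = (if k \<in> p ` Rr then W (rp k) else if k \<in> q ` Rr then conj_vec (W (rq k))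
    else cvec (w\<^sub>0 k))" for k
  define y where "y k = (if k \<in> p ` Rr \<union> q ` Rr then 0 else y\<^sub>0 k)" for k
  have at_p: "\<mu> (p r) = z (fst r)" "w (p r) = W r" "y (p r) = 0" if "r \<in> Rr" for r
    using that injp by (auto simp: \<mu>_def w_def y_def rp_def)
  have at_q: "\<mu> (q r) = cnj (z (fst r))" "w (q r) = conj_vec (W r)" "y (q r) = 0" if "r \<in> Rr" for r
  proof -
    have "q r \<notin> p ` Rr" using pq[OF _ that] by (metis imageE)
    then show "\<mu> (q r) = cnj (z (fst r))" "w (q r) = conj_vec (W r)" "y (q r) = 0"
      using that injq by (auto simp: \<mu>_def w_def y_def rq_def)
  qed
  have at_real: "\<mu> k = complex_of_real (s k)" "w k = cvec (w\<^sub>0 k)" "y k = y\<^sub>0 k" if "k \<notin> p ` Rr \<union> q ` Rr" for k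
    using that by (auto simp: \<mu>_def w_def y_def)
  have cases_k: "(\<exists>r\<in>Rr. k = p r) \<or> (\<exists>r\<in>Rr. k = q r) \<or> k \<notin> p ` Rr \<union> q ` Rr" for k by blast
  have N: "x \<in> stable_region T \<and> x \<in> invariant_zeros A B C D \<and> x \<notin> \<real>"
    if "x \<in> nonreal_stable_zeros T A B C D" for x
    using that by (auto simp: nonreal_stable_zeros_def)
  have nonreal_p: "\<mu> (p r) \<notin> \<real>" "\<mu> (p r) \<in> stable_region T" "\<mu> (p r) \<in> invariant_zeros A B C D" if "r \<in> Rr" for r
    using N[OF JF(2)[OF rJ[OF that]]] by (simp_all add: at_p[OF that])
  have nonreal_q: "\<mu> (q r) \<notin> \<real>" "\<mu> (q r) \<in> stable_region T" "\<mu> (q r) \<in> invariant_zeros A B C D" if "r \<in> Rr" for r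
    using N[OF JF(3)[OF rJ[OF that]]] unfolding at_q[OF that] by blast+
  have Some_real: "k \<notin> p ` Rr \<union> q ` Rr" if "fst (e k) \<noteq> None" for k
    using that lp(1) lq(1) by auto
  show ?thesis
  proof (rule solvable_of_modes[OF ri dc d, where \<mu> = \<mu> and w = w and y = y and e = e])
    show "bij_betw e UNIV ?I" by (rule e)
    show "?M (\<mu> k) (y k) (b k) (w k)" for k
      using cases_k[of k]
    proof (elim disjE bexE)
      fix r assume r: "r \<in> Rr" "k = p r"
      then show ?thesis using W[OF r(1)] at_p[OF r(1)] by simp
    next
      fix r assume r: "r \<in> Rr" "k = q r"
      then show ?thesis using mode_conj[OF W[OF r(1)]] at_q[OF r(1)] b_pair[OF r(1)] by simp
    next
      assume k: "k \<notin> p ` Rr \<union> q ` Rr"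
      show ?thesis using real[OF k] unfolding at_real[OF k] by blast
    qed
    show "y k = 0" if "fst (e k) = None" for k
      using real[of k] that by (cases "k \<in> p ` Rr \<union> q ` Rr") (auto simp: y_def)
    show "\<exists>\<alpha>. \<alpha> \<noteq> 0 \<and> y k = \<alpha> *s axis i 1" if "fst (e k) = Some i" for k i
    proof -
      have k: "k \<notin> p ` Rr \<union> q ` Rr" using Some_real that by simp
      show ?thesis using real[OF k] that unfolding at_real[OF k] by simp
    qed
    show "\<mu> k \<in> stable_region T" for k
      using cases_k[of k] nonreal_p(2) nonreal_q(2) real[of k] at_real(1)[of k] by auto
    show "conj_vec (b k) = b k \<and> conj_vec (w k) = w k" if "\<mu> k \<in> \<real>" for k
    proof -
      have k: "k \<notin> p ` Rr \<union> q ` Rr" using that nonreal_p(1) nonreal_q(1) by auto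
      show ?thesis using real[OF k] unfolding at_real[OF k] by simp
    qed
    show "\<exists>k'. fst (e k') = fst (e k) \<and> \<mu> k' = cnj (\<mu> k) \<and> b k' = conj_vec (b k) \<and> w k' = conj_vec (w k)"
      if "\<mu> k \<notin> \<real>" for k
      using cases_k[of k]
    proof (elim disjE bexE)
      fix r assume r: "r \<in> Rr" "k = p r"
      then show ?thesis
        using at_p[OF r(1)] at_q[OF r(1)] b_pair[OF r(1)] lp[OF r(1)] lq[OF r(1)]
        by (intro exI[of _ "q r"]) simp
    next
      fix r assume r: "r \<in> Rr" "k = q r"
      then show ?thesis
        using at_p[OF r(1)] at_q[OF r(1)] b_pair[OF r(1)] lp[OF r(1)] lq[OF r(1)]
        by (intro exI[of _ "p r"]) simp
    next
      assume k: "k \<notin> p ` Rr \<union> q ` Rr"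
      then show ?thesis using that at_real(1)[OF k] by simp
    qed
    show "inj_on \<mu> {k. fst (e k) = Some i}" for i
    proof (rule inj_onI)
      fix k k' assume kk: "k \<in> {k. fst (e k) = Some i}" "k' \<in> {k. fst (e k) = Some i}" "\<mu> k = \<mu> k'"
      have k: "k \<notin> p ` Rr \<union> q ` Rr" "k' \<notin> p ` Rr \<union> q ` Rr" using Some_real kk by simp_all
      \<comment> \<open>Equal eigenvalues force equal positions, because the sets \<Lambda> j are
        disjoint.\<close>
      have "s k \<in> \<Lambda> (snd (e k))" "s k' \<in> \<Lambda> (snd (e k'))"
        using real[OF k(1)] real[OF k(2)] kk(1,2) by simp_all
      moreover have "s k = s k'" using kk(3) unfolding at_real(1)[OF k(1)] at_real(1)[OF k(2)] by simp
      ultimately have "snd (e k) = snd (e k')" using \<Lambda>(3) by (metis IntI empty_iff)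
      then have "e k = e k'" using kk(1,2) by (simp add: prod_eq_iff)
      then show "k = k'" using einj by (simp add: inj_eq)
    qed
    show "\<mu> k \<notin> invariant_zeros A B C D" if "fst (e k) \<noteq> None" for k
    proof -
      obtain i where i: "fst (e k) = Some i" using \<open>fst (e k) \<noteq> None\<close> by blast
      have k: "k \<notin> p ` Rr \<union> q ` Rr" using Some_real that by simp
      have "s k \<in> \<Lambda> (snd (e k))" using real[OF k] i by simp
      then show ?thesis using \<Lambda>(2) unfolding at_real(1)[OF k] by blast
    qed
    show "\<mu> k \<in> invariant_zeros A B C D" if "\<mu> k \<notin> \<real>" for k
      using cases_k[of k] nonreal_p(3) nonreal_q(3) at_real(1)[of k] that by auto
  qed
qed

end

theorem theorem21:
  fixes T :: time_domain
    and A :: "real^'n^'n" and B :: "real^'m^'n" and C :: "real^'n^'p" and D :: "real^'m^'p"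
    and \<nu> :: "'p \<Rightarrow> nat" and \<nu>\<^sub>0 :: nat
    and c :: nat and z :: "nat \<Rightarrow> complex"
  assumes "right_invertible A B C D"
    and "stabilizable T A B"
    and "complex_of_real (dc_point T) \<notin> invariant_zeros A B C D"
    and "\<And>s. s \<in> invariant_zeros A B C D \<Longrightarrow> s \<in> stable_region T \<Longrightarrow>
           algebraic_mult A B C D s = geometric_mult A B C D s"
    and "bij_betw z {1..2 * c} (nonreal_stable_zeros T A B C D)"
    and "\<And>i. i \<in> {1..2 * c} \<Longrightarrow> odd i \<Longrightarrow> z (i + 1) = cnj (z i)"
    and "\<nu>\<^sub>0 + (\<Sum>i\<in>UNIV. \<nu> i) = CARD('n)"
  defines "J \<equiv> {i \<in> {1..2 * c}. odd i}"
  shows "problem_1C_solvable T A B C D \<nu>\<^sub>0 \<nu> \<longleftrightarrow>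
    (\<exists>\<eta> :: nat \<Rightarrow> nat.
       \<eta> 0 + (\<Sum>i\<in>J. 2 * \<eta> i) = \<nu>\<^sub>0 \<and>
       (\<forall>Q0 \<in> Pow {0}. \<forall>Q \<in> Pow J. \<forall>Q' \<in> Pow J. \<forall>P \<in> Pow UNIV.
          vec.dim ((\<Sum>i\<in>Q0. E_space T A B C D z i) + (\<Sum>i\<in>Q. E_space T A B C D z i) +
                   (\<Sum>i\<in>Q'. conj_vec ` E_space T A B C D z i) + (\<Sum>i\<in>P. R_star_complex A B C D i))
          \<ge> (\<Sum>i\<in>Q0. \<eta> i) + (\<Sum>i\<in>Q. \<eta> i) + (\<Sum>i\<in>Q'. \<eta> i) + (\<Sum>i\<in>P. \<nu> i)))"
    (is "?solvable \<longleftrightarrow> ?bound")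
proof
  assume ?solvable
  then obtain F \<mu> v where stab: "eigenvalues (A + B ** F) \<subseteq> stable_region T"
    and dec: "decoupling_eigenbasis A B C D F \<nu>\<^sub>0 \<nu> \<mu> v"
    and obs: "\<And>i. observable_eigenvalues A B C D F i \<inter> invariant_zeros A B C D = {}"
    and free: "eigenvalues (A + B ** F) - invariant_zeros A B C D \<subseteq> \<real>"
    unfolding problem_1C_solvable_def by blast
  note bound = eigenbasis_dimension_bound[OF assms(1,3,5,6,7) J_def[THEN meta_eq_to_obj_eq] stab dec obs free]
  show ?bound
    unfolding mode_sum_def[symmetric] Pow_iff Ball_def
    \<comment> \<open>The witness is found by unification with the counting identity, taken at empty
      index sets; the count is the same for all of them.\<close>
    by (intro exI conjI allI impI, rule bound(1)[of "{}" "{}" "{}"]; (rule bound(2))?) simp_all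
next
  assume ?bound
  then obtain \<eta> where eta: "\<eta> 0 + (\<Sum>i\<in>J. 2 * \<eta> i) = \<nu>\<^sub>0"
    and dim: "\<forall>Q0\<in>Pow {0}. \<forall>Q\<in>Pow J. \<forall>Q'\<in>Pow J. \<forall>P\<in>Pow UNIV.
      (\<Sum>i\<in>Q0. \<eta> i) + (\<Sum>i\<in>Q. \<eta> i) + (\<Sum>i\<in>Q'. \<eta> i) + (\<Sum>i\<in>P. \<nu> i)
      \<le> vec.dim (mode_sum T A B C D z Q0 Q Q' P)"
    unfolding mode_sum_def by blast
  show ?solvable
  proof (rule solvable_of_dimension_bound[OF assms(1,3,5) _ assms(7) J_def[THEN meta_eq_to_obj_eq] eta])
    show "(\<Sum>i\<in>Q0. \<eta> i) + (\<Sum>i\<in>Q. \<eta> i) + (\<Sum>i\<in>Q'. \<eta> i) + (\<Sum>i\<in>P. \<nu> i)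
      \<le> vec.dim (mode_sum T A B C D z Q0 Q Q' P)" if "Q0 \<subseteq> {0}" "Q \<subseteq> J" "Q' \<subseteq> J" for Q0 Q Q' P
      using dim that by simp
  qed (rule assms(6))
qed

end
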